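(* Assume (A1)–(A4) hold with $0<s\le2$, $\frac1\beta\le\alpha_0<1$ and $s+\frac1\beta>\alpha_0$, and suppose $\|f_\rho^*\|_{L^q(\mathcal X,\mu)}\le C_q<\infty$ for some $q>\frac{2(s\beta+1)}{2+(s-\alpha_0)\beta}$. Let $\lambda\asymp n^{-\frac{\beta}{s\beta+1}}$. Then there is a constant $C$ independent of $n$ and $\delta$ such that for every fixed $\delta\in(0,1)$, for all sufficiently large $n$, with probability at least $1-\delta$, $$\|\hat f_\lambda-f_\lambda\|_{L^2(\mathcal X,\mu)}\le\ln\frac4\delta\;C\,n^{-\frac12\frac{s\beta}{s\beta+1}}.$$
   Context: Setup. $\mathcal X\subseteq\mathbb R^d$; $\rho$ is a distribution on $\mathcal X\times\mathbb R$ with $\int y^2d\rho<\infty$, marginal $\mu$, $f_\rho^*(x)=\int y\,d\rho(y|x)$. $\mathcal H$ is a separable RKHS with continuous kernel $k$, $\sup_xk(x,x)\le\kappa^2$. $(Tf)(x)=\int k(x,y)f(y)d\mu(y)$ on $L^2(\mathcal X,\mu)$ has decomposition $T=\sum_{i\in N}\lambda_i\langle\cdot,e_i\rangle_{L^2}e_i$, $k(x,y)=\sum_i\lambda_ie_i(x)e_i(y)$, $(\lambda_i)$ positive non-increasing summable, $(e_i)$ orthonormal in $L^2(\mu)$. $[\mathcal H]^s=\{\sum\lambda_i^{s/2}a_ie_i:\sum a_i^2<\infty\}$, norm $(\sum a_i^2)^{1/2}$. For $\alpha>0$, $M_\alpha\in[0,\infty]$ is the smallest $A$ with $\sum_i\lambda_i^\alpha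 e_i(x)^2\le A^2$ for $\mu$-a.e. $x$. $T$ is also viewed as an operator on $\mathcal H$, $Tf=\int k(x,\cdot)f(x)d\mu(x)$; $g=Tf_\rho^*$; $f_\lambda=(T+\lambda)^{-1}g\in\mathcal H$. Given an i.i.d. sample $(x_i,y_i)_{i=1}^n\sim\rho$, $\hat f_\lambda=\arg\min_{f\in\mathcal H}\big(\frac1n\sum(y_i-f(x_i))^2+\lambda\|f\|_{\mathcal H}^2\big)$. $\lambda\asymp n^{-a}$ means $c_1n^{-a}\le\lambda_n\le c_2n^{-a}$ with constants independent of $n$. (A1) $N=\{1,2,\dots\}$, $ci^{-\beta}\le\lambda_i\le Ci^{-\beta}$ for some $\beta>1$, $c,C>0$. (A2) $\alpha_0:=\inf\{\alpha\in[\frac1\beta,1]:M_\alpha<\infty\}$. (A3) $\|f_\rho^*\|_{[\mathcal H]^s}\le R$. (A4) with $\epsilon=y-f_\rho^*(x)$, $\mathbb E(|\epsilon|^m\mid x)\le\frac12m!\sigma^2L^{m-2}$ for all $m\ge2$, $\mu$-a.e. $x$. *)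

theory Defs
  imports "HOL-Probability.Probability"
begin

text \<open>The marginal of rho on X (rho lives on X x R with the trace Borel sigma algebra).\<close>
definition marginal :: "('a::euclidean_space \<times> real) measure \<Rightarrow> 'a set \<Rightarrow> 'a measure" where
  "marginal \<rho> X = distr \<rho> (restrict_space borel X) fst"

text \<open>K x is the conditional distribution rho(y|x); the regression function is its mean.\<close>
definition regfun :: "('a \<Rightarrow> real measure) \<Rightarrow> 'a \<Rightarrow> real" where
  "regfun K x = (\<integral>y. y \<partial>(K x))"

definition disintegration ::
  "('a::euclidean_space \<times> real) measure \<Rightarrow> 'a set \<Rightarrow> ('a \<Rightarrow> real measure) \<Rightarrow> bool" where
  "disintegration \<rho> X K \<longleftrightarrow>
     K \<in> restrict_space borel X \<rightarrow>\<^sub>M prob_algebra borel \<and>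
     (\<forall>A\<in>sets \<rho>. emeasure \<rho> A = (\<integral>\<^sup>+x. emeasure (K x) (Pair x -` A) \<partial>marginal \<rho> X))"

text \<open>The Hilbert space 'h is (a copy of) the RKHS of k on X: the element h is the
  function x \<mapsto> h \<bullet> Phi x (this map is injective), and Phi x plays the role of k(x, .),
  so the reproducing property and k x y = <k(x,.), k(y,.)> hold.\<close>
definition rkhs_model :: "'a set \<Rightarrow> ('a \<Rightarrow> 'a \<Rightarrow> real) \<Rightarrow> ('a \<Rightarrow> 'h::real_inner) \<Rightarrow> bool" where
  "rkhs_model X k \<Phi> \<longleftrightarrow>
     (\<forall>x\<in>X. \<forall>y\<in>X. k x y = \<Phi> x \<bullet> \<Phi> y) \<and>
     (\<forall>h. (\<forall>x\<in>X. h \<bullet> \<Phi> x = 0) \<longrightarrow> h = 0)"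

definition T_H :: "'a measure \<Rightarrow> ('a \<Rightarrow> 'h::{real_inner,complete_space,second_countable_topology}) \<Rightarrow> 'h \<Rightarrow> 'h" where
  "T_H \<mu> \<Phi> h = (\<integral>x. (h \<bullet> \<Phi> x) *\<^sub>R \<Phi> x \<partial>\<mu>)"

definition g_H :: "'a measure \<Rightarrow> ('a \<Rightarrow> 'h::{real_inner,complete_space,second_countable_topology}) \<Rightarrow> ('a \<Rightarrow> real) \<Rightarrow> 'h" where
  "g_H \<mu> \<Phi> f = (\<integral>x. f x *\<^sub>R \<Phi> x \<partial>\<mu>)"

definition f_lambda :: "'a measure \<Rightarrow> ('a \<Rightarrow> 'h::{real_inner,complete_space,second_countable_topology}) \<Rightarrow> ('a \<Rightarrow> real) \<Rightarrow> real \<Rightarrow> 'h" where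
  "f_lambda \<mu> \<Phi> f lam = (THE h. T_H \<mu> \<Phi> h + lam *\<^sub>R h = g_H \<mu> \<Phi> f)"

definition emp_obj :: "('a \<Rightarrow> 'h::real_inner) \<Rightarrow> real \<Rightarrow> nat \<Rightarrow> (nat \<Rightarrow> 'a \<times> real) \<Rightarrow> 'h \<Rightarrow> real" where
  "emp_obj \<Phi> lam n z h =
     (1 / real n) * (\<Sum>i<n. (snd (z i) - h \<bullet> \<Phi> (fst (z i)))\<^sup>2) + lam * (norm h)\<^sup>2"

definition krr :: "('a \<Rightarrow> 'h::real_inner) \<Rightarrow> real \<Rightarrow> nat \<Rightarrow> (nat \<Rightarrow> 'a \<times> real) \<Rightarrow> 'h" where
  "krr \<Phi> lam n z = (THE h. \<forall>h'. emp_obj \<Phi> lam n z h \<le> emp_obj \<Phi> lam n z h')"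

definition L2norm :: "'a measure \<Rightarrow> ('a \<Rightarrow> real) \<Rightarrow> real" where
  "L2norm \<mu> f = sqrt (\<integral>x. (f x)\<^sup>2 \<partial>\<mu>)"

definition in_L2 :: "'a measure \<Rightarrow> ('a \<Rightarrow> real) \<Rightarrow> bool" where
  "in_L2 \<mu> f \<longleftrightarrow> f \<in> borel_measurable \<mu> \<and> integrable \<mu> (\<lambda>x. (f x)\<^sup>2)"

definition T_L2 :: "'a measure \<Rightarrow> ('a \<Rightarrow> 'a \<Rightarrow> real) \<Rightarrow> ('a \<Rightarrow> real) \<Rightarrow> 'a \<Rightarrow> real" where
  "T_L2 \<mu> k f x = (\<integral>y. k x y * f y \<partial>\<mu>)"

text \<open>Spectral data: (lam i) positive, non-increasing, summable; (e i) orthonormal in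
  L^2(mu); T = sum_i lam_i <., e_i> e_i (series converging in L^2(mu) for every f in L^2);
  k(x,y) = sum_i lam_i e_i(x) e_i(y). Index set N = nat (index i here is i+1 in the paper).\<close>
definition spectral_decomp ::
  "'a measure \<Rightarrow> ('a \<Rightarrow> 'a \<Rightarrow> real) \<Rightarrow> (nat \<Rightarrow> real) \<Rightarrow> (nat \<Rightarrow> 'a \<Rightarrow> real) \<Rightarrow> bool" where
  "spectral_decomp \<mu> k lam e \<longleftrightarrow>
     (\<forall>i. 0 < lam i) \<and> (\<forall>i. lam (Suc i) \<le> lam i) \<and> summable lam \<and>
     (\<forall>i. in_L2 \<mu> (e i)) \<and>
     (\<forall>i j. (\<integral>x. e i x * e j x \<partial>\<mu>) = (if i = j then 1 else 0)) \<and>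
     (\<forall>f. in_L2 \<mu> f \<longrightarrow>
        (\<lambda>m. \<integral>x. (T_L2 \<mu> k f x - (\<Sum>i<m. lam i * (\<integral>y. f y * e i y \<partial>\<mu>) * e i x))\<^sup>2 \<partial>\<mu>)
          \<longlonglongrightarrow> 0) \<and>
     (AE x in \<mu>. AE y in \<mu>. (\<lambda>i. lam i * e i x * e i y) sums k x y)"

definition M_finite :: "'a measure \<Rightarrow> (nat \<Rightarrow> real) \<Rightarrow> (nat \<Rightarrow> 'a \<Rightarrow> real) \<Rightarrow> real \<Rightarrow> bool" where
  "M_finite \<mu> lam e \<alpha> \<longleftrightarrow>
     (\<exists>A::real. AE x in \<mu>. \<forall>m. (\<Sum>i<m. lam i powr \<alpha> * (e i x)\<^sup>2) \<le> A\<^sup>2)"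

definition alpha0 :: "'a measure \<Rightarrow> (nat \<Rightarrow> real) \<Rightarrow> (nat \<Rightarrow> 'a \<Rightarrow> real) \<Rightarrow> real \<Rightarrow> real" where
  "alpha0 \<mu> lam e \<beta> = Inf {\<alpha>. 1 / \<beta> \<le> \<alpha> \<and> \<alpha> \<le> 1 \<and> M_finite \<mu> lam e \<alpha>}"

definition interp_norm_le ::
  "'a measure \<Rightarrow> (nat \<Rightarrow> real) \<Rightarrow> (nat \<Rightarrow> 'a \<Rightarrow> real) \<Rightarrow> real \<Rightarrow> real \<Rightarrow> ('a \<Rightarrow> real) \<Rightarrow> bool" where
  "interp_norm_le \<mu> lam e s R f \<longleftrightarrow>
     (\<exists>a. summable (\<lambda>i. (a i)\<^sup>2) \<and> (\<Sum>i. (a i)\<^sup>2) \<le> R\<^sup>2 \<and>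
        (\<lambda>m. \<integral>x. (f x - (\<Sum>i<m. lam i powr (s / 2) * a i * e i x))\<^sup>2 \<partial>\<mu>) \<longlonglongrightarrow> 0)"

end

theory Submission
  imports Defs
begin

text \<open>Let \<open>T\<close> be the covariance operator on the RKHS, \<open>T_X\<close> its empirical version, \<open>l\<close> the regularisation
  parameter and \<open>u\<close> the difference of the ridge estimator and its population version. Then
  \<open>(T_X + l) u = \<xi>\<close> with a centred average \<open>\<xi>\<close>. If \<open>T_X + l \<ge> (T + l) / 8\<close> as quadratic forms, testing this
  equation against \<open>u\<close> bounds the L2 norm of \<open>u\<close> by 8 times the norm of \<open>(T + l) powr (-1/2) \<xi>\<close>.

  The form inequality is reduced to the first \<open>n ^ g\<close> eigenfunctions, the remaining ones being uniformly small
  because \<open>\<alpha> < 1\<close> for some exponent with finite \<open>M_\<alpha>\<close>. On these, a fixed but high trace moment of the whitened deviation tends to 0: the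
  whitened feature vectors have squared norm of order \<open>l powr (- \<alpha>)\<close>, which is smaller than \<open>n\<close> by a power of
  \<open>n\<close>, and this beats the polynomial dimension.

  The average \<open>\<xi>\<close> splits into a noise part and an approximation part. For the noise, the expectation of
  \<open>cosh (t * norm S)\<close>, with \<open>S\<close> the sum and \<open>t\<close> the reciprocal of its standard deviation, stays bounded, which gives an
  exponential tail. The variance of the approximation part is of strictly smaller order because
  \<open>\<alpha> < s + 1 / \<beta>\<close>, so Chebyshev's inequality suffices once \<open>n\<close> is large in terms of the confidence
  level.\<close>

section \<open>Traces of powers of symmetric matrices\<close>

text \<open>The two parts of \<open>\<xi>\<close> are treated differently because the constant must
  not depend on \<delta>. The noise is exactly of the size of the target rate, so an exponential
  tail is needed to turn \<delta> into a factor \<open>ln (4 / \<delta>)\<close>. The whitened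
  approximation part has second moment of order \<open>l powr (s - \<alpha>)\<close>, against
  \<open>l powr (- 1 / \<beta>)\<close> for the noise; the gap is a power of n and beats any fixed
  \<delta>. The operator comparison is similar: a fixed relative error suffices, so a failure
  probability decaying like a power of n is enough, and the trace moments behind it need only
  algebra and independence, no matrix exponentials. The infimum over admissible exponents need not
  be attained. Its upper bounds are strict, so a slightly larger \<alpha> with finite
  \<open>M_\<alpha>\<close> satisfies them too. The eigenfunctions are known only almost everywhere,
  and their representatives in the Hilbert space need not span it. Pointwise facts are therefore
  confined to a set of full measure, vectors are expanded only where this is proved, and
  \<open>(T + l) powr (-1/2)\<close> is replaced by finite truncations with bounds uniform in the
  truncation index.\<close>

context
  fixes m :: nat
begin

text \<open>The dimension grows with the sample, so matrices are functions on indices rather than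
  elements of a type of fixed size. Entries outside the block are set to 0, which makes
  associativity and additivity of powers equalities of functions.\<close>

definition mmult :: "(nat \<Rightarrow> nat \<Rightarrow> real) \<Rightarrow> (nat \<Rightarrow> nat \<Rightarrow> real) \<Rightarrow> nat \<Rightarrow> nat \<Rightarrow> real" where
  "mmult A B = (\<lambda>i j. if i < m \<and> j < m then \<Sum>k<m. A i k * B k j else 0)"

fun mpow :: "(nat \<Rightarrow> nat \<Rightarrow> real) \<Rightarrow> nat \<Rightarrow> nat \<Rightarrow> nat \<Rightarrow> real" where
  "mpow A 0 = (\<lambda>i j. if i = j \<and> i < m then 1 else 0)"
| "mpow A (Suc k) = mmult A (mpow A k)"

definition mtrace :: "(nat \<Rightarrow> nat \<Rightarrow> real) \<Rightarrow> real" where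
  "mtrace A = (\<Sum>i<m. A i i)"

definition hs_inner :: "(nat \<Rightarrow> nat \<Rightarrow> real) \<Rightarrow> (nat \<Rightarrow> nat \<Rightarrow> real) \<Rightarrow> real" where
  "hs_inner A B = (\<Sum>i<m. \<Sum>j<m. A i j * B i j)"

definition symm :: "(nat \<Rightarrow> nat \<Rightarrow> real) \<Rightarrow> bool" where
  "symm A \<longleftrightarrow> (\<forall>i j. A i j = A j i)"

lemma mmult_assoc: "mmult (mmult A B) C = mmult A (mmult B C)"
proof (intro ext)
  fix i j
  show "mmult (mmult A B) C i j = mmult A (mmult B C) i j"
  proof (cases "i < m \<and> j < m")
    case True
    have "(\<Sum>k<m. (\<Sum>l<m. A i l * B l k) * C k j) = (\<Sum>k<m. \<Sum>l<m. A i l * B l k * C k j)"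
      by (simp add: sum_distrib_right)
    also have "\<dots> = (\<Sum>l<m. \<Sum>k<m. A i l * B l k * C k j)" by (rule sum.swap)
    also have "\<dots> = (\<Sum>l<m. A i l * (\<Sum>k<m. B l k * C k j))"
      by (simp add: sum_distrib_left mult.assoc)
    finally show ?thesis using True by (simp add: mmult_def)
  qed (auto simp: mmult_def)
qed

lemma mpow_outside: "\<not> (i < m \<and> j < m) \<Longrightarrow> mpow A k i j = 0"
  by (cases k) (auto simp: mmult_def)

text \<open>\<open>mpow X 0\<close> is the unit of the block only, hence the condition that B
  vanishes outside it.\<close>

lemma mmult_one_left:
  assumes "\<And>i j. \<not> (i < m \<and> j < m) \<Longrightarrow> B i j = 0"
  shows "mmult (mpow X 0) B = B"
proof (intro ext)
  fix i j
  show "mmult (mpow X 0) B i j = B i j"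
  proof (cases "i < m \<and> j < m")
    case True
    have "(\<Sum>l<m. mpow X 0 i l * B l j) = (\<Sum>l<m. if l = i then B i j else 0)"
      using True by (intro sum.cong) auto
    then show ?thesis using True by (simp add: mmult_def)
  qed (use assms in \<open>auto simp: mmult_def\<close>)
qed

lemma mpow_add: "mmult (mpow A k) (mpow A l) = mpow A (k + l)"
proof (induction k)
  case 0
  have "mmult (mpow A 0) (mpow A l) = mpow A l" by (rule mmult_one_left) (rule mpow_outside)
  then show ?case by simp
qed (simp add: mmult_assoc)

lemma mtrace_mmult_commute: "mtrace (mmult A B) = mtrace (mmult B A)"
proof -
  have "mtrace (mmult A B) = (\<Sum>i<m. \<Sum>k<m. A i k * B k i)" by (simp add: mtrace_def mmult_def)
  also have "\<dots> = (\<Sum>k<m. \<Sum>i<m. A i k * B k i)" by (rule sum.swap)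
  finally show ?thesis by (simp add: mtrace_def mmult_def mult.commute)
qed

lemma hs_inner_eq_mtrace: "hs_inner A B = mtrace (mmult (\<lambda>i j. A j i) B)"
proof -
  have "hs_inner A B = (\<Sum>j<m. \<Sum>i<m. A i j * B i j)" unfolding hs_inner_def by (rule sum.swap)
  then show ?thesis by (simp add: mtrace_def mmult_def)
qed

lemma transpose_mmult: "(\<lambda>i j. mmult A B j i) = mmult (\<lambda>i j. B j i) (\<lambda>i j. A j i)"
  by (auto simp: mmult_def mult.commute fun_eq_iff)

lemma mpow_Suc_right: "mpow A (Suc k) = mmult (mpow A k) (mpow A (Suc 0))"
  using mpow_add[of A k "Suc 0"] by simp

lemma symm_mpow: assumes "symm A" shows "(\<lambda>i j. mpow A k j i) = mpow A k"
proof (induction k)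
  case 0
  then show ?case by (auto simp: fun_eq_iff)
next
  case (Suc k)
  \<comment> \<open>A may be nonzero outside the block, so the first power is the truncation of A,
    not A itself.\<close>
  have *: "mpow A (Suc 0) = (\<lambda>i j. if i < m \<and> j < m then A i j else 0)"
  proof (intro ext)
    fix i j
    show "mpow A (Suc 0) i j = (if i < m \<and> j < m then A i j else 0)"
    proof (cases "i < m \<and> j < m")
      case True
      have "(\<Sum>l<m. A i l * mpow A 0 l j) = (\<Sum>l<m. if l = j then A i j else 0)"
        using True by (intro sum.cong) auto
      then show ?thesis using True by (simp add: mmult_def)
    qed (auto simp: mmult_def)
  qed
  have "(\<lambda>i j. mpow A (Suc k) j i) = mmult (\<lambda>i j. mpow A k j i) (\<lambda>i j. A j i)"
    by (simp add: transpose_mmult)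
  also have "\<dots> = mmult (mpow A k) A" using Suc assms by (simp add: symm_def)
  also have "\<dots> = mmult (mpow A k) (mpow A (Suc 0))" unfolding * by (auto simp: mmult_def fun_eq_iff)
  also have "\<dots> = mpow A (Suc k)" by (rule mpow_Suc_right[symmetric])
  finally show ?case .
qed

lemma hs_inner_Cauchy_Schwarz: "(hs_inner A B)\<^sup>2 \<le> hs_inner A A * hs_inner B B"
proof -
  have "hs_inner P Q = (\<Sum>p\<in>{..<m}\<times>{..<m}. P (fst p) (snd p) * Q (fst p) (snd p))" for P Q
    unfolding hs_inner_def by (subst sum.cartesian_product) (simp add: case_prod_beta)
  then show ?thesis
    using Cauchy_Schwarz_ineq_sum[of "\<lambda>p. A (fst p) (snd p)" "\<lambda>p. B (fst p) (snd p)" "{..<m}\<times>{..<m}"]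
    by (simp add: power2_eq_square)
qed

lemma hs_inner_self_nonneg: "0 \<le> hs_inner A A"
  unfolding hs_inner_def by (intro sum_nonneg) auto

text \<open>This is the telescoping of \<open>X ^ k - Y ^ k\<close> into words
  \<open>X ^ q * (X - Y) * Y ^ (k - 1 - q)\<close>, tested under a trace. The left factor C is
  arbitrary because each induction step moves one X into it.\<close>

lemma mtrace_mpow_diff:
  "mtrace (mmult C (mpow X k)) - mtrace (mmult C (mpow Y k)) =
   (\<Sum>q<k. mtrace (mmult C (mmult (mpow X q) (mmult (\<lambda>i j. X i j - Y i j) (mpow Y (k - 1 - q))))))"
proof (induction k arbitrary: C)
  case 0
  then show ?case by simp
next
  case (Suc k)
  let ?D = "\<lambda>i j. X i j - Y i j"
  have tr_diff: "mtrace (mmult C (mmult ?D Z)) = mtrace (mmult (mmult C X) Z) - mtrace (mmult (mmult C Y) Z)" for Z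
  proof -
    have "mmult C (mmult ?D Z) i j = mmult C (mmult X Z) i j - mmult C (mmult Y Z) i j" for i j
      by (auto simp: mmult_def left_diff_distrib right_diff_distrib sum_subtractf)
    then show ?thesis by (simp add: mtrace_def sum_subtractf mmult_assoc)
  qed
  have "mtrace (mmult C (mpow X (Suc k))) - mtrace (mmult C (mpow Y (Suc k)))
      = (mtrace (mmult (mmult C X) (mpow X k)) - mtrace (mmult (mmult C X) (mpow Y k)))
        + (mtrace (mmult (mmult C X) (mpow Y k)) - mtrace (mmult (mmult C Y) (mpow Y k)))"
    by (simp add: mmult_assoc)
  also have "mtrace (mmult (mmult C X) (mpow Y k)) - mtrace (mmult (mmult C Y) (mpow Y k))
      = mtrace (mmult C (mmult (mpow X 0) (mmult ?D (mpow Y k))))"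
  proof -
    have "mmult C (mmult (mpow X 0) (mmult ?D (mpow Y k))) = mmult (mmult (mmult C (mpow X 0)) ?D) (mpow Y k)"
      by (simp add: mmult_assoc)
    also have "mmult (mmult C (mpow X 0)) ?D = mmult C ?D"
    proof (intro ext)
      fix i j
      have "mmult C (mpow X 0) i l = C i l" if "i < m" "l < m" for l
      proof -
        have "(\<Sum>n<m. C i n * mpow X 0 n l) = (\<Sum>n<m. if n = l then C i l else 0)"
          by (intro sum.cong) auto
        then show ?thesis using that by (simp add: mmult_def)
      qed
      then show "mmult (mmult C (mpow X 0)) ?D i j = mmult C ?D i j"
        unfolding mmult_def[of "mmult C (mpow X 0)"] mmult_def[of C ?D] by auto
    qed
    finally show ?thesis by (simp add: mmult_assoc tr_diff)
  qed
  also have "mtrace (mmult (mmult C X) (mpow X k)) - mtrace (mmult (mmult C X) (mpow Y k))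
     = (\<Sum>q<k. mtrace (mmult C (mmult (mpow X (Suc q)) (mmult ?D (mpow Y (Suc k - 1 - Suc q))))))"
    by (subst Suc) (simp add: mmult_assoc)
  finally show ?case
    by (subst sum.lessThan_Suc_shift) simp
qed

end

lemma log_convex_le_ends:
  fixes H :: "nat \<Rightarrow> real"
  assumes nonneg: "\<And>a. 0 \<le> H a"
    and lc: "\<And>a. 0 < a \<Longrightarrow> a < r \<Longrightarrow> (H a)\<^sup>2 \<le> H (a - 1) * H (a + 1)"
    and "a \<le> r"
  shows "H a \<le> max (H 0) (H r)"
proof -
  define G where "G = Max (H ` {..r})"
  have G: "\<And>b. b \<le> r \<Longrightarrow> H b \<le> G" unfolding G_def by auto
  have "G \<in> H ` {..r}" unfolding G_def by (rule Max_in) auto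
  then have "\<exists>b. b \<le> r \<and> H b = G" by auto
  define b where "b = (LEAST b. b \<le> r \<and> H b = G)"
  have b: "b \<le> r" "H b = G" using LeastI_ex[OF \<open>\<exists>b. b \<le> r \<and> H b = G\<close>] by (auto simp: b_def)
  have least: "H c \<noteq> G" if "c < b" for c
    using not_less_Least[of c "\<lambda>b. b \<le> r \<and> H b = G"] that b by (auto simp: b_def)
  have "b = 0 \<or> b = r"
  proof (rule ccontr)
    assume "\<not> (b = 0 \<or> b = r)"
    then have b': "0 < b" "b < r" using b by auto
    have lt: "H (b - 1) < G" using least[of "b - 1"] G[of "b - 1"] b' by force
    have "0 < G" using lt nonneg[of "b - 1"] by linarith
    have "G\<^sup>2 \<le> H (b - 1) * H (b + 1)" using lc[OF b'] b by simp
    also have "\<dots> \<le> H (b - 1) * G" using G[of "b+1"] b' nonneg by (intro mult_left_mono) auto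
    also have "\<dots> < G * G" using lt \<open>0 < G\<close> by simp
    finally show False by (simp add: power2_eq_square)
  qed
  then show ?thesis using b G[OF \<open>a \<le> r\<close>] by auto
qed

text \<open>With \<open>U a = X ^ a * A * Y ^ (r - a)\<close> the trace on the left is the Hilbert-Schmidt inner product of
  \<open>U a\<close> and \<open>U b\<close> for every splitting \<open>q = a + b\<close>, so the squared norms of the \<open>U a\<close> are log-convex in \<open>a\<close>.\<close>
lemma mtrace_alternating_le:
  assumes "symm A" "symm X" "symm Y" "q \<le> 2 * r"
  shows "mtrace m (mmult m A (mmult m (mpow m X q) (mmult m A (mpow m Y (2 * r - q)))))
    \<le> hs_inner m (mmult m A (mpow m X r)) (mmult m A (mpow m X r))
      + hs_inner m (mmult m A (mpow m Y r)) (mmult m A (mpow m Y r))"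
proof -
  define U where "U a = mmult m (mpow m X a) (mmult m A (mpow m Y (r - a)))" for a
  have tA: "(\<lambda>i j. A j i) = A" using assms(1) by (auto simp: symm_def)
  have UU: "hs_inner m (U a) (U b) =
      mtrace m (mmult m A (mmult m (mpow m X (a + b)) (mmult m A (mpow m Y (2 * r - (a + b))))))"
    if "a \<le> r" "b \<le> r" for a b
  proof -
    have "hs_inner m (U a) (U b) = mtrace m (mmult m (mmult m (mmult m (mpow m Y (r - a)) A) (mpow m X a))
       (mmult m (mpow m X b) (mmult m A (mpow m Y (r - b)))))"
      unfolding hs_inner_eq_mtrace U_def transpose_mmult
      by (simp add: symm_mpow assms tA)
    also have "\<dots> = mtrace m (mmult m (mpow m Y (r - a))
       (mmult m A (mmult m (mmult m (mpow m X a) (mpow m X b)) (mmult m A (mpow m Y (r - b))))))"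
      by (simp add: mmult_assoc)
    also have "\<dots> = mtrace m (mmult m (mmult m A (mmult m (mmult m (mpow m X a) (mpow m X b)) (mmult m A (mpow m Y (r - b)))))
          (mpow m Y (r - a)))"
      by (rule mtrace_mmult_commute)
    also have "\<dots> = mtrace m (mmult m A (mmult m (mmult m (mpow m X a) (mpow m X b)) (mmult m A
          (mmult m (mpow m Y (r - b)) (mpow m Y (r - a))))))"
      by (simp add: mmult_assoc)
    also have "\<dots> = mtrace m (mmult m A (mmult m (mpow m X (a + b)) (mmult m A (mpow m Y ((r - b) + (r - a))))))"
      by (simp only: mpow_add)
    also have "(r - b) + (r - a) = 2 * r - (a + b)" using that by simp
    finally show ?thesis .
  qed
  define H where "H a = hs_inner m (U a) (U a)" for a
  have max: "H a \<le> max (H 0) (H r)" if "a \<le> r" for a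
  proof (rule log_convex_le_ends)
    fix a assume a: "0 < a" "a < r"
    \<comment> \<open>Since \<open>a + a = (a - 1) + (a + 1)\<close>, the inner product of the two
      neighbours is the same trace, and Cauchy-Schwarz yields log-convexity.\<close>
    have "H a = hs_inner m (U (a - 1)) (U (a + 1))"
      unfolding H_def using a by (subst (1 2) UU) (auto simp: mult_2)
    then show "(H a)\<^sup>2 \<le> H (a - 1) * H (a + 1)"
      unfolding H_def by (simp add: hs_inner_Cauchy_Schwarz)
  qed (use that in \<open>auto simp: H_def hs_inner_self_nonneg\<close>)
  obtain a b where ab: "a \<le> r" "b \<le> r" "q = a + b"
  proof
    show "min q r \<le> r" "q - min q r \<le> r" "q = min q r + (q - min q r)" using assms(4) by auto
  qed
  have nn: "0 \<le> max (H 0) (H r)" by (simp add: H_def hs_inner_self_nonneg le_max_iff_disj)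
  have "(hs_inner m (U a) (U b))\<^sup>2 \<le> H a * H b" unfolding H_def by (rule hs_inner_Cauchy_Schwarz)
  also have "\<dots> \<le> max (H 0) (H r) * max (H 0) (H r)"
    using max ab nn by (intro mult_mono) (auto simp: H_def hs_inner_self_nonneg)
  finally have "hs_inner m (U a) (U b) \<le> max (H 0) (H r)"
    using nn by (metis abs_le_square_iff abs_of_nonneg abs_ge_self order_trans power2_eq_square)
  also have "\<dots> \<le> H 0 + H r" by (simp add: H_def hs_inner_self_nonneg)
  also have "H 0 = hs_inner m (mmult m A (mpow m Y r)) (mmult m A (mpow m Y r))"
  proof -
    have "mmult m (mpow m X 0) (mmult m A Z) = mmult m A Z" for Z
      by (rule mmult_one_left) (auto simp: mmult_def)
    then show ?thesis
      unfolding H_def by (subst UU) (auto simp: hs_inner_eq_mtrace transpose_mmult symm_mpow assms tA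
        mmult_assoc mtrace_mmult_commute[of m "mpow m Y r"] mpow_add mult_2 simp del: mpow.simps)
  qed
  \<comment> \<open>\<open>U r\<close> is \<open>X ^ r * A\<close>; cyclicity of the trace and
    symmetry give it the norm of \<open>A * X ^ r\<close>.\<close>
  also have "H r = hs_inner m (mmult m A (mpow m X r)) (mmult m A (mpow m X r))"
  proof -
    let ?Z = "mpow m X (r + r)"
    have "mtrace m (mmult m A (mmult m ?Z (mmult m A (mpow m Y 0))))
        = mtrace m (mmult m (mpow m Y 0) (mmult m A (mmult m ?Z A)))"
      by (subst (2) mtrace_mmult_commute) (simp only: mmult_assoc)
    also have "mmult m (mpow m Y 0) (mmult m A (mmult m ?Z A)) = mmult m A (mmult m ?Z A)"
      by (rule mmult_one_left) (auto simp: mmult_def)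
    also have "mtrace m (mmult m A (mmult m ?Z A)) = mtrace m (mmult m A (mmult m A ?Z))"
      by (metis mmult_assoc mtrace_mmult_commute)
    finally show ?thesis
      unfolding H_def by (subst UU) (auto simp: hs_inner_eq_mtrace transpose_mmult symm_mpow assms tA
        mmult_assoc mtrace_mmult_commute[of m "mpow m X r"] mpow_add mult_2 simp del: mpow.simps)
  qed
  finally show ?thesis using UU[OF ab(1,2)] ab(3) by simp
qed

section \<open>Moments of centred sums of random rank-one matrices\<close>

text \<open>Closed under sums and products, so every polynomial in the entries of the random
  matrices is integrable at once.\<close>

definition bounded_rv :: "'b measure \<Rightarrow> ('b \<Rightarrow> real) \<Rightarrow> bool" where
  "bounded_rv P f \<longleftrightarrow> f \<in> borel_measurable P \<and> (\<exists>C. \<forall>x\<in>space P. \<bar>f x\<bar> \<le> C)"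

lemma bounded_rv_const: "bounded_rv P (\<lambda>_. c)"
  by (auto simp: bounded_rv_def)

lemma bounded_rv_add:
  assumes "bounded_rv P f" "bounded_rv P g" shows "bounded_rv P (\<lambda>x. f x + g x)"
proof -
  obtain C D where "\<forall>x\<in>space P. \<bar>f x\<bar> \<le> C" "\<forall>x\<in>space P. \<bar>g x\<bar> \<le> D"
    using assms by (auto simp: bounded_rv_def)
  then have "\<forall>x\<in>space P. \<bar>f x + g x\<bar> \<le> C + D" by fastforce
  then show ?thesis using assms by (auto simp: bounded_rv_def)
qed

lemma bounded_rv_mult:
  assumes "bounded_rv P f" "bounded_rv P g" shows "bounded_rv P (\<lambda>x. f x * g x)"
proof -
  obtain C D where "\<forall>x\<in>space P. \<bar>f x\<bar> \<le> C" "\<forall>x\<in>space P. \<bar>g x\<bar> \<le> D"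
    using assms by (auto simp: bounded_rv_def)
  then have "\<forall>x\<in>space P. \<bar>f x * g x\<bar> \<le> \<bar>C\<bar> * \<bar>D\<bar>"
    by (auto simp: abs_mult intro!: mult_mono)
  then show ?thesis using assms by (auto simp: bounded_rv_def)
qed

lemma bounded_rv_sum:
  assumes "\<And>i. i \<in> S \<Longrightarrow> bounded_rv P (f i)" shows "bounded_rv P (\<lambda>x. \<Sum>i\<in>S. f i x)"
  using assms
  by (induction S rule: infinite_finite_induct) (auto intro: bounded_rv_const bounded_rv_add)

lemma bounded_rv_compose:
  assumes "bounded_rv P f" "g \<in> measurable Q P" shows "bounded_rv Q (\<lambda>x. f (g x))"
  using assms unfolding bounded_rv_def by (auto dest: measurable_space)

lemma (in finite_measure) bounded_rv_integrable:
  assumes "bounded_rv M f" shows "integrable M f"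
proof -
  obtain C where "f \<in> borel_measurable M" "\<forall>x\<in>space M. \<bar>f x\<bar> \<le> C"
    using assms by (auto simp: bounded_rv_def)
  then show ?thesis by (intro integrable_const_bound[where B=C]) auto
qed

definition bounded_rmat :: "nat \<Rightarrow> 'b measure \<Rightarrow> ('b \<Rightarrow> nat \<Rightarrow> nat \<Rightarrow> real) \<Rightarrow> bool" where
  "bounded_rmat m P F \<longleftrightarrow> (\<forall>i<m. \<forall>j<m. bounded_rv P (\<lambda>z. F z i j))"

lemma bounded_rmat_mmult:
  assumes "bounded_rmat m P F" "bounded_rmat m P G"
  shows "bounded_rmat m P (\<lambda>z. mmult m (F z) (G z))"
  unfolding bounded_rmat_def mmult_def using assms
  by (auto intro!: bounded_rv_sum bounded_rv_mult simp: bounded_rmat_def)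

lemma bounded_rmat_mpow:
  assumes "bounded_rmat m P F" shows "bounded_rmat m P (\<lambda>z. mpow m (F z) k)"
proof (induction k)
  case 0
  then show ?case by (auto simp: bounded_rmat_def intro: bounded_rv_const)
qed (simp add: assms bounded_rmat_mmult)

lemma bounded_rv_mtrace:
  "bounded_rmat m P F \<Longrightarrow> bounded_rv P (\<lambda>z. mtrace m (F z))"
  unfolding mtrace_def bounded_rmat_def by (intro bounded_rv_sum) auto

lemma bounded_rv_hs_inner:
  "bounded_rmat m P F \<Longrightarrow> bounded_rmat m P G \<Longrightarrow> bounded_rv P (\<lambda>z. hs_inner m (F z) (G z))"
  unfolding hs_inner_def bounded_rmat_def by (intro bounded_rv_sum bounded_rv_mult) auto

lemmas bounded_rv_intros = bounded_rv_const bounded_rv_add bounded_rv_mult bounded_rv_sum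
  bounded_rv_mtrace bounded_rv_hs_inner bounded_rmat_mmult bounded_rmat_mpow

text \<open>The factor is \<open>a * (a + 8)\<close> with \<open>a = 2 * (2 * r + 1)\<close>. In
  units of \<open>N * B\<close>, the words in the full sum contribute \<open>a + 4\<close> and the
  leave-one-out words 4; the outer \<open>a\<close> counts the words, doubled by an
  absorption.\<close>

fun moment_const :: "nat \<Rightarrow> real" where
  "moment_const 0 = 1"
| "moment_const (Suc r) = 2 * (2 * real r + 1) * (4 * real r + 10) * moment_const r"

lemma moment_const_nonneg: "0 \<le> moment_const r"
  by (induction r) auto

text \<open>In the application v is the whitened feature vector, whose covariance is diagonal with
  entries \<open>lam j / (lam j + l)\<close>, and B bounds its squared norm. With
  \<open>1 \<le> B\<close>, lower-order terms can be absorbed into multiples of B.\<close>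

locale rank_one_sum = prob_space M for M :: "'b measure" +
  fixes m :: nat and v :: "'b \<Rightarrow> nat \<Rightarrow> real" and B :: real and s :: "nat \<Rightarrow> real"
  assumes v_meas: "\<And>j. (\<lambda>x. v x j) \<in> borel_measurable M"
    and v_bound: "\<And>x. x \<in> space M \<Longrightarrow> (\<Sum>j<m. (v x j)\<^sup>2) \<le> B"
    and v_cov: "\<And>i j. i < m \<Longrightarrow> j < m \<Longrightarrow> (\<integral>x. v x i * v x j \<partial>M) = (if i = j then s i else 0)"
    and s01: "\<And>j. 0 \<le> s j" "\<And>j. s j \<le> 1"
    and B1: "1 \<le> B"
begin

sublocale prod: product_sigma_finite "\<lambda>_. M"
  by unfold_locales

definition cmat :: "'b \<Rightarrow> nat \<Rightarrow> nat \<Rightarrow> real" where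
  "cmat x i j = v x i * v x j - (if i = j then s i else 0)"

definition cmat_sum :: "'i set \<Rightarrow> ('i \<Rightarrow> 'b) \<Rightarrow> nat \<Rightarrow> nat \<Rightarrow> real" where
  "cmat_sum I z i j = (\<Sum>l\<in>I. cmat (z l) i j)"

lemma symm_cmat: "symm (cmat x)" and symm_cmat_sum: "symm (cmat_sum I z)"
  by (auto simp: symm_def cmat_def cmat_sum_def intro!: sum.cong)

lemma bounded_rv_v: assumes "j < m" shows "bounded_rv M (\<lambda>x. v x j)"
proof -
  have "\<bar>v x j\<bar> \<le> sqrt B" if x: "x \<in> space M" for x
  proof -
    have "(v x j)\<^sup>2 \<le> (\<Sum>j<m. (v x j)\<^sup>2)" using assms by (intro member_le_sum) auto
    also have "\<dots> \<le> B" by (rule v_bound[OF x])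
    finally show ?thesis by (metis real_sqrt_abs real_sqrt_le_mono)
  qed
  then show ?thesis using v_meas by (auto simp: bounded_rv_def)
qed

lemma bounded_rmat_cmat: "bounded_rmat m M cmat"
proof -
  have "bounded_rv M (\<lambda>x. v x i * v x j + - (if i = j then s i else 0))" if "i < m" "j < m" for i j
    using that by (intro bounded_rv_add bounded_rv_mult bounded_rv_v bounded_rv_const)
  then show ?thesis by (simp add: bounded_rmat_def cmat_def)
qed

lemma bounded_rmat_component:
  "l \<in> I \<Longrightarrow> bounded_rmat m (Pi\<^sub>M I (\<lambda>_. M)) (\<lambda>z. cmat (z l))"
  unfolding bounded_rmat_def
  using bounded_rmat_cmat[unfolded bounded_rmat_def]
  by (auto intro!: bounded_rv_compose[where g="\<lambda>z. z l" and P=M] measurable_component_singleton)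

lemma bounded_rmat_cmat_sum:
  "J \<subseteq> I \<Longrightarrow> bounded_rmat m (Pi\<^sub>M I (\<lambda>_. M)) (cmat_sum J)"
  unfolding bounded_rmat_def cmat_sum_def
  using bounded_rmat_component[unfolded bounded_rmat_def, of _ I]
  by (auto intro!: bounded_rv_sum)

lemma integral_cmat:
  assumes "i < m" "j < m" shows "(\<integral>x. cmat x i j \<partial>M) = 0"
proof -
  have "integrable M (\<lambda>x. v x i * v x j)"
    using assms by (intro bounded_rv_integrable bounded_rv_mult bounded_rv_v)
  then show ?thesis unfolding cmat_def using v_cov[OF assms] by (simp add: prob_space)
qed

lemma cmat_mult_vec:
  assumes "i < m"
  shows "(\<Sum>k<m. cmat x i k * h k) = v x i * (\<Sum>k<m. v x k * h k) - s i * h i"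
proof -
  have "(\<Sum>k<m. cmat x i k * h k) = (\<Sum>k<m. v x i * (v x k * h k) - (if k = i then s i * h i else 0))"
    unfolding cmat_def by (intro sum.cong) (auto simp: algebra_simps)
  then show ?thesis using assms by (simp add: sum_subtractf sum_distrib_left)
qed

text \<open>The matrix sends h to v times its inner product with h, minus a contraction of
  h.\<close>

lemma cmat_mult_vec_norm:
  assumes "x \<in> space M"
  shows "(\<Sum>i<m. (\<Sum>k<m. cmat x i k * h k)\<^sup>2) \<le> 2 * B * (\<Sum>k<m. v x k * h k)\<^sup>2 + 2 * (\<Sum>k<m. (h k)\<^sup>2)"
proof -
  let ?w = "\<Sum>k<m. v x k * h k"
  have "(\<Sum>i<m. (\<Sum>k<m. cmat x i k * h k)\<^sup>2) \<le> (\<Sum>i<m. 2 * ?w\<^sup>2 * (v x i)\<^sup>2 + 2 * (h i)\<^sup>2)"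
  proof (intro sum_mono)
    fix i assume "i \<in> {..<m}"
    then have "(\<Sum>k<m. cmat x i k * h k)\<^sup>2 = (v x i * ?w - s i * h i)\<^sup>2" by (simp add: cmat_mult_vec)
    also have "\<dots> \<le> 2 * (v x i * ?w)\<^sup>2 + 2 * (s i * h i)\<^sup>2"
      using sum_squares_bound[of "v x i * ?w" "- (s i * h i)"] by (simp add: power2_diff)
    also have "(s i * h i)\<^sup>2 \<le> (h i)\<^sup>2"
      using s01[of i] by (simp add: power_mult_distrib mult_left_le_one_le power_le_one)
    finally show "(\<Sum>k<m. cmat x i k * h k)\<^sup>2 \<le> 2 * ?w\<^sup>2 * (v x i)\<^sup>2 + 2 * (h i)\<^sup>2"
      by (simp add: power_mult_distrib algebra_simps)
  qed
  also have "\<dots> = 2 * (\<Sum>i<m. (v x i)\<^sup>2) * ?w\<^sup>2 + 2 * (\<Sum>k<m. (h k)\<^sup>2)"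
    by (simp add: sum.distrib sum_distrib_left[symmetric] sum_distrib_right[symmetric] mult.commute mult.left_commute)
  also have "2 * (\<Sum>i<m. (v x i)\<^sup>2) * ?w\<^sup>2 \<le> 2 * B * ?w\<^sup>2"
    using v_bound[OF assms] by (intro mult_right_mono) auto
  finally show ?thesis by simp
qed

lemma hs_cmat_mmult_le:
  assumes "x \<in> space M"
  shows "hs_inner m (mmult m (cmat x) Z) (mmult m (cmat x) Z)
    \<le> 2 * B * (\<Sum>j<m. (\<Sum>k<m. v x k * Z k j)\<^sup>2) + 2 * hs_inner m Z Z"
proof -
  have "hs_inner m (mmult m (cmat x) Z) (mmult m (cmat x) Z)
      = (\<Sum>j<m. \<Sum>i<m. (\<Sum>k<m. cmat x i k * Z k j)\<^sup>2)"
    unfolding hs_inner_def by (subst sum.swap) (simp add: mmult_def power2_eq_square)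
  also have "\<dots> \<le> (\<Sum>j<m. 2 * B * (\<Sum>k<m. v x k * Z k j)\<^sup>2 + 2 * (\<Sum>k<m. (Z k j)\<^sup>2))"
    by (intro sum_mono cmat_mult_vec_norm assms)
  also have "\<dots> = 2 * B * (\<Sum>j<m. (\<Sum>k<m. v x k * Z k j)\<^sup>2) + 2 * (\<Sum>j<m. \<Sum>k<m. (Z k j)\<^sup>2)"
    by (simp add: sum.distrib sum_distrib_left)
  also have "(\<Sum>j<m. \<Sum>k<m. (Z k j)\<^sup>2) = hs_inner m Z Z"
    unfolding hs_inner_def by (subst sum.swap) (simp add: power2_eq_square)
  finally show ?thesis .
qed

text \<open>The squared inner product of v with h has expectation at most the squared norm of h.
  Hence the second moment of the random matrix is of order B, while its squared norm can be of order
  \<open>B * B\<close>.\<close>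

lemma integral_hs_cmat_mmult_le:
  "(\<integral>x. hs_inner m (mmult m (cmat x) Z) (mmult m (cmat x) Z) \<partial>M) \<le> 4 * B * hs_inner m Z Z"
proof -
  have bZ: "bounded_rmat m M (\<lambda>_. Z)" by (auto simp: bounded_rmat_def intro: bounded_rv_const)
  have sq: "(\<integral>x. (\<Sum>k<m. v x k * h k)\<^sup>2 \<partial>M) \<le> (\<Sum>k<m. (h k)\<^sup>2)" for h
  proof -
    have ex: "(\<Sum>k<m. v x k * h k)\<^sup>2 = (\<Sum>k<m. \<Sum>l<m. h k * h l * (v x k * v x l))" for x
      by (simp add: power2_eq_square sum_product algebra_simps)
    have int0: "integrable M (\<lambda>x. h k * h l * (v x k * v x l))" if "k < m" "l < m" for k l
      using that by (intro bounded_rv_integrable bounded_rv_mult bounded_rv_v bounded_rv_const)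
    have "(\<integral>x. (\<Sum>k<m. v x k * h k)\<^sup>2 \<partial>M) = (\<Sum>k<m. (\<integral>x. (\<Sum>l<m. h k * h l * (v x k * v x l)) \<partial>M))"
      unfolding ex using int0
      by (intro Bochner_Integration.integral_sum Bochner_Integration.integrable_sum) (simp only: lessThan_iff)
    also have "\<dots> = (\<Sum>k<m. \<Sum>l<m. (\<integral>x. h k * h l * (v x k * v x l) \<partial>M))"
      using int0 by (intro sum.cong refl Bochner_Integration.integral_sum) (simp only: lessThan_iff)
    finally have "(\<integral>x. (\<Sum>k<m. v x k * h k)\<^sup>2 \<partial>M) = (\<Sum>k<m. \<Sum>l<m. h k * h l * (\<integral>x. v x k * v x l \<partial>M))"
      by simp
    also have "\<dots> = (\<Sum>k<m. \<Sum>l<m. if l = k then h k * h k * s k else 0)"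
      by (intro sum.cong refl) (auto simp: v_cov)
    also have "\<dots> = (\<Sum>k<m. (h k)\<^sup>2 * s k)" by (simp add: power2_eq_square)
    also have "\<dots> \<le> (\<Sum>k<m. (h k)\<^sup>2)" using s01 by (intro sum_mono mult_left_le) auto
    finally show ?thesis .
  qed
  have bsq: "bounded_rv M (\<lambda>x. (\<Sum>k<m. v x k * h k)\<^sup>2)" for h
    unfolding power2_eq_square
    by (intro bounded_rv_mult bounded_rv_sum) (auto intro: bounded_rv_const bounded_rv_v)
  note int = bounded_rv_integrable[OF bsq]
  have "(\<integral>x. hs_inner m (mmult m (cmat x) Z) (mmult m (cmat x) Z) \<partial>M)
     \<le> (\<integral>x. 2 * B * (\<Sum>j<m. (\<Sum>k<m. v x k * Z k j)\<^sup>2) + 2 * hs_inner m Z Z \<partial>M)"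
    by (intro integral_mono bounded_rv_integrable bounded_rv_intros bounded_rmat_cmat bZ hs_cmat_mmult_le bsq)
  also have "\<dots> = 2 * B * (\<Sum>j<m. (\<integral>x. (\<Sum>k<m. v x k * Z k j)\<^sup>2 \<partial>M)) + 2 * hs_inner m Z Z"
    using int by (simp add: prob_space)
  also have "\<dots> \<le> 2 * B * (\<Sum>j<m. (\<Sum>k<m. (Z k j)\<^sup>2)) + 2 * hs_inner m Z Z"
    using sq B1 by (intro add_right_mono mult_left_mono sum_mono) auto
  also have "(\<Sum>j<m. \<Sum>k<m. (Z k j)\<^sup>2) = hs_inner m Z Z"
    unfolding hs_inner_def by (subst sum.swap) (simp add: power2_eq_square)
  also have "2 * B * hs_inner m Z Z + 2 * hs_inner m Z Z \<le> 4 * B * hs_inner m Z Z"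
    using mult_right_mono[OF B1 hs_inner_self_nonneg[of m Z]] by simp
  finally show ?thesis .
qed

text \<open>A pathwise bound, needed because Z will be a power of the full sum X and so depends on
  every summand. The squares of the summands add up, apart from terms of order
  \<open>B * card I\<close>, to \<open>2 * B\<close> times the quadratic form of X, which is traded
  for \<theta> times the square of X.\<close>

lemma sum_hs_cmat_mmult_le:
  fixes z :: "'i \<Rightarrow> 'b"
  assumes fin: "finite I" and z: "\<And>l. l \<in> I \<Longrightarrow> z l \<in> space M" and th: "0 < \<theta>"
  shows "(\<Sum>l\<in>I. hs_inner m (mmult m (cmat (z l)) Z) (mmult m (cmat (z l)) Z))
    \<le> \<theta> * hs_inner m (mmult m (cmat_sum I z) Z) (mmult m (cmat_sum I z) Z)
      + (B\<^sup>2 / \<theta> + 4 * B * card I) * hs_inner m Z Z"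
proof -
  let ?X = "cmat_sum I z" let ?n = "real (card I)"
  have col: "2 * B * (\<Sum>l\<in>I. (\<Sum>k<m. v (z l) k * h k)\<^sup>2)
     \<le> \<theta> * (\<Sum>i<m. (\<Sum>k<m. ?X i k * h k)\<^sup>2) + (B\<^sup>2 / \<theta> + 2 * B * ?n) * (\<Sum>i<m. (h i)\<^sup>2)" for h
  proof -
    \<comment> \<open>The squared inner product equals the quadratic form of the centred matrix plus
      a diagonal term. It is thus linear in that matrix, and summation over the sample gives the
      form of X.\<close>
    have one: "(\<Sum>k<m. v x k * h k)\<^sup>2 = (\<Sum>i<m. h i * (\<Sum>k<m. cmat x i k * h k)) + (\<Sum>i<m. s i * (h i)\<^sup>2)" for x
    proof -
      have "(\<Sum>i<m. h i * (\<Sum>k<m. cmat x i k * h k)) = (\<Sum>i<m. h i * (v x i * (\<Sum>k<m. v x k * h k) - s i * h i))"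
        by (intro sum.cong refl) (simp add: cmat_mult_vec)
      also have "\<dots> = (\<Sum>i<m. v x i * h i) * (\<Sum>k<m. v x k * h k) - (\<Sum>i<m. s i * (h i)\<^sup>2)"
        by (simp add: algebra_simps sum_subtractf sum_distrib_left power2_eq_square)
      finally show ?thesis by (simp add: power2_eq_square)
    qed
    have "(\<Sum>l\<in>I. \<Sum>i<m. h i * (\<Sum>k<m. cmat (z l) i k * h k)) = (\<Sum>i<m. h i * (\<Sum>k<m. ?X i k * h k))"
    proof -
      have "(\<Sum>l\<in>I. \<Sum>i<m. h i * (\<Sum>k<m. cmat (z l) i k * h k))
          = (\<Sum>i<m. h i * (\<Sum>l\<in>I. \<Sum>k<m. cmat (z l) i k * h k))"
        by (subst sum.swap) (simp add: sum_distrib_left)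
      moreover have "(\<Sum>l\<in>I. \<Sum>k<m. cmat (z l) i k * h k) = (\<Sum>k<m. ?X i k * h k)" for i
        by (subst sum.swap) (simp add: cmat_sum_def sum_distrib_right)
      ultimately show ?thesis by simp
    qed
    then have "(\<Sum>l\<in>I. (\<Sum>k<m. v (z l) k * h k)\<^sup>2)
       = (\<Sum>i<m. h i * (\<Sum>k<m. ?X i k * h k)) + ?n * (\<Sum>i<m. s i * (h i)\<^sup>2)"
      by (simp add: one sum.distrib)
    also have "\<dots> \<le> (\<Sum>i<m. h i * (\<Sum>k<m. ?X i k * h k)) + ?n * (\<Sum>i<m. (h i)\<^sup>2)"
      using s01 by (intro add_left_mono mult_left_mono sum_mono mult_left_le_one_le) auto
    finally have "2 * B * (\<Sum>l\<in>I. (\<Sum>k<m. v (z l) k * h k)\<^sup>2)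
       \<le> 2 * B * ((\<Sum>i<m. h i * (\<Sum>k<m. ?X i k * h k)) + ?n * (\<Sum>i<m. (h i)\<^sup>2))"
      using B1 by (intro mult_left_mono) auto
    also have "\<dots> = (\<Sum>i<m. 2 * B * (h i * (\<Sum>k<m. ?X i k * h k))) + 2 * B * ?n * (\<Sum>i<m. (h i)\<^sup>2)"
      by (simp add: algebra_simps sum_distrib_left)
    also have "(\<Sum>i<m. 2 * B * (h i * (\<Sum>k<m. ?X i k * h k)))
       \<le> (\<Sum>i<m. \<theta> * (\<Sum>k<m. ?X i k * h k)\<^sup>2 + B\<^sup>2 / \<theta> * (h i)\<^sup>2)"
    proof (intro sum_mono)
      fix i
      let ?y = "\<Sum>k<m. ?X i k * h k"
      \<comment> \<open>Young's inequality, weighted so that the coefficient of the square is the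
        free parameter \<theta>.\<close>
      have "0 \<le> (\<theta> * ?y - B * h i)\<^sup>2 / \<theta>" using th by simp
      also have "\<dots> = \<theta> * ?y\<^sup>2 + B\<^sup>2 / \<theta> * (h i)\<^sup>2 - 2 * B * (h i * ?y)"
        using th by (simp add: power2_eq_square field_simps)
      finally show "2 * B * (h i * ?y) \<le> \<theta> * ?y\<^sup>2 + B\<^sup>2 / \<theta> * (h i)\<^sup>2" by simp
    qed
    finally show ?thesis by (simp add: sum.distrib sum_distrib_left algebra_simps)
  qed
  have "(\<Sum>l\<in>I. hs_inner m (mmult m (cmat (z l)) Z) (mmult m (cmat (z l)) Z))
     \<le> (\<Sum>l\<in>I. 2 * B * (\<Sum>j<m. (\<Sum>k<m. v (z l) k * Z k j)\<^sup>2) + 2 * hs_inner m Z Z)"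
    by (intro sum_mono hs_cmat_mmult_le z)
  also have "\<dots> = (\<Sum>j<m. 2 * B * (\<Sum>l\<in>I. (\<Sum>k<m. v (z l) k * Z k j)\<^sup>2)) + 2 * ?n * hs_inner m Z Z"
    by (simp add: sum.distrib sum_distrib_left sum.swap[of _ "{..<m}" I])
  also have "\<dots> \<le> (\<Sum>j<m. \<theta> * (\<Sum>i<m. (\<Sum>k<m. ?X i k * Z k j)\<^sup>2) + (B\<^sup>2 / \<theta> + 2 * B * ?n) * (\<Sum>i<m. (Z i j)\<^sup>2))
       + 2 * ?n * hs_inner m Z Z"
    by (intro add_right_mono sum_mono col)
  also have "\<dots> = \<theta> * (\<Sum>j<m. \<Sum>i<m. (\<Sum>k<m. ?X i k * Z k j)\<^sup>2)
       + (B\<^sup>2 / \<theta> + 2 * B * ?n) * (\<Sum>j<m. \<Sum>i<m. (Z i j)\<^sup>2) + 2 * ?n * hs_inner m Z Z"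
    by (simp add: sum.distrib sum_distrib_left)
  also have "(\<Sum>j<m. \<Sum>i<m. (Z i j)\<^sup>2) = hs_inner m Z Z"
    unfolding hs_inner_def by (subst sum.swap) (simp add: power2_eq_square)
  also have "(\<Sum>j<m. \<Sum>i<m. (\<Sum>k<m. ?X i k * Z k j)\<^sup>2) = hs_inner m (mmult m ?X Z) (mmult m ?X Z)"
    unfolding hs_inner_def by (subst sum.swap) (simp add: mmult_def power2_eq_square)
  finally show ?thesis
    using mult_right_mono[OF B1, of "2 * (?n * hs_inner m Z Z)"] hs_inner_self_nonneg[of m Z]
    by (simp add: algebra_simps)
qed

lemma mtrace_mmult_sum_left:
  "mtrace m (mmult m (cmat_sum I z) Z) = (\<Sum>l\<in>I. mtrace m (mmult m (cmat (z l)) Z))"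
proof -
  have "(\<Sum>i<m. \<Sum>k<m. (\<Sum>l\<in>I. cmat (z l) i k) * Z k i) = (\<Sum>i<m. \<Sum>l\<in>I. \<Sum>k<m. cmat (z l) i k * Z k i)"
    by (simp add: sum_distrib_right sum.swap[of _ I])
  also have "\<dots> = (\<Sum>l\<in>I. \<Sum>i<m. \<Sum>k<m. cmat (z l) i k * Z k i)" by (rule sum.swap)
  finally show ?thesis by (simp add: mtrace_def mmult_def cmat_sum_def)
qed

lemma hs_mpow_eq_mtrace:
  "hs_inner m (mpow m (cmat_sum I z) (Suc r)) (mpow m (cmat_sum I z) (Suc r))
   = (\<Sum>l\<in>I. mtrace m (mmult m (cmat (z l)) (mpow m (cmat_sum I z) (2 * r + 1))))"
proof -
  let ?X = "cmat_sum I z"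
  have "hs_inner m (mpow m ?X (Suc r)) (mpow m ?X (Suc r)) = mtrace m (mpow m ?X (Suc (2 * r + 1)))"
    unfolding hs_inner_eq_mtrace symm_mpow[OF symm_cmat_sum] mpow_add by (simp del: mpow.simps add: mult_2)
  then show ?thesis by (simp add: mtrace_mmult_sum_left)
qed

lemma cmat_sum_remove:
  assumes "finite I" "l \<in> I"
  shows "(\<lambda>i j. cmat_sum I z i j - cmat_sum (I - {l}) z i j) = cmat (z l)"
  using assms by (auto simp: cmat_sum_def sum.remove fun_eq_iff)

text \<open>Each of the \<open>2 * r + 1\<close> words in the telescoped difference is bounded by
  one norm with powers of the full sum and one with powers of the leave-one-out sum. The former is
  handled pathwise; the latter is kept, since independence will bound its expectation.\<close>

lemma hs_mpow_Suc_le: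
  fixes z :: "'i \<Rightarrow> 'b"
  assumes fin: "finite I" and z: "\<And>l. l \<in> I \<Longrightarrow> z l \<in> space M"
  shows "hs_inner m (mpow m (cmat_sum I z) (Suc r)) (mpow m (cmat_sum I z) (Suc r))
    \<le> 2 * (\<Sum>l\<in>I. mtrace m (mmult m (cmat (z l)) (mpow m (cmat_sum (I - {l}) z) (2 * r + 1))))
      + 2 * (2 * real r + 1) * (2 * (2 * real r + 1) * B\<^sup>2 + 4 * B * card I)
         * hs_inner m (mpow m (cmat_sum I z) r) (mpow m (cmat_sum I z) r)
      + 2 * (2 * real r + 1) * (\<Sum>l\<in>I. hs_inner m (mmult m (cmat (z l)) (mpow m (cmat_sum (I - {l}) z) r))
          (mmult m (cmat (z l)) (mpow m (cmat_sum (I - {l}) z) r)))"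
proof -
  let ?F = "hs_inner m (mpow m (cmat_sum I z) (Suc r)) (mpow m (cmat_sum I z) (Suc r))"
  let ?G = "hs_inner m (mpow m (cmat_sum I z) r) (mpow m (cmat_sum I z) r)"
  let ?T = "\<Sum>l\<in>I. mtrace m (mmult m (cmat (z l)) (mpow m (cmat_sum (I - {l}) z) (2 * r + 1)))"
  let ?S = "\<Sum>l\<in>I. hs_inner m (mmult m (cmat (z l)) (mpow m (cmat_sum (I - {l}) z) r))
          (mmult m (cmat (z l)) (mpow m (cmat_sum (I - {l}) z) r))"
  let ?c = "2 * (2 * real r + 1) * B\<^sup>2 + 4 * B * card I"
  let ?X = "cmat_sum I z" let ?Y = "\<lambda>l. cmat_sum (I - {l}) z"
  let ?hX = "\<lambda>l. hs_inner m (mmult m (cmat (z l)) (mpow m ?X r)) (mmult m (cmat (z l)) (mpow m ?X r))"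
  let ?hY = "\<lambda>l. hs_inner m (mmult m (cmat (z l)) (mpow m (?Y l) r)) (mmult m (cmat (z l)) (mpow m (?Y l) r))"
  have each: "mtrace m (mmult m (cmat (z l)) (mpow m ?X (2 * r + 1)))
     \<le> mtrace m (mmult m (cmat (z l)) (mpow m (?Y l) (2 * r + 1))) + (2 * real r + 1) * (?hX l + ?hY l)"
    if l: "l \<in> I" for l
  proof -
    have "mtrace m (mmult m (cmat (z l)) (mpow m ?X (2 * r + 1))) - mtrace m (mmult m (cmat (z l)) (mpow m (?Y l) (2 * r + 1)))
      = (\<Sum>q<2 * r + 1. mtrace m (mmult m (cmat (z l)) (mmult m (mpow m ?X q) (mmult m (cmat (z l)) (mpow m (?Y l) (2 * r - q))))))"
      unfolding mtrace_mpow_diff cmat_sum_remove[OF fin l] by simp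
    also have "\<dots> \<le> (\<Sum>q<2 * r + 1. ?hX l + ?hY l)"
      by (intro sum_mono mtrace_alternating_le symm_cmat symm_cmat_sum) auto
    finally show ?thesis by (simp add: algebra_simps del: mpow.simps)
  qed
  \<comment> \<open>Chosen so that exactly half of the left-hand side appears on the right.
    Absorbing it doubles the remaining terms.\<close>
  define \<theta> where "\<theta> = 1 / (2 * (2 * real r + 1))"
  have th: "0 < \<theta>" by (simp add: \<theta>_def)
  have "?F \<le> (\<Sum>l\<in>I. mtrace m (mmult m (cmat (z l)) (mpow m (?Y l) (2 * r + 1))) + (2 * real r + 1) * (?hX l + ?hY l))"
    unfolding hs_mpow_eq_mtrace by (intro sum_mono each)
  also have "\<dots> = ?T + (2 * real r + 1) * (\<Sum>l\<in>I. ?hX l) + (2 * real r + 1) * ?S"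
    by (simp only: sum.distrib sum_distrib_left[symmetric] distrib_left add.assoc)
  also have "\<dots> \<le> ?T + (2 * real r + 1) * (\<theta> * ?F + (B\<^sup>2 / \<theta> + 4 * B * card I) * ?G) + (2 * real r + 1) * ?S"
    using sum_hs_cmat_mmult_le[where z=z and Z="mpow m ?X r", OF fin z th]
    by (intro add_right_mono add_left_mono mult_left_mono) auto
  also have "(2 * real r + 1) * (\<theta> * ?F + (B\<^sup>2 / \<theta> + 4 * B * card I) * ?G)
     = ?F / 2 + (2 * real r + 1) * ?c * ?G"
    by (simp add: \<theta>_def field_simps)
  finally have le: "?F \<le> ?T + (?F / 2 + (2 * real r + 1) * ?c * ?G) + (2 * real r + 1) * ?S" .
  have aux: "F \<le> 2 * T + 2 * w * c * G + 2 * w * S" if "F \<le> T + (F / 2 + w * c * G) + w * S"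
    for F T w c G S :: real
    using that by (simp add: algebra_simps)
  show ?thesis by (rule aux[OF le])
qed


lemma cmat_sum_fun_upd: "l \<notin> J \<Longrightarrow> cmat_sum J (z(l := y)) = cmat_sum J z"
  by (auto simp: cmat_sum_def fun_eq_iff intro!: sum.cong)

lemma integral_PiM_insert_bounded:
  assumes "finite J" "l \<notin> J" "bounded_rv (Pi\<^sub>M (insert l J) (\<lambda>_. M)) f"
  shows "(\<integral>z. f z \<partial>Pi\<^sub>M (insert l J) (\<lambda>_. M)) = (\<integral>z. (\<integral>y. f (z(l := y)) \<partial>M) \<partial>Pi\<^sub>M J (\<lambda>_. M))"
proof -
  interpret P: prob_space "Pi\<^sub>M (insert l J) (\<lambda>_. M)" by (intro prob_space_PiM prob_space_axioms)
  show ?thesis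
    using assms by (intro prod.product_integral_insert P.bounded_rv_integrable) auto
qed

text \<open>Integrating over coordinate l first pairs a mean-zero matrix with one that is constant
  in that coordinate.\<close>

lemma integral_mtrace_indep:
  assumes "finite J" "l \<notin> J"
  shows "(\<integral>z. mtrace m (mmult m (cmat (z l)) (mpow m (cmat_sum J z) k)) \<partial>Pi\<^sub>M (insert l J) (\<lambda>_. M)) = 0"
proof -
  have zero: "(\<integral>y. mtrace m (mmult m (cmat y) Z) \<partial>M) = 0" for Z
  proof -
    have int: "integrable M (\<lambda>y. cmat y i k)" if "i < m" "k < m" for i k
      using bounded_rmat_cmat that by (auto simp: bounded_rmat_def intro: bounded_rv_integrable)
    have "(\<integral>y. mtrace m (mmult m (cmat y) Z) \<partial>M) = (\<integral>y. (\<Sum>i<m. \<Sum>k<m. cmat y i k * Z k i) \<partial>M)"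
      by (simp add: mtrace_def mmult_def)
    also have "\<dots> = (\<Sum>i<m. (\<integral>y. (\<Sum>k<m. cmat y i k * Z k i) \<partial>M))"
      using int by (intro Bochner_Integration.integral_sum Bochner_Integration.integrable_sum integrable_mult_left) auto
    also have "\<dots> = (\<Sum>i<m. (\<Sum>k<m. (\<integral>y. cmat y i k * Z k i \<partial>M)))"
      using int by (intro sum.cong refl Bochner_Integration.integral_sum integrable_mult_left) auto
    also have "\<dots> = 0" by (intro sum.neutral ballI) (auto simp: integral_cmat)
    finally show ?thesis .
  qed
  have "bounded_rv (Pi\<^sub>M (insert l J) (\<lambda>_. M)) (\<lambda>z. mtrace m (mmult m (cmat (z l)) (mpow m (cmat_sum J z) k)))"
    by (intro bounded_rv_intros bounded_rmat_component bounded_rmat_cmat_sum) auto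
  then show ?thesis
    by (subst integral_PiM_insert_bounded[OF assms]) (simp_all add: cmat_sum_fun_upd assms zero)
qed

lemma integral_hs_indep_le:
  assumes "finite J" "l \<notin> J"
  shows "(\<integral>z. hs_inner m (mmult m (cmat (z l)) (mpow m (cmat_sum J z) r)) (mmult m (cmat (z l)) (mpow m (cmat_sum J z) r))
            \<partial>Pi\<^sub>M (insert l J) (\<lambda>_. M))
      \<le> 4 * B * (\<integral>z. hs_inner m (mpow m (cmat_sum J z) r) (mpow m (cmat_sum J z) r) \<partial>Pi\<^sub>M J (\<lambda>_. M))"
proof -
  interpret PJ: prob_space "Pi\<^sub>M J (\<lambda>_. M)" by (intro prob_space_PiM prob_space_axioms)
  interpret PI: prob_space "Pi\<^sub>M (insert l J) (\<lambda>_. M)" by (intro prob_space_PiM prob_space_axioms)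
  let ?f = "\<lambda>z. hs_inner m (mmult m (cmat (z l)) (mpow m (cmat_sum J z) r)) (mmult m (cmat (z l)) (mpow m (cmat_sum J z) r))"
  have bf: "bounded_rv (Pi\<^sub>M (insert l J) (\<lambda>_. M)) ?f"
    by (intro bounded_rv_intros bounded_rmat_component bounded_rmat_cmat_sum) auto
  have int: "integrable (Pi\<^sub>M J (\<lambda>_. M)) (\<lambda>z. hs_inner m (mpow m (cmat_sum J z) r) (mpow m (cmat_sum J z) r))"
    by (intro PJ.bounded_rv_integrable bounded_rv_intros bounded_rmat_cmat_sum) auto
  have "(\<integral>z. ?f z \<partial>Pi\<^sub>M (insert l J) (\<lambda>_. M)) = (\<integral>z. (\<integral>y. ?f (z(l := y)) \<partial>M) \<partial>Pi\<^sub>M J (\<lambda>_. M))"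
    by (rule integral_PiM_insert_bounded[OF assms bf])
  also have "\<dots> = (\<integral>z. (\<integral>y. hs_inner m (mmult m (cmat y) (mpow m (cmat_sum J z) r)) (mmult m (cmat y) (mpow m (cmat_sum J z) r)) \<partial>M)
       \<partial>Pi\<^sub>M J (\<lambda>_. M))"
    by (simp add: cmat_sum_fun_upd assms)
  also have "\<dots> \<le> (\<integral>z. 4 * B * hs_inner m (mpow m (cmat_sum J z) r) (mpow m (cmat_sum J z) r) \<partial>Pi\<^sub>M J (\<lambda>_. M))"
    using int B1
    by (intro integral_mono' integral_hs_cmat_mmult_le) (auto simp: hs_inner_self_nonneg)
  finally show ?thesis by simp
qed

text \<open>Write \<open>X\<close> for the sum, \<open>A l\<close> for its summands and \<open>Y l = X - A l\<close>. Since \<open>A l\<close> is centred and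
  independent of \<open>Y l\<close>, the power \<open>X ^ (2 r + 1)\<close> in \<open>tr (X ^ (2 r + 2)) = (\<Sum>l. tr (A l * X ^ (2 r + 1)))\<close>
  may be replaced by \<open>X ^ (2 r + 1) - Y l ^ (2 r + 1)\<close>, a sum of words with two factors \<open>A l\<close>.\<close>
theorem trace_moment_bound:
  fixes I :: "'i set"
  assumes "B \<le> N" "finite I" "card I \<le> N"
  shows "(\<integral>z. hs_inner m (mpow m (cmat_sum I z) r) (mpow m (cmat_sum I z) r) \<partial>Pi\<^sub>M I (\<lambda>_. M))
    \<le> moment_const r * (N * B) ^ r * m"
  using assms(2,3)
\<comment> \<open>The index set varies because the leave-one-out terms require the bound for
  \<open>I - {l}\<close>; N stays fixed, so the bound is the same.\<close>
proof (induction r arbitrary: I)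
  case 0
  interpret PI: prob_space "Pi\<^sub>M I (\<lambda>_. M)" by (intro prob_space_PiM prob_space_axioms)
  \<comment> \<open>The dimension enters the moment bound only here, as the squared norm of the
    unit.\<close>
  have "hs_inner m (mpow m A 0) (mpow m A 0) = m" for A
    by (simp add: hs_inner_def if_distrib cong: if_cong)
  then show ?case by (simp add: PI.prob_space)
next
  case (Suc r)
  interpret PI: prob_space "Pi\<^sub>M I (\<lambda>_. M)" by (intro prob_space_PiM prob_space_axioms)
  let ?P = "Pi\<^sub>M I (\<lambda>_. M)"
  let ?f = "\<lambda>r I z. hs_inner m (mpow m (cmat_sum I z) r) (mpow m (cmat_sum I z) r)"
  let ?t = "\<lambda>l z. mtrace m (mmult m (cmat (z l)) (mpow m (cmat_sum (I - {l}) z) (2 * r + 1)))"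
  let ?h = "\<lambda>l z. hs_inner m (mmult m (cmat (z l)) (mpow m (cmat_sum (I - {l}) z) r))
          (mmult m (cmat (z l)) (mpow m (cmat_sum (I - {l}) z) r))"
  define a where "a = 2 * (2 * real r + 1)"
  define c where "c = a * B\<^sup>2 + 4 * B * card I"
  define D where "D = moment_const r * (N * B) ^ r * m"
  have N0: "0 \<le> N" "0 \<le> B" using assms(1) B1 by auto
  have D0: "0 \<le> D" using N0 unfolding D_def by (intro mult_nonneg_nonneg moment_const_nonneg) auto
  have a0: "0 \<le> a" by (simp add: a_def)
  have c0: "0 \<le> c" using a0 N0 by (simp add: c_def)
  have int_t: "integrable ?P (?t l)" and int_h: "integrable ?P (?h l)" if "l \<in> I" for l
    using that
    by (intro PI.bounded_rv_integrable bounded_rv_intros bounded_rmat_component bounded_rmat_cmat_sum; auto)+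
  have int_f: "integrable ?P (?f k I)" for k
    by (intro PI.bounded_rv_integrable bounded_rv_intros bounded_rmat_cmat_sum) auto
  have ins: "insert l (I - {l}) = I" if "l \<in> I" for l using that by auto
  have t0: "(\<integral>z. ?t l z \<partial>?P) = 0" if "l \<in> I" for l
    using integral_mtrace_indep[of "I - {l}" l "2 * r + 1"] Suc.prems unfolding ins[OF that] by auto
  have h0: "(\<integral>z. ?h l z \<partial>?P) \<le> 4 * B * D" if "l \<in> I" for l
  proof -
    have "(\<integral>z. ?h l z \<partial>?P) \<le> 4 * B * (\<integral>z. ?f r (I - {l}) z \<partial>Pi\<^sub>M (I - {l}) (\<lambda>_. M))"
      using integral_hs_indep_le[of "I - {l}" l r] Suc.prems unfolding ins[OF that] by auto
    also have "\<dots> \<le> 4 * B * D"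
      unfolding D_def using N0 Suc.prems that
      by (intro mult_left_mono Suc.IH) (auto simp: card_Diff_singleton)
    finally show ?thesis .
  qed
  have "(\<integral>z. ?f (Suc r) I z \<partial>?P) \<le> (\<integral>z. 2 * (\<Sum>l\<in>I. ?t l z) + a * c * ?f r I z + a * (\<Sum>l\<in>I. ?h l z) \<partial>?P)"
  proof (intro integral_mono int_f)
    show "integrable ?P (\<lambda>z. 2 * (\<Sum>l\<in>I. ?t l z) + a * c * ?f r I z + a * (\<Sum>l\<in>I. ?h l z))"
      by (intro Bochner_Integration.integrable_add integrable_mult_right Bochner_Integration.integrable_sum int_t int_h int_f)
    fix z assume "z \<in> space ?P"
    then have "\<And>l. l \<in> I \<Longrightarrow> z l \<in> space M" by (auto simp: space_PiM)
    from hs_mpow_Suc_le[where z=z and r=r, OF Suc.prems(1) this]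
    show "?f (Suc r) I z \<le> 2 * (\<Sum>l\<in>I. ?t l z) + a * c * ?f r I z + a * (\<Sum>l\<in>I. ?h l z)"
      by (simp only: a_def c_def)
  qed
  also have "\<dots> = 2 * (\<integral>z. (\<Sum>l\<in>I. ?t l z) \<partial>?P) + a * c * (\<integral>z. ?f r I z \<partial>?P) + a * (\<integral>z. (\<Sum>l\<in>I. ?h l z) \<partial>?P)"
    using int_t int_h int_f
    by (subst Bochner_Integration.integral_add Bochner_Integration.integral_mult_right_zero;
        (intro Bochner_Integration.integrable_add integrable_mult_right Bochner_Integration.integrable_sum)?; simp)+
  also have "(\<integral>z. (\<Sum>l\<in>I. ?t l z) \<partial>?P) = (\<Sum>l\<in>I. (\<integral>z. ?t l z \<partial>?P))"
    by (rule Bochner_Integration.integral_sum[OF int_t])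
  also have "(\<integral>z. (\<Sum>l\<in>I. ?h l z) \<partial>?P) = (\<Sum>l\<in>I. (\<integral>z. ?h l z \<partial>?P))"
    by (rule Bochner_Integration.integral_sum[OF int_h])
  also have "2 * (\<Sum>l\<in>I. (\<integral>z. ?t l z \<partial>?P)) + a * c * (\<integral>z. ?f r I z \<partial>?P) + a * (\<Sum>l\<in>I. (\<integral>z. ?h l z \<partial>?P))
      \<le> 2 * (\<Sum>l\<in>I. 0) + a * c * D + a * (\<Sum>l\<in>I. 4 * B * D)"
    using t0 h0 Suc.IH[OF Suc.prems] a0 c0
    by (intro add_mono mult_left_mono sum_mono) (auto simp: D_def)
  also have "\<dots> = a * (c + card I * (4 * B)) * D" by (simp add: algebra_simps)
  also have "\<dots> \<le> a * ((4 * real r + 10) * (N * B)) * D"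
  proof (intro mult_right_mono mult_left_mono D0 a0)
    have "B * B \<le> N * B" "card I * B \<le> N * B" using assms(1) Suc.prems N0 by (auto intro: mult_right_mono)
    then show "c + card I * (4 * B) \<le> (4 * real r + 10) * (N * B)"
      using mult_left_mono[of "B * B" "N * B" a] a0 by (simp add: c_def a_def power2_eq_square algebra_simps)
  qed
  finally show ?case by (simp add: D_def a_def algebra_simps)
qed

end

section \<open>From trace moments to a uniform bound on quadratic forms\<close>

lemma mvec_mpow_Suc:
  assumes "i < m"
  shows "(\<Sum>j<m. mpow m X (Suc k) i j * b j) = (\<Sum>l<m. X i l * (\<Sum>j<m. mpow m X k l j * b j))"
proof -
  have "(\<Sum>j<m. mpow m X (Suc k) i j * b j) = (\<Sum>j<m. \<Sum>l<m. X i l * mpow m X k l j * b j)"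
    using assms by (simp add: mmult_def sum_distrib_right)
  also have "\<dots> = (\<Sum>l<m. \<Sum>j<m. X i l * mpow m X k l j * b j)" by (rule sum.swap)
  finally show ?thesis by (simp add: sum_distrib_left mult.assoc)
qed

text \<open>For a unit vector \<open>b\<close>, Cauchy-Schwarz squares the form at each step:
  \<open>\<langle>b, X ^ p b\<rangle>\<^sup>2 \<le> \<langle>b, X ^ (2 p) b\<rangle>\<close>.\<close>
lemma quad_form_le_hs:
  assumes X: "symm X" and t: "0 \<le> t"
    and hs: "hs_inner m (mpow m X (2 ^ k)) (mpow m X (2 ^ k)) \<le> t ^ (2 * 2 ^ k)"
  shows "\<bar>\<Sum>i<m. \<Sum>j<m. b i * X i j * b j\<bar> \<le> t * (\<Sum>i<m. (b i)\<^sup>2)"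
proof -
  define \<beta> where "\<beta> = (\<Sum>i<m. (b i)\<^sup>2)"
  define y where "y p i = (\<Sum>j<m. mpow m X p i j * b j)" for p i
  define q where "q p = (\<Sum>i<m. b i * y p i)" for p
  have b0: "0 \<le> \<beta>" by (simp add: \<beta>_def sum_nonneg)
  \<comment> \<open>By symmetry the squared norm of \<open>X ^ p\<close> applied to b is the form of
    \<open>X ^ (2 * p)\<close> at b.\<close>
  have yy: "(\<Sum>i<m. (y p i)\<^sup>2) = q (2 * p)" for p
  proof -
    have "(\<Sum>i<m. (y p i)\<^sup>2) = (\<Sum>i<m. \<Sum>j<m. \<Sum>l<m. b l * (mpow m X p l i * mpow m X p i j) * b j)"
    proof (intro sum.cong refl)
      fix i
      have "(y p i)\<^sup>2 = (\<Sum>l<m. mpow m X p l i * b l) * (\<Sum>j<m. mpow m X p i j * b j)"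
        using symm_mpow[OF X, of m p] by (simp add: y_def power2_eq_square fun_eq_iff)
      then show "(y p i)\<^sup>2 = (\<Sum>j<m. \<Sum>l<m. b l * (mpow m X p l i * mpow m X p i j) * b j)"
        by (subst sum.swap) (simp add: sum_product algebra_simps)
    qed
    also have "\<dots> = (\<Sum>j<m. \<Sum>i<m. \<Sum>l<m. b l * (mpow m X p l i * mpow m X p i j) * b j)" by (rule sum.swap)
    also have "\<dots> = (\<Sum>j<m. \<Sum>l<m. \<Sum>i<m. b l * (mpow m X p l i * mpow m X p i j) * b j)"
      by (intro sum.cong refl sum.swap)
    also have "\<dots> = (\<Sum>l<m. \<Sum>j<m. \<Sum>i<m. b l * (mpow m X p l i * mpow m X p i j) * b j)" by (rule sum.swap)
    also have "\<dots> = (\<Sum>l<m. \<Sum>j<m. b l * mpow m X (2 * p) l j * b j)"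
      by (simp add: mult_2 mpow_add[symmetric] mmult_def sum_distrib_left sum_distrib_right)
    finally show ?thesis by (simp add: q_def y_def sum_distrib_left mult.assoc)
  qed
  have CS: "(q p)\<^sup>2 \<le> \<beta> * q (2 * p)" for p
    unfolding yy[symmetric] unfolding q_def \<beta>_def by (rule Cauchy_Schwarz_ineq_sum)
  have pow: "\<bar>q 1\<bar> ^ (2 ^ k) \<le> \<beta> ^ (2 ^ k - 1) * \<bar>q (2 ^ k)\<bar>" for k
  proof (induction k)
    case 0 then show ?case by simp
  next
    case (Suc k)
    have "\<bar>q 1\<bar> ^ (2 ^ Suc k) = (\<bar>q 1\<bar> ^ (2 ^ k))\<^sup>2" by (simp add: power_mult[symmetric] mult.commute)
    also have "\<dots> \<le> (\<beta> ^ (2 ^ k - 1) * \<bar>q (2 ^ k)\<bar>)\<^sup>2"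
      using Suc by (intro power_mono) auto
    also have "\<dots> = \<beta> ^ (2 * (2 ^ k - 1)) * (q (2 ^ k))\<^sup>2" by (simp add: power_mult_distrib power_mult[symmetric] mult.commute)
    also have "\<dots> \<le> \<beta> ^ (2 * (2 ^ k - 1)) * (\<beta> * q (2 * 2 ^ k))"
      using b0 by (intro mult_left_mono CS) auto
    also have "\<dots> = \<beta> ^ Suc (2 * (2 ^ k - 1)) * q (2 ^ Suc k)" by simp
    also have "Suc (2 * (2 ^ k - 1)) = (2 ^ Suc k - 1 :: nat)"
      by (cases "2 ^ k :: nat") simp_all
    also have "\<beta> ^ (2 ^ Suc k - 1) * q (2 ^ Suc k) \<le> \<beta> ^ (2 ^ Suc k - 1) * \<bar>q (2 ^ Suc k)\<bar>"
      using b0 by (intro mult_left_mono) auto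
    finally show ?case .
  qed
  \<comment> \<open>The Hilbert-Schmidt norm dominates the operator norm, which ends the chain of
    squarings.\<close>
  have qHS: "q (2 * p) \<le> \<beta> * hs_inner m (mpow m X p) (mpow m X p)" for p
  proof -
    have "q (2 * p) \<le> (\<Sum>i<m. (\<Sum>j<m. (mpow m X p i j)\<^sup>2) * \<beta>)"
      unfolding yy[symmetric] y_def \<beta>_def by (intro sum_mono Cauchy_Schwarz_ineq_sum)
    then show ?thesis by (simp add: hs_inner_def sum_distrib_right[symmetric] sum_distrib_left[symmetric] power2_eq_square mult.commute)
  qed
  have "\<bar>q 1\<bar> ^ (2 ^ Suc k) \<le> \<beta> ^ (2 ^ Suc k - 1) * \<bar>q (2 ^ Suc k)\<bar>" by (rule pow)
  also have "\<bar>q (2 ^ Suc k)\<bar> = q (2 * 2 ^ k)"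
    using yy[of "2 ^ k", symmetric] by (simp add: sum_nonneg)
  also have "\<dots> \<le> \<beta> * t ^ (2 * 2 ^ k)"
    using qHS[of "2 ^ k"] mult_left_mono[OF hs b0] by simp
  also have "\<beta> ^ (2 ^ Suc k - 1) * (\<beta> * t ^ (2 * 2 ^ k)) = \<beta> ^ Suc (2 ^ Suc k - 1) * t ^ (2 * 2 ^ k)"
    by (simp only: power_Suc2 mult.assoc)
  also have "Suc (2 ^ Suc k - 1) = (2 ^ Suc k :: nat)" by simp
  also have "\<beta> ^ (2 ^ Suc k) * t ^ (2 * 2 ^ k) = (t * \<beta>) ^ (2 ^ Suc k)" by (simp add: power_mult_distrib mult.commute)
  finally have "\<bar>q 1\<bar> ^ (2 ^ Suc k) \<le> (t * \<beta>) ^ (2 ^ Suc k)"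
    using b0 by (simp add: mult_left_mono)
  then have "\<bar>q 1\<bar> \<le> t * \<beta>"
    using b0 t by (subst (asm) power_mono_iff) auto
  moreover have "q 1 = (\<Sum>i<m. \<Sum>j<m. b i * X i j * b j)"
  proof -
    have "y 1 i = (\<Sum>l<m. X i l * b l)" if "i < m" for i
    proof -
      have "(\<Sum>j<m. mpow m X 0 l j * b j) = b l" if "l < m" for l
      proof -
        have "(\<Sum>j<m. mpow m X 0 l j * b j) = (\<Sum>j<m. if j = l then b l else 0)"
          using that by (intro sum.cong) auto
        then show ?thesis using that by simp
      qed
      then show ?thesis using mvec_mpow_Suc[OF that, of X 0 b] by (simp add: y_def)
    qed
    then show ?thesis by (simp add: q_def sum_distrib_left mult.assoc)
  qed
  ultimately show ?thesis by (simp add: \<beta>_def)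
qed

text \<open>Markov's inequality with the moment as an extended nonnegative integral: integrability
  follows from the bound instead of being assumed.\<close>

lemma (in prob_space) prob_ge_le:
  fixes u :: "'a \<Rightarrow> real"
  assumes [measurable]: "u \<in> borel_measurable M" and nn: "\<And>x. x \<in> space M \<Longrightarrow> 0 \<le> u x"
    and le: "(\<integral>\<^sup>+x. ennreal (u x) \<partial>M) \<le> ennreal K" and K: "0 \<le> K" and c: "0 < c"
  shows "prob {x\<in>space M. c \<le> u x} \<le> K / c"
proof -
  have int: "integrable M u"
    using le by (intro integrableI_nonneg) (auto simp: nn intro: le_less_trans)
  have "ennreal (\<integral>x. u x \<partial>M) \<le> ennreal K"
    using le nn_integral_eq_integral[OF int] nn by simp
  then have "(\<integral>x. u x \<partial>M) \<le> K" using K by (simp add: ennreal_le_iff)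
  then have "(\<integral>x. u x \<partial>M) / c \<le> K / c" using c by (simp add: divide_right_mono)
  moreover have "prob {x\<in>space M. c \<le> u x} \<le> (\<integral>x. u x \<partial>M) / c"
    using integral_Markov_inequality_measure[OF int, of "{}" c] nn c by simp
  ultimately show ?thesis by simp
qed

text \<open>The event is cut out by the single random variable that Markov's inequality controls. It
  is therefore measurable, although the conclusion quantifies over uncountably many b.\<close>

theorem (in rank_one_sum) prob_quad_form_deviation:
  fixes I :: "'i set"
  assumes I: "finite I" "card I \<le> N" and "B \<le> N" and t: "0 < t"
  shows "\<exists>E\<in>sets (Pi\<^sub>M I (\<lambda>_. M)).
    measure (Pi\<^sub>M I (\<lambda>_. M)) E \<ge> 1 - moment_const (2 ^ k) * (N * B) ^ (2 ^ k) * m / t ^ (2 * 2 ^ k) \<and>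
    (\<forall>z\<in>E. \<forall>b. \<bar>\<Sum>i<m. \<Sum>j<m. b i * cmat_sum I z i j * b j\<bar> \<le> t * (\<Sum>i<m. (b i)\<^sup>2))"
proof -
  interpret PI: prob_space "Pi\<^sub>M I (\<lambda>_. M)" by (intro prob_space_PiM prob_space_axioms)
  let ?P = "Pi\<^sub>M I (\<lambda>_. M)"
  let ?u = "\<lambda>z. hs_inner m (mpow m (cmat_sum I z) (2 ^ k)) (mpow m (cmat_sum I z) (2 ^ k))"
  let ?K = "moment_const (2 ^ k) * (N * B) ^ (2 ^ k) * m"
  have bu: "bounded_rv ?P ?u" by (intro bounded_rv_intros bounded_rmat_cmat_sum) auto
  then have [measurable]: "?u \<in> borel_measurable ?P" by (simp add: bounded_rv_def)
  have K0: "0 \<le> ?K" using B1 assms(3) by (intro mult_nonneg_nonneg moment_const_nonneg) auto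
  have "(\<integral>\<^sup>+z. ennreal (?u z) \<partial>?P) = ennreal (\<integral>z. ?u z \<partial>?P)"
    by (intro nn_integral_eq_integral PI.bounded_rv_integrable bu) (auto simp: hs_inner_self_nonneg)
  also have "\<dots> \<le> ennreal ?K" using I assms(3) by (intro ennreal_leI trace_moment_bound)
  finally have "PI.prob {z\<in>space ?P. t ^ (2 * 2 ^ k) \<le> ?u z} \<le> ?K / t ^ (2 * 2 ^ k)"
    using K0 t by (intro PI.prob_ge_le) (auto simp: hs_inner_self_nonneg)
  moreover have "PI.prob {z\<in>space ?P. \<not> t ^ (2 * 2 ^ k) \<le> ?u z} = 1 - PI.prob {z\<in>space ?P. t ^ (2 * 2 ^ k) \<le> ?u z}"
    by (intro PI.prob_neg) simp
  ultimately show ?thesis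
    using t by (intro bexI[of _ "{z\<in>space ?P. \<not> t ^ (2 * 2 ^ k) \<le> ?u z}"])
      (auto intro!: quad_form_le_hs[OF symm_cmat_sum, where k=k])
qed

section \<open>Exponential and Chebyshev inequalities in Hilbert space\<close>

text \<open>In the induction step the defect is
  \<open>\<tau> * (1 - \<tau>) * (v - u) * (v ^ j - u ^ j)\<close>, nonnegative because the two
  differences have the same sign.\<close>

lemma power_convex_comb:
  fixes u v :: real
  assumes "0 \<le> u" "0 \<le> v" "0 \<le> \<tau>" "\<tau> \<le> 1"
  shows "((1 - \<tau>) * u + \<tau> * v) ^ j \<le> (1 - \<tau>) * u ^ j + \<tau> * v ^ j"
proof (induction j)
  case 0 then show ?case by simp
next
  case (Suc j)
  have "((1 - \<tau>) * u + \<tau> * v) ^ Suc j \<le> ((1 - \<tau>) * u + \<tau> * v) * ((1 - \<tau>) * u ^ j + \<tau> * v ^ j)"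
    using Suc assms by (simp add: mult_left_mono)
  also have "\<dots> = (1 - \<tau>) * u ^ Suc j + \<tau> * v ^ Suc j - \<tau> * (1 - \<tau>) * ((v - u) * (v ^ j - u ^ j))"
    by (simp add: algebra_simps)
  also have "\<dots> \<le> (1 - \<tau>) * u ^ Suc j + \<tau> * v ^ Suc j"
  proof -
    have "0 \<le> (v - u) * (v ^ j - u ^ j)"
      using assms power_mono[of u v j] power_mono[of v u j]
      by (cases "u \<le> v") (auto intro: mult_nonneg_nonneg mult_nonpos_nonpos)
    then show ?thesis using assms by simp
  qed
  finally show ?case .
qed

lemma cosh_sums_square: "(\<lambda>j. (r\<^sup>2) ^ j / fact (2 * j)) sums cosh (r :: real)"
proof -
  have "(\<lambda>j. (if even (2 * j) then r ^ (2 * j) /\<^sub>R fact (2 * j) else 0)) sums cosh r"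
    using cosh_converges[of r]
    by (subst sums_mono_reindex[of "\<lambda>j. 2 * j"]) (auto simp: strict_mono_def elim!: evenE)
  then show ?thesis unfolding power_mult[symmetric] by (simp add: divide_inverse mult.commute)
qed

text \<open>Since \<open>cosh (sqrt u)\<close> is a power series in \<open>u\<close> with nonnegative coefficients, it is convex, and
  \<open>norm (s + x) ^ 2\<close> is a convex combination of \<open>(norm s - norm x) ^ 2\<close> and \<open>(norm s + norm x) ^ 2\<close>.\<close>
lemma cosh_norm_add_le:
  fixes s x :: "'h::real_inner"
  shows "cosh (norm (s + x)) \<le> cosh (norm s) * (exp (norm x) - norm x) + (sinh (norm s) / norm s) * (s \<bullet> x)"
proof -
  define a where "a = norm s"
  define b where "b = norm x"
  \<comment> \<open>The cosine of the angle between the vectors; division by zero makes it 0 when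
    one of them vanishes.\<close>
  define \<theta> where "\<theta> = (s \<bullet> x) / (a * b)"
  have ab: "0 \<le> a" "0 \<le> b" by (auto simp: a_def b_def)
  have sx: "s \<bullet> x = a * b * \<theta>" unfolding \<theta>_def a_def b_def by (cases "s = 0 \<or> x = 0") auto
  have th: "\<bar>\<theta>\<bar> \<le> 1"
    using Cauchy_Schwarz_ineq2[of s x] by (auto simp: \<theta>_def a_def b_def abs_mult divide_le_eq)
  define \<tau> where "\<tau> = (1 + \<theta>) / 2"
  have tau: "0 \<le> \<tau>" "\<tau> \<le> 1" using th by (auto simp: \<tau>_def)
  have sq: "(norm (s + x))\<^sup>2 = (1 - \<tau>) * (a - b)\<^sup>2 + \<tau> * (a + b)\<^sup>2"
  proof -
    have "(norm (s + x))\<^sup>2 = a\<^sup>2 + 2 * (s \<bullet> x) + b\<^sup>2"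
      unfolding a_def b_def power2_norm_eq_inner by (simp add: inner_simps inner_commute)
    also have "2 * (s \<bullet> x) = 2 * (a * b * \<theta>)" by (simp only: sx)
    also have "a\<^sup>2 + 2 * (a * b * \<theta>) + b\<^sup>2 = (1 - \<tau>) * (a - b)\<^sup>2 + \<tau> * (a + b)\<^sup>2"
      by (simp add: \<tau>_def field_simps power2_eq_square)
    finally show ?thesis .
  qed
  have "cosh (norm (s + x)) \<le> (1 - \<tau>) * cosh (a - b) + \<tau> * cosh (a + b)"
  proof (rule sums_le)
    show "(\<lambda>j. ((norm (s + x))\<^sup>2) ^ j / fact (2 * j)) sums cosh (norm (s + x))" by (rule cosh_sums_square)
    show "(\<lambda>j. (1 - \<tau>) * (((a - b)\<^sup>2) ^ j / fact (2 * j)) + \<tau> * (((a + b)\<^sup>2) ^ j / fact (2 * j)))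
        sums ((1 - \<tau>) * cosh (a - b) + \<tau> * cosh (a + b))"
      by (intro sums_add sums_mult cosh_sums_square)
    fix j
    show "((norm (s + x))\<^sup>2) ^ j / fact (2 * j)
      \<le> (1 - \<tau>) * (((a - b)\<^sup>2) ^ j / fact (2 * j)) + \<tau> * (((a + b)\<^sup>2) ^ j / fact (2 * j))"
      using divide_right_mono[OF power_convex_comb[of "(a - b)\<^sup>2" "(a + b)\<^sup>2" \<tau> j], of "fact (2 * j)"] tau
      unfolding sq by (simp add: add_divide_distrib)
  qed
  also have "\<dots> = cosh a * cosh b + \<theta> * (sinh a * sinh b)"
    by (simp add: \<tau>_def cosh_add cosh_diff field_simps)
  \<comment> \<open>\<open>sinh b\<close> is split into b, which yields a term linear in x that
    vanishes in the mean, and the nonnegative rest \<open>sinh b - b\<close>, where \<theta> may be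
    replaced by 1. This is the origin of \<open>exp (norm x) - norm x\<close>.\<close>
  also have "\<dots> = cosh a * cosh b + sinh a * (\<theta> * (sinh b - b)) + sinh a * (\<theta> * b)"
    by (simp add: algebra_simps)
  also have "sinh a * (\<theta> * (sinh b - b)) \<le> cosh a * (sinh b - b)"
  proof -
    have sb: "0 \<le> sinh b - b"
    proof -
      have "(\<lambda>x. sinh x - x) 0 \<le> (\<lambda>x. sinh x - x) b"
        using ab(2)
        by (rule DERIV_nonneg_imp_nondecreasing)
          (auto intro!: exI derivative_eq_intros simp: cosh_real_ge_1)
      then show ?thesis by simp
    qed
    have "\<theta> * (sinh b - b) \<le> 1 * (sinh b - b)" using th sb by (intro mult_right_mono) auto
    then have "sinh a * (\<theta> * (sinh b - b)) \<le> sinh a * (sinh b - b)" using ab by (intro mult_left_mono) auto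
    also have "\<dots> \<le> cosh a * (sinh b - b)" using sb by (intro mult_right_mono sinh_le_cosh_real)
    finally show ?thesis .
  qed
  finally have "cosh (norm (s + x)) \<le> cosh a * (cosh b + sinh b - b) + sinh a * (\<theta> * b)"
    by (simp add: algebra_simps)
  also have "cosh b + sinh b - b = exp b - b" by (simp add: cosh_plus_sinh)
  also have "sinh a * (\<theta> * b) = (sinh a / a) * (s \<bullet> x)" by (cases "a = 0") (auto simp: sx)
  finally show ?thesis by (simp add: a_def b_def)
qed

text \<open>Integrating one coordinate at a time removes the linear term, and each coordinate costs
  a factor \<open>1 + a\<close>. Centring is stated through inner products, so no vector-valued
  integral occurs.\<close>

lemma cosh_norm_sum_integral_le:
  fixes \<xi> :: "'b \<Rightarrow> 'h::{real_inner,second_countable_topology}"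
  assumes P: "prob_space P" and \<xi>[measurable]: "\<xi> \<in> borel_measurable P"
    and mean: "\<And>c. integrable P (\<lambda>y. c \<bullet> \<xi> y)" "\<And>c. (\<integral>y. c \<bullet> \<xi> y \<partial>P) = 0"
    and mgf: "(\<integral>\<^sup>+y. ennreal (exp (norm (\<xi> y)) - norm (\<xi> y)) \<partial>P) \<le> ennreal (1 + a)" and a: "0 \<le> a"
    and "finite I"
  shows "(\<integral>\<^sup>+z. ennreal (cosh (norm (\<Sum>i\<in>I. \<xi> (z i)))) \<partial>Pi\<^sub>M I (\<lambda>_. P)) \<le> ennreal ((1 + a) ^ card I)"
  using \<open>finite I\<close>
proof (induction I)
  case empty
  interpret P0: prob_space "Pi\<^sub>M {} (\<lambda>_. P)" by (intro prob_space_PiM P)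
  show ?case by (simp add: P0.emeasure_space_1)
next
  case (insert l J)
  interpret prob_space P by fact
  interpret product_sigma_finite "\<lambda>_. P" by unfold_locales
  have cosh_meas[measurable]: "(cosh :: real \<Rightarrow> real) \<in> borel_measurable borel"
    by (intro borel_measurable_continuous_onI continuous_intros)
  have exp_ge: "norm y \<le> exp (norm y)" for y :: 'h
    using exp_ge_add_one_self[of "norm y"] by linarith
  have int: "integrable P (\<lambda>y. exp (norm (\<xi> y)) - norm (\<xi> y))"
    using mgf exp_ge by (intro integrableI_nonneg) (auto intro: le_less_trans)
  have le: "(\<integral>y. exp (norm (\<xi> y)) - norm (\<xi> y) \<partial>P) \<le> 1 + a"
  proof -
    have "ennreal (\<integral>y. exp (norm (\<xi> y)) - norm (\<xi> y) \<partial>P) \<le> ennreal (1 + a)"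
      using nn_integral_eq_integral[OF int] mgf exp_ge by simp
    then show ?thesis using a by (subst (asm) ennreal_le_iff) auto
  qed
  have step: "(\<integral>\<^sup>+y. ennreal (cosh (norm (s + \<xi> y))) \<partial>P) \<le> ennreal (cosh (norm s)) * ennreal (1 + a)" for s
  proof -
    let ?g = "\<lambda>y. cosh (norm s) * (exp (norm (\<xi> y)) - norm (\<xi> y)) + (sinh (norm s) / norm s) * (s \<bullet> \<xi> y)"
    have ig: "integrable P ?g" by (intro Bochner_Integration.integrable_add integrable_mult_right int mean)
    have g0: "0 \<le> ?g y" for y
      using cosh_norm_add_le[of s "\<xi> y"] cosh_real_pos[of "norm (s + \<xi> y)"] by linarith
    have "(\<integral>\<^sup>+y. ennreal (cosh (norm (s + \<xi> y))) \<partial>P) \<le> (\<integral>\<^sup>+y. ennreal (?g y) \<partial>P)"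
      by (intro nn_integral_mono ennreal_leI cosh_norm_add_le)
    also have "\<dots> = ennreal (\<integral>y. ?g y \<partial>P)" using ig g0 by (intro nn_integral_eq_integral) auto
    also have "(\<integral>y. ?g y \<partial>P) = cosh (norm s) * (\<integral>y. exp (norm (\<xi> y)) - norm (\<xi> y) \<partial>P)"
      using int mean by (subst Bochner_Integration.integral_add) (auto simp del: integral_diff)
    also have "ennreal \<dots> \<le> ennreal (cosh (norm s) * (1 + a))"
      using le by (intro ennreal_leI mult_left_mono) auto
    finally show ?thesis using a by (simp add: ennreal_mult)
  qed
  have meas: "(\<lambda>z. ennreal (cosh (norm (\<Sum>i\<in>S. \<xi> (z i))))) \<in> borel_measurable (Pi\<^sub>M S (\<lambda>_. P))" for S
    by measurable
  have "(\<integral>\<^sup>+z. ennreal (cosh (norm (\<Sum>i\<in>insert l J. \<xi> (z i)))) \<partial>Pi\<^sub>M (insert l J) (\<lambda>_. P))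
     = (\<integral>\<^sup>+z. (\<integral>\<^sup>+y. ennreal (cosh (norm (\<Sum>i\<in>insert l J. \<xi> ((z(l := y)) i)))) \<partial>P) \<partial>Pi\<^sub>M J (\<lambda>_. P))"
    using insert.hyps meas by (intro product_nn_integral_insert) auto
  also have "\<dots> = (\<integral>\<^sup>+z. (\<integral>\<^sup>+y. ennreal (cosh (norm ((\<Sum>i\<in>J. \<xi> (z i)) + \<xi> y))) \<partial>P) \<partial>Pi\<^sub>M J (\<lambda>_. P))"
  proof -
    have "(\<Sum>i\<in>insert l J. \<xi> ((z(l := y)) i)) = (\<Sum>i\<in>J. \<xi> (z i)) + \<xi> y" for z y
    proof -
      have "(\<Sum>i\<in>J. \<xi> ((z(l := y)) i)) = (\<Sum>i\<in>J. \<xi> (z i))" using insert.hyps by (intro sum.cong) auto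
      then show ?thesis using insert.hyps by (simp add: add.commute)
    qed
    then show ?thesis by (simp only:)
  qed
  also have "\<dots> \<le> (\<integral>\<^sup>+z. ennreal (cosh (norm (\<Sum>i\<in>J. \<xi> (z i)))) * ennreal (1 + a) \<partial>Pi\<^sub>M J (\<lambda>_. P))"
    by (intro nn_integral_mono step)
  also have "\<dots> = (\<integral>\<^sup>+z. ennreal (cosh (norm (\<Sum>i\<in>J. \<xi> (z i)))) \<partial>Pi\<^sub>M J (\<lambda>_. P)) * ennreal (1 + a)"
    by (intro nn_integral_multc meas)
  also have "\<dots> \<le> ennreal ((1 + a) ^ card J) * ennreal (1 + a)"
    by (intro mult_right_mono insert.IH) auto
  also have "\<dots> = ennreal ((1 + a) ^ card (insert l J))"
    using insert.hyps a by (simp add: ennreal_mult[symmetric] mult.commute del: ennreal_plus)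
  finally show ?case .
qed

text \<open>Conditioning on the earlier coordinates kills the mixed term, so the variances
  add.\<close>

lemma norm_sum_square_integral_le:
  fixes \<xi> :: "'b \<Rightarrow> 'h::{real_inner,second_countable_topology}" and a :: real
  assumes P: "prob_space P" and \<xi>[measurable]: "\<xi> \<in> borel_measurable P"
    and mean: "\<And>c. integrable P (\<lambda>y. c \<bullet> \<xi> y)" "\<And>c. (\<integral>y. c \<bullet> \<xi> y \<partial>P) = 0"
    and int: "integrable P (\<lambda>y. (norm (\<xi> y))\<^sup>2)" and le: "(\<integral>y. (norm (\<xi> y))\<^sup>2 \<partial>P) \<le> a"
    and "finite I"
  shows "(\<integral>\<^sup>+z. ennreal ((norm (\<Sum>i\<in>I. \<xi> (z i)))\<^sup>2) \<partial>Pi\<^sub>M I (\<lambda>_. P)) \<le> ennreal (card I * a)"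
  using \<open>finite I\<close>
proof (induction I)
  case empty
  interpret P0: prob_space "Pi\<^sub>M {} (\<lambda>_. P)" by (intro prob_space_PiM P)
  show ?case by (simp add: P0.emeasure_space_1)
next
  case (insert l J)
  interpret prob_space P by fact
  interpret product_sigma_finite "\<lambda>_. P" by unfold_locales
  interpret PJ: prob_space "Pi\<^sub>M J (\<lambda>_. P)" by (intro prob_space_PiM P)
  have "0 \<le> (\<integral>y. (norm (\<xi> y))\<^sup>2 \<partial>P)" by simp
  then have a: "0 \<le> a" using le by linarith
  have step: "(\<integral>\<^sup>+y. ennreal ((norm (s + \<xi> y))\<^sup>2) \<partial>P) \<le> ennreal ((norm s)\<^sup>2) + ennreal a" for s
  proof -
    have ex: "(norm (s + y))\<^sup>2 = (norm s)\<^sup>2 + 2 * (s \<bullet> y) + (norm y)\<^sup>2" for y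
      by (simp add: power2_norm_eq_inner inner_simps inner_commute)
    have "integrable P (\<lambda>y. (norm (s + \<xi> y))\<^sup>2)"
      unfolding ex by (intro Bochner_Integration.integrable_add integrable_mult_right int mean) auto
    then have "(\<integral>\<^sup>+y. ennreal ((norm (s + \<xi> y))\<^sup>2) \<partial>P) = ennreal (\<integral>y. (norm (s + \<xi> y))\<^sup>2 \<partial>P)"
      by (intro nn_integral_eq_integral) auto
    also have "(\<integral>y. (norm (s + \<xi> y))\<^sup>2 \<partial>P) = (norm s)\<^sup>2 + (\<integral>y. (norm (\<xi> y))\<^sup>2 \<partial>P)"
      unfolding ex using mean int by (simp add: prob_space)
    also have "ennreal \<dots> \<le> ennreal ((norm s)\<^sup>2 + a)" using le by (intro ennreal_leI) auto
    finally show ?thesis using a by simp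
  qed
  have meas: "(\<lambda>z. ennreal ((norm (\<Sum>i\<in>S. \<xi> (z i)))\<^sup>2)) \<in> borel_measurable (Pi\<^sub>M S (\<lambda>_. P))" for S
    by measurable
  have "(\<integral>\<^sup>+z. ennreal ((norm (\<Sum>i\<in>insert l J. \<xi> (z i)))\<^sup>2) \<partial>Pi\<^sub>M (insert l J) (\<lambda>_. P))
     = (\<integral>\<^sup>+z. (\<integral>\<^sup>+y. ennreal ((norm (\<Sum>i\<in>insert l J. \<xi> ((z(l := y)) i)))\<^sup>2) \<partial>P) \<partial>Pi\<^sub>M J (\<lambda>_. P))"
    using insert.hyps meas by (intro product_nn_integral_insert) auto
  also have "\<dots> = (\<integral>\<^sup>+z. (\<integral>\<^sup>+y. ennreal ((norm ((\<Sum>i\<in>J. \<xi> (z i)) + \<xi> y))\<^sup>2) \<partial>P) \<partial>Pi\<^sub>M J (\<lambda>_. P))"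
  proof -
    have "(\<Sum>i\<in>insert l J. \<xi> ((z(l := y)) i)) = (\<Sum>i\<in>J. \<xi> (z i)) + \<xi> y" for z y
    proof -
      have "(\<Sum>i\<in>J. \<xi> ((z(l := y)) i)) = (\<Sum>i\<in>J. \<xi> (z i))" using insert.hyps by (intro sum.cong) auto
      then show ?thesis using insert.hyps by (simp add: add.commute)
    qed
    then show ?thesis by (simp only:)
  qed
  also have "\<dots> \<le> (\<integral>\<^sup>+z. ennreal ((norm (\<Sum>i\<in>J. \<xi> (z i)))\<^sup>2) + ennreal a \<partial>Pi\<^sub>M J (\<lambda>_. P))"
    by (intro nn_integral_mono step)
  also have "\<dots> = (\<integral>\<^sup>+z. ennreal ((norm (\<Sum>i\<in>J. \<xi> (z i)))\<^sup>2) \<partial>Pi\<^sub>M J (\<lambda>_. P)) + ennreal a"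
    by (subst nn_integral_add[OF meas]) (auto simp: PJ.emeasure_space_1)
  also have "\<dots> \<le> ennreal (card J * a) + ennreal a"
    by (intro add_right_mono insert.IH)
  also have "\<dots> = ennreal (card (insert l J) * a)"
    using insert.hyps a by (simp add: ennreal_plus[symmetric] algebra_simps del: ennreal_plus)
  finally show ?case .
qed

section \<open>Hilbert space preliminaries\<close>

text \<open>The library version is stated for the class \<open>banach\<close>, of which \<open>{real_inner, complete_space}\<close> is not
  a subsort.\<close>
lemma integrable_complete_space:
  fixes f :: "'a \<Rightarrow> 'h::{real_normed_vector,complete_space,second_countable_topology}"
  assumes f[measurable]: "f \<in> borel_measurable M" and int: "integrable M (\<lambda>x. norm (f x))"
  shows "integrable M f"
proof -
  obtain s where s: "\<And>i. simple_function M (s i)"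
    and lim: "\<And>x. x \<in> space M \<Longrightarrow> (\<lambda>i. s i x) \<longlonglongrightarrow> f x"
    and bnd: "\<And>i x. x \<in> space M \<Longrightarrow> norm (s i x) \<le> 2 * norm (f x)"
    using borel_measurable_implies_sequence_metric[OF f, of 0] by simp metis
  have [measurable]: "\<And>i. s i \<in> borel_measurable M"
    using s by (auto intro: borel_measurable_simple_function)
  have fin: "(\<integral>\<^sup>+x. ennreal (norm (f x)) \<partial>M) < \<infinity>"
    using int by (simp add: integrable_iff_bounded)
  have fin2: "(\<integral>\<^sup>+x. ennreal (2 * norm (f x)) \<partial>M) < \<infinity>"
    using fin by (simp add: nn_integral_cmult ennreal_mult ennreal_mult_less_top)
  have sb: "Bochner_Integration.simple_bochner_integrable M (s i)" for i
  proof (rule simple_bochner_integrableI_bounded[OF s])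
    have "(\<integral>\<^sup>+x. ennreal (norm (s i x)) \<partial>M) \<le> (\<integral>\<^sup>+x. ennreal (2 * norm (f x)) \<partial>M)"
      by (intro nn_integral_mono ennreal_leI bnd)
    then show "(\<integral>\<^sup>+x. ennreal (norm (s i x)) \<partial>M) < \<infinity>" using fin2 by (rule le_less_trans)
  qed
  define d where "d = (\<lambda>i. \<integral>\<^sup>+x. ennreal (norm (f x - s i x)) \<partial>M)"
  have d: "d \<longlonglongrightarrow> 0"
    unfolding d_def
    by (rule nn_integral_dominated_convergence_norm[where w="\<lambda>x. 2 * norm (f x)"])
      (use bnd lim fin2 in auto)
  let ?I = "\<lambda>i. Bochner_Integration.simple_bochner_integral M (s i)"
  have "Cauchy ?I"
  proof (rule metric_CauchyI)
    fix e :: real assume e: "0 < e"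
    then have "eventually (\<lambda>i. d i < ennreal (e / 2)) sequentially"
      using order_tendstoD(2)[OF d, of "ennreal (e / 2)"] by simp
    then obtain n0 where n0: "\<And>i. i \<ge> n0 \<Longrightarrow> d i < ennreal (e / 2)"
      by (auto simp: eventually_sequentially)
    have "dist (?I i) (?I j) < e" if "i \<ge> n0" "j \<ge> n0" for i j
    proof -
      have "ennreal (norm (?I i - ?I j)) \<le> d i + d j"
        unfolding d_def by (rule simple_bochner_integral_bounded[OF f sb sb])
      also have "\<dots> < ennreal (e / 2) + ennreal (e / 2)" using that by (intro add_strict_mono n0)
      also have "\<dots> = ennreal e" using e by (simp add: ennreal_plus[symmetric] del: ennreal_plus)
      finally show ?thesis using e by (simp add: dist_norm ennreal_less_iff)
    qed
    then show "\<exists>n0. \<forall>i\<ge>n0. \<forall>j\<ge>n0. dist (?I i) (?I j) < e" by blast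
  qed
  then obtain x where "?I \<longlonglongrightarrow> x" by (auto simp: Cauchy_convergent_iff convergent_def)
  then have "has_bochner_integral M f x"
    using d sb by (intro has_bochner_integral.intros[where s=s]) (auto simp: d_def)
  then show ?thesis by (rule integrable.intros)
qed

text \<open>The equation is the fixed-point equation of
  \<open>x - \<tau> *\<^sub>R (A x - g)\<close>, a contraction for small \<tau> by
  coercivity.\<close>

lemma lax_milgram:
  fixes A :: "'h::{real_inner,complete_space} \<Rightarrow> 'h"
  assumes lin: "linear A" and bnd: "\<And>x. norm (A x) \<le> L * norm x"
    and coer: "\<And>x. l * (norm x)\<^sup>2 \<le> A x \<bullet> x" and l: "0 < l"
  shows "\<exists>!x. A x = g"
proof -
  \<comment> \<open>Adding the square of l to that of L keeps S positive and ensures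
    \<open>\<tau> * l \<le> 1\<close>, so the contraction factor is a real square root.\<close>
  define S where "S = L\<^sup>2 + l\<^sup>2"
  have S0: "0 < S" using l by (simp add: S_def add_nonneg_pos)
  define \<tau> where "\<tau> = l / S"
  have t0: "0 < \<tau>" using l S0 by (simp add: \<tau>_def)
  have tl: "\<tau> * l \<le> 1" using S0 by (simp add: \<tau>_def S_def divide_le_eq power2_eq_square)
  define F where "F x = x - \<tau> *\<^sub>R (A x - g)" for x
  have contr: "norm (x - \<tau> *\<^sub>R A x) \<le> sqrt (1 - \<tau> * l) * norm x" for x
  proof -
    have "(norm (x - \<tau> *\<^sub>R A x))\<^sup>2 = (norm x)\<^sup>2 - 2 * \<tau> * (A x \<bullet> x) + \<tau>\<^sup>2 * (norm (A x))\<^sup>2"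
      unfolding power2_norm_eq_inner by (simp add: inner_simps inner_commute power2_eq_square algebra_simps)
    also have "\<dots> \<le> (norm x)\<^sup>2 - 2 * \<tau> * (l * (norm x)\<^sup>2) + \<tau>\<^sup>2 * (L * norm x)\<^sup>2"
      using t0 bnd[of x] coer[of x]
      by (intro add_mono diff_mono mult_left_mono power_mono) auto
    also have "\<dots> \<le> (norm x)\<^sup>2 - 2 * \<tau> * (l * (norm x)\<^sup>2) + \<tau>\<^sup>2 * (S * (norm x)\<^sup>2)"
      by (intro add_left_mono mult_left_mono) (auto simp: S_def algebra_simps)
    also have "\<tau>\<^sup>2 * (S * (norm x)\<^sup>2) = \<tau> * l * (norm x)\<^sup>2"
      using S0 by (simp add: \<tau>_def power2_eq_square)
    also have "(norm x)\<^sup>2 - 2 * \<tau> * (l * (norm x)\<^sup>2) + \<tau> * l * (norm x)\<^sup>2 = (1 - \<tau> * l) * (norm x)\<^sup>2"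
      by (simp add: algebra_simps)
    finally have "sqrt ((norm (x - \<tau> *\<^sub>R A x))\<^sup>2) \<le> sqrt ((1 - \<tau> * l) * (norm x)\<^sup>2)"
      by (rule real_sqrt_le_mono)
    then show ?thesis by (simp add: real_sqrt_mult)
  qed
  have "\<exists>!x. F x = x"
  proof (rule banach_fix_type)
    show "0 \<le> sqrt (1 - \<tau> * l)" using tl by simp
    show "sqrt (1 - \<tau> * l) < 1" using t0 l by simp
    show "\<forall>x y. dist (F x) (F y) \<le> sqrt (1 - \<tau> * l) * dist x y"
    proof (intro allI)
      fix x y
      have "F x - F y = (x - y) - \<tau> *\<^sub>R A (x - y)"
        using lin by (simp add: F_def linear_diff algebra_simps)
      then show "dist (F x) (F y) \<le> sqrt (1 - \<tau> * l) * dist x y" using contr[of "x - y"] by (simp add: dist_norm)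
    qed
  qed
  moreover have "F x = x \<longleftrightarrow> A x = g" for x using t0 by (simp add: F_def)
  ultimately show ?thesis by simp
qed

section \<open>Orthonormal sequences, Bessel's inequality and Fourier series\<close>

locale orthonormal_seq =
  fixes h :: "nat \<Rightarrow> 'h::real_inner"
  assumes orthonormal: "h i \<bullet> h j = (if i = j then 1 else 0)"
begin

lemma norm_sum_square: "(norm (\<Sum>i\<in>{a..<b}. c i *\<^sub>R h i))\<^sup>2 = (\<Sum>i\<in>{a..<b}. (c i)\<^sup>2)"
  unfolding power2_norm_eq_inner
  by (simp add: inner_sum_left inner_sum_right orthonormal if_distrib power2_eq_square cong: if_cong)

lemma norm_diff_partial_sum:
  "(norm (x - (\<Sum>i<n. (x \<bullet> h i) *\<^sub>R h i)))\<^sup>2 = (norm x)\<^sup>2 - (\<Sum>i<n. (x \<bullet> h i)\<^sup>2)"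
proof -
  let ?s = "\<Sum>i<n. (x \<bullet> h i) *\<^sub>R h i"
  have "x \<bullet> ?s = (\<Sum>i<n. (x \<bullet> h i)\<^sup>2)" by (simp add: inner_sum_right power2_eq_square)
  moreover have "?s \<bullet> ?s = (\<Sum>i<n. (x \<bullet> h i)\<^sup>2)"
    using norm_sum_square[of "\<lambda>i. x \<bullet> h i" 0 n] by (simp add: power2_norm_eq_inner lessThan_atLeast0)
  ultimately show ?thesis by (simp add: power2_norm_eq_inner inner_diff_left inner_diff_right inner_commute)
qed

lemma bessel: "(\<Sum>i<n. (x \<bullet> h i)\<^sup>2) \<le> (norm x)\<^sup>2"
  using norm_diff_partial_sum[of x n] zero_le_power2[of "norm (x - (\<Sum>i<n. (x \<bullet> h i) *\<^sub>R h i))"] by linarith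

lemma inner_partial_sum: "(\<Sum>i<n. c i *\<^sub>R h i) \<bullet> h j = (if j < n then c j else 0)"
  by (simp add: inner_sum_left orthonormal if_distrib cong: if_cong)

end

text \<open>By Bessel's inequality the coefficients are square summable, and orthonormality
  transfers the Cauchy property. The limit need not be x, since the sequence is not assumed to be
  complete.\<close>

lemma convergent_fourier:
  fixes h :: "nat \<Rightarrow> 'h::{real_inner,complete_space}"
  assumes "orthonormal_seq h"
  shows "convergent (\<lambda>n. \<Sum>i<n. (x \<bullet> h i) *\<^sub>R h i)"
proof -
  interpret orthonormal_seq h by fact
  have "summable (\<lambda>i. (x \<bullet> h i)\<^sup>2)"
    by (rule bounded_imp_summable[of _ "(norm x)\<^sup>2"])
      (simp_all add: lessThan_Suc_atMost[symmetric] bessel del: sum.lessThan_Suc)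
  then have "Cauchy (\<lambda>n. \<Sum>i<n. (x \<bullet> h i)\<^sup>2)"
    by (auto simp: summable_iff_convergent Cauchy_convergent_iff)
  have "Cauchy (\<lambda>n. \<Sum>i<n. (x \<bullet> h i) *\<^sub>R h i)"
  proof (rule CauchyI')
    fix e :: real assume "0 < e"
    then have "0 < e\<^sup>2" by simp
    from CauchyD[OF \<open>Cauchy (\<lambda>n. \<Sum>i<n. (x \<bullet> h i)\<^sup>2)\<close> this] obtain N where
      N: "\<And>a b. a \<ge> N \<Longrightarrow> b \<ge> N \<Longrightarrow> norm ((\<Sum>i<a. (x \<bullet> h i)\<^sup>2) - (\<Sum>i<b. (x \<bullet> h i)\<^sup>2)) < e\<^sup>2" by blast
    have "norm ((\<Sum>i<a. (x \<bullet> h i) *\<^sub>R h i) - (\<Sum>i<b. (x \<bullet> h i) *\<^sub>R h i)) < e" if "a \<ge> N" "b > a" for a b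
    proof -
      have split: "sum f {..<b} = sum f {..<a} + sum f {a..<b}" for f :: "nat \<Rightarrow> 'z::comm_monoid_add"
        using that sum.atLeastLessThan_concat[of 0 a b f] by (simp add: lessThan_atLeast0)
      have "(norm (\<Sum>i\<in>{a..<b}. (x \<bullet> h i) *\<^sub>R h i))\<^sup>2 < e\<^sup>2"
        unfolding norm_sum_square using N[of a b] that by (simp add: split sum_nonneg)
      then have "norm (\<Sum>i\<in>{a..<b}. (x \<bullet> h i) *\<^sub>R h i) < e"
        by (rule power_less_imp_less_base) (use \<open>0 < e\<close> in simp)
      then show ?thesis by (simp add: split norm_minus_commute)
    qed
    then show "\<exists>M. \<forall>m\<ge>M. \<forall>n>m. dist (\<Sum>i<m. (x \<bullet> h i) *\<^sub>R h i) (\<Sum>i<n. (x \<bullet> h i) *\<^sub>R h i) < e"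
      unfolding dist_norm by (intro exI[of _ N] allI impI) simp
  qed
  then show ?thesis by (simp add: Cauchy_convergent_iff)
qed

section \<open>Disintegration\<close>

locale disintegrated = prob_space \<rho> for \<rho> :: "('a::euclidean_space \<times> real) measure" +
  fixes X :: "'a set" and K :: "'a \<Rightarrow> real measure"
  assumes sets_rho: "sets \<rho> = sets (restrict_space borel (X \<times> UNIV))"
    and disint: "disintegration \<rho> X K"
begin

abbreviation \<mu> where "\<mu> \<equiv> marginal \<rho> X"

lemma space_rho: "space \<rho> = X \<times> UNIV"
  using sets_eq_imp_space_eq[OF sets_rho] by (simp add: space_restrict_space)

lemma space_mu: "space \<mu> = X"
  by (simp add: marginal_def space_restrict_space)

lemma sets_mu[measurable_cong]: "sets \<mu> = sets (restrict_space borel X)"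
  by (simp add: marginal_def)

lemma fst_measurable_restrict: "fst \<in> \<rho> \<rightarrow>\<^sub>M restrict_space borel X"
proof (rule measurable_restrict_space2)
  show "fst \<in> space \<rho> \<rightarrow> X" by (auto simp: space_rho)
  have "fst \<in> restrict_space borel (X \<times> UNIV) \<rightarrow>\<^sub>M borel"
    by (intro measurable_restrict_space1 borel_measurable_continuous_onI continuous_intros)
  then show "fst \<in> \<rho> \<rightarrow>\<^sub>M borel" by (simp cong: measurable_cong_sets add: measurable_cong_sets[OF sets_rho])
qed

lemma fst_measurable[measurable]: "fst \<in> \<rho> \<rightarrow>\<^sub>M \<mu>"
  using fst_measurable_restrict by (simp add: measurable_cong_sets[OF refl sets_mu])

lemma snd_measurable[measurable]: "snd \<in> borel_measurable \<rho>"
proof -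
  have "snd \<in> restrict_space borel (X \<times> UNIV) \<rightarrow>\<^sub>M borel"
    by (intro measurable_restrict_space1 borel_measurable_continuous_onI continuous_intros)
  then show ?thesis by (simp add: measurable_cong_sets[OF sets_rho])
qed

sublocale mu: prob_space \<mu>
  unfolding marginal_def by (rule prob_space_distr[OF fst_measurable_restrict])

lemma integral_marginal:
  fixes f :: "'a \<Rightarrow> real"
  shows "f \<in> borel_measurable \<mu> \<Longrightarrow> (\<integral>x. f x \<partial>\<mu>) = (\<integral>z. f (fst z) \<partial>\<rho>)"
  unfolding marginal_def
  by (rule integral_distr[OF fst_measurable_restrict]) simp

lemma integrable_marginal:
  fixes f :: "'a \<Rightarrow> real"
  shows "f \<in> borel_measurable \<mu> \<Longrightarrow> integrable \<mu> f \<longleftrightarrow> integrable \<rho> (\<lambda>z. f (fst z))"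
  unfolding marginal_def
  by (rule integrable_distr_eq[OF fst_measurable_restrict]) simp

lemma AE_marginal: "(AE x in \<mu>. P x) \<Longrightarrow> AE z in \<rho>. P (fst z)"
  unfolding marginal_def by (rule AE_distrD[OF fst_measurable_restrict])

lemma K_measurable[measurable]: "K \<in> \<mu> \<rightarrow>\<^sub>M prob_algebra borel"
  using disint by (simp add: disintegration_def measurable_cong_sets[OF sets_mu])

lemma K_measurable_subprob[measurable]: "K \<in> \<mu> \<rightarrow>\<^sub>M subprob_algebra borel"
  by (rule measurable_prob_algebraD[OF K_measurable])

lemma K_prob: "x \<in> X \<Longrightarrow> prob_space (K x)" and K_sets: "x \<in> X \<Longrightarrow> sets (K x) = sets borel"
  using measurable_space[OF K_measurable, of x] by (auto simp: space_mu space_prob_algebra)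

lemma pair_measurable: "(\<lambda>(x, y). (x, y)) \<in> \<mu> \<Otimes>\<^sub>M borel \<rightarrow>\<^sub>M \<rho>"
proof -
  have "(\<lambda>x. x) \<in> \<mu> \<rightarrow>\<^sub>M borel"
    by (simp add: measurable_cong_sets[OF sets_mu] measurable_restrict_space1)
  then have "(\<lambda>p. (fst p, snd p)) \<in> \<mu> \<Otimes>\<^sub>M borel \<rightarrow>\<^sub>M borel \<Otimes>\<^sub>M (borel :: real measure)"
    by (intro measurable_Pair) (auto intro: measurable_compose[OF measurable_fst])
  then have "(\<lambda>p. p) \<in> \<mu> \<Otimes>\<^sub>M borel \<rightarrow>\<^sub>M restrict_space borel (X \<times> (UNIV :: real set))"
    by (intro measurable_restrict_space2) (auto simp: space_pair_measure space_mu borel_prod)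
  then show ?thesis by (simp add: measurable_cong_sets[OF refl sets_rho] case_prod_eta)
qed

text \<open>The defining identity on sets says that the joint law is the monadic bind of the
  marginal with the kernel pushing \<open>K x\<close> forward along \<open>Pair x\<close>;
  integration against a bind is iterated integration.\<close>

lemma nn_integral_disintegration:
  assumes f: "f \<in> borel_measurable \<rho>"
  shows "(\<integral>\<^sup>+z. f z \<partial>\<rho>) = (\<integral>\<^sup>+x. (\<integral>\<^sup>+y. f (x, y) \<partial>K x) \<partial>\<mu>)"
proof -
  let ?N = "\<lambda>x. distr (K x) \<rho> (Pair x)"
  have N: "?N \<in> \<mu> \<rightarrow>\<^sub>M subprob_algebra \<rho>"
    using pair_measurable by (intro measurable_distr2[where M=borel]) auto
  have Pair_meas: "Pair x \<in> K x \<rightarrow>\<^sub>M \<rho>" if "x \<in> X" for x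
    using measurable_compose[OF measurable_Pair1'[of x \<mu> borel] pair_measurable] that
    by (simp add: space_mu measurable_cong_sets[OF K_sets[OF that] refl])
  have "X \<noteq> {}" using mu.not_empty by (simp add: space_mu)
  have "\<rho> = \<mu> \<bind> ?N"
  proof (rule measure_eqI)
    show "sets \<rho> = sets (\<mu> \<bind> ?N)"
      using \<open>X \<noteq> {}\<close> by (intro sets_bind[OF sets_kernel[OF N], symmetric]) (auto simp: space_mu)
    fix A assume A: "A \<in> sets \<rho>"
    have "emeasure \<rho> A = (\<integral>\<^sup>+x. emeasure (K x) (Pair x -` A) \<partial>\<mu>)"
      using disint A by (simp add: disintegration_def)
    also have "\<dots> = (\<integral>\<^sup>+x. emeasure (?N x) A \<partial>\<mu>)"
    proof (rule nn_integral_cong)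
      fix x assume "x \<in> space \<mu>"
      then have x: "x \<in> X" by (simp add: space_mu)
      have "space (K x) = UNIV" using sets_eq_imp_space_eq[OF K_sets[OF x]] by simp
      then show "emeasure (K x) (Pair x -` A) = emeasure (?N x) A"
        using emeasure_distr[OF Pair_meas[OF x] A] by simp
    qed
    also have "\<dots> = emeasure (\<mu> \<bind> ?N) A"
      using \<open>X \<noteq> {}\<close> by (intro emeasure_bind[OF _ N A, symmetric]) (simp add: space_mu)
    finally show "emeasure \<rho> A = emeasure (\<mu> \<bind> ?N) A" .
  qed
  then have "(\<integral>\<^sup>+z. f z \<partial>\<rho>) = (\<integral>\<^sup>+z. f z \<partial>(\<mu> \<bind> ?N))" by simp
  also have "\<dots> = (\<integral>\<^sup>+x. (\<integral>\<^sup>+z. f z \<partial>?N x) \<partial>\<mu>)" by (rule nn_integral_bind[OF f N])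
  also have "\<dots> = (\<integral>\<^sup>+x. (\<integral>\<^sup>+y. f (x, y) \<partial>K x) \<partial>\<mu>)"
    using f by (intro nn_integral_cong nn_integral_distr Pair_meas) (auto simp: space_mu)
  finally show ?thesis .
qed

lemma inner_nn_integral_measurable[measurable]:
  assumes "f \<in> borel_measurable \<rho>"
  shows "(\<lambda>x. \<integral>\<^sup>+y. f (x, y) \<partial>K x) \<in> borel_measurable \<mu>"
proof (rule nn_integral_measurable_subprob_algebra2[OF _ K_measurable_subprob])
  show "(\<lambda>(x, y). f (x, y)) \<in> borel_measurable (\<mu> \<Otimes>\<^sub>M borel)"
    using measurable_compose[OF pair_measurable assms] by (simp add: case_prod_beta)
qed

lemma section_measurable:
  assumes "f \<in> borel_measurable \<rho>" "x \<in> X"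
  shows "(\<lambda>y. f (x, y)) \<in> borel_measurable (K x)"
proof -
  have "Pair x \<in> K x \<rightarrow>\<^sub>M \<rho>"
    using measurable_compose[OF measurable_Pair1'[of x \<mu> borel] pair_measurable] assms(2)
    by (simp add: space_mu measurable_cong_sets[OF K_sets[OF assms(2)] refl])
  then show ?thesis using measurable_compose[OF _ assms(1)] by blast
qed

lemma integral_disintegration:
  fixes f :: "'a \<times> real \<Rightarrow> real"
  assumes f: "integrable \<rho> f"
  shows "AE x in \<mu>. integrable (K x) (\<lambda>y. f (x, y))"
    and "integrable \<mu> (\<lambda>x. \<integral>y. f (x, y) \<partial>K x)"
    and "(\<integral>z. f z \<partial>\<rho>) = (\<integral>x. (\<integral>y. f (x, y) \<partial>K x) \<partial>\<mu>)"
proof -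
  have fm[measurable]: "f \<in> borel_measurable \<rho>" using f by auto
  let ?p = "\<lambda>x. \<integral>\<^sup>+y. ennreal (f (x, y)) \<partial>K x"
  let ?m = "\<lambda>x. \<integral>\<^sup>+y. ennreal (- f (x, y)) \<partial>K x"
  have pm: "?p \<in> borel_measurable \<mu>" "?m \<in> borel_measurable \<mu>"
    using inner_nn_integral_measurable[of "\<lambda>z. ennreal (f z)"]
      inner_nn_integral_measurable[of "\<lambda>z. ennreal (- f z)"] by auto
  have P: "(\<integral>\<^sup>+z. ennreal (f z) \<partial>\<rho>) = (\<integral>\<^sup>+x. ?p x \<partial>\<mu>)"
    and N: "(\<integral>\<^sup>+z. ennreal (- f z) \<partial>\<rho>) = (\<integral>\<^sup>+x. ?m x \<partial>\<mu>)"
    by (auto intro!: nn_integral_disintegration)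
  have fin: "(\<integral>\<^sup>+x. ?p x \<partial>\<mu>) \<noteq> \<infinity>" "(\<integral>\<^sup>+x. ?m x \<partial>\<mu>) \<noteq> \<infinity>"
    using f unfolding real_integrable_def P[symmetric] N[symmetric] by auto
  have AEp: "AE x in \<mu>. ?p x \<noteq> \<infinity>" and AEm: "AE x in \<mu>. ?m x \<noteq> \<infinity>"
    using nn_integral_PInf_AE[OF pm(1) fin(1)] nn_integral_PInf_AE[OF pm(2) fin(2)] by auto
  show ae: "AE x in \<mu>. integrable (K x) (\<lambda>y. f (x, y))"
    using AEp AEm AE_space
    by eventually_elim (auto simp: real_integrable_def space_mu intro: section_measurable)
  have eq: "AE x in \<mu>. (\<integral>y. f (x, y) \<partial>K x) = enn2real (?p x) - enn2real (?m x)"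
    using ae by eventually_elim (rule real_lebesgue_integral_def)
  have ip: "integrable \<mu> (\<lambda>x. enn2real (?p x))" "(\<integral>x. enn2real (?p x) \<partial>\<mu>) = enn2real (\<integral>\<^sup>+x. ?p x \<partial>\<mu>)"
    and im: "integrable \<mu> (\<lambda>x. enn2real (?m x))" "(\<integral>x. enn2real (?m x) \<partial>\<mu>) = enn2real (\<integral>\<^sup>+x. ?m x \<partial>\<mu>)"
  proof -
    have *: "(\<integral>\<^sup>+x. ennreal (enn2real (?p x)) \<partial>\<mu>) = (\<integral>\<^sup>+x. ?p x \<partial>\<mu>)"
      using AEp by (intro nn_integral_cong_AE) (auto simp: less_top)
    then show "integrable \<mu> (\<lambda>x. enn2real (?p x))"
      using fin pm by (intro integrableI_nonneg) (auto simp: less_top)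
    show "(\<integral>x. enn2real (?p x) \<partial>\<mu>) = enn2real (\<integral>\<^sup>+x. ?p x \<partial>\<mu>)"
      using pm by (subst integral_eq_nn_integral) (auto simp: *)
    have *: "(\<integral>\<^sup>+x. ennreal (enn2real (?m x)) \<partial>\<mu>) = (\<integral>\<^sup>+x. ?m x \<partial>\<mu>)"
      using AEm by (intro nn_integral_cong_AE) (auto simp: less_top)
    then show "integrable \<mu> (\<lambda>x. enn2real (?m x))"
      using fin pm by (intro integrableI_nonneg) (auto simp: less_top)
    show "(\<integral>x. enn2real (?m x) \<partial>\<mu>) = enn2real (\<integral>\<^sup>+x. ?m x \<partial>\<mu>)"
      using pm by (subst integral_eq_nn_integral) (auto simp: *)
  qed
  \<comment> \<open>Measurability has to include the points where the section is not integrable and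
    its integral is 0 by convention.\<close>
  have meas: "(\<lambda>x. \<integral>y. f (x, y) \<partial>K x) \<in> borel_measurable \<mu>"
  proof -
    have "(\<lambda>x. \<integral>z. f z \<partial>distr (K x) \<rho> (Pair x)) \<in> borel_measurable \<mu>"
      by (rule measurable_compose[OF measurable_distr2[where M=borel] integral_measurable_subprob_algebra[OF fm]])
        (use pair_measurable in auto)
    moreover have "(\<integral>z. f z \<partial>distr (K x) \<rho> (Pair x)) = (\<integral>y. f (x, y) \<partial>K x)" if "x \<in> space \<mu>" for x
    proof -
      have x: "x \<in> X" using that by (simp add: space_mu)
      have "Pair x \<in> K x \<rightarrow>\<^sub>M \<rho>"
        using measurable_compose[OF measurable_Pair1'[of x \<mu> borel] pair_measurable] that
        by (simp add: space_mu measurable_cong_sets[OF K_sets[OF x] refl])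
      then show ?thesis by (intro integral_distr) auto
    qed
    ultimately show ?thesis by (simp cong: measurable_cong)
  qed
  show "integrable \<mu> (\<lambda>x. \<integral>y. f (x, y) \<partial>K x)"
    using Bochner_Integration.integrable_diff[OF ip(1) im(1)] meas eq
    by (subst integrable_cong_AE) auto
  have "(\<integral>z. f z \<partial>\<rho>) = enn2real (\<integral>\<^sup>+x. ?p x \<partial>\<mu>) - enn2real (\<integral>\<^sup>+x. ?m x \<partial>\<mu>)"
    using real_lebesgue_integral_def[OF f] P N by simp
  also have "\<dots> = (\<integral>x. enn2real (?p x) - enn2real (?m x) \<partial>\<mu>)"
    using ip im by simp
  also have "\<dots> = (\<integral>x. (\<integral>y. f (x, y) \<partial>K x) \<partial>\<mu>)"
    using eq meas ip im by (intro integral_cong_AE) auto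
  finally show "(\<integral>z. f z \<partial>\<rho>) = (\<integral>x. (\<integral>y. f (x, y) \<partial>K x) \<partial>\<mu>)" .
qed

end

section \<open>The covariance operator and its eigenbasis\<close>

text \<open>Both bases are at most their maximum and the exponents add to 1. This is the
  interpolation between an eigenvalue and l behind all the spectral estimates below.\<close>

lemma weighted_geometric_le_sum:
  fixes x y t :: real
  assumes "0 < x" "0 < y" "0 \<le> t" "t \<le> 1"
  shows "x powr t * y powr (1 - t) \<le> x + y"
proof -
  have "x powr t * y powr (1 - t) \<le> (max x y) powr t * (max x y) powr (1 - t)"
    using assms by (intro mult_mono powr_mono2) auto
  also have "\<dots> = max x y" using assms by (simp add: powr_add[symmetric])
  also have "\<dots> \<le> x + y" using assms by auto
  finally show ?thesis .
qed

section \<open>Square-integrable functions\<close>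

lemma L2_mult_integrable:
  fixes f g :: "'a \<Rightarrow> real"
  assumes [measurable]: "f \<in> borel_measurable M" "g \<in> borel_measurable M"
    and "integrable M (\<lambda>x. (f x)\<^sup>2)" "integrable M (\<lambda>x. (g x)\<^sup>2)"
  shows "integrable M (\<lambda>x. f x * g x)"
proof (rule Bochner_Integration.integrable_bound[where f="\<lambda>x. (f x)\<^sup>2 + (g x)\<^sup>2"])
  have "\<bar>f x * g x\<bar> \<le> (f x)\<^sup>2 + (g x)\<^sup>2" for x
  proof -
    have "0 \<le> \<bar>f x\<bar> * \<bar>g x\<bar>" by simp
    moreover have "2 * \<bar>f x\<bar> * \<bar>g x\<bar> \<le> (f x)\<^sup>2 + (g x)\<^sup>2"
      using sum_squares_bound[of "\<bar>f x\<bar>" "\<bar>g x\<bar>"] by simp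
    ultimately show ?thesis by (simp only: abs_mult)
  qed
  then show "AE x in M. norm (f x * g x) \<le> norm ((f x)\<^sup>2 + (g x)\<^sup>2)" by simp
qed (use assms in auto)

lemma L2_add_integrable:
  fixes f g :: "'a \<Rightarrow> real"
  assumes "f \<in> borel_measurable M" "g \<in> borel_measurable M"
    and "integrable M (\<lambda>x. (f x)\<^sup>2)" "integrable M (\<lambda>x. (g x)\<^sup>2)"
  shows "integrable M (\<lambda>x. (f x + g x)\<^sup>2)"
proof -
  have "(f x + g x)\<^sup>2 = (f x)\<^sup>2 + 2 * (f x * g x) + (g x)\<^sup>2" for x by (simp add: power2_sum)
  then show ?thesis using L2_mult_integrable[OF assms] assms by simp
qed

lemma L2_sum_integrable:
  fixes f :: "'i \<Rightarrow> 'a \<Rightarrow> real"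
  assumes "\<And>i. i \<in> I \<Longrightarrow> f i \<in> borel_measurable M" "\<And>i. i \<in> I \<Longrightarrow> integrable M (\<lambda>x. (f i x)\<^sup>2)"
  shows "integrable M (\<lambda>x. (\<Sum>i\<in>I. f i x)\<^sup>2)"
  using assms
proof (induction I rule: infinite_finite_induct)
  case (insert i I)
  then show ?case by (auto intro!: L2_add_integrable)
qed auto

text \<open>The nonzero vectors are covered by countably many open sets within which all inner
  products are positive. If \<open>z x\<close> lies in such a set B and is orthogonal to almost
  every \<open>z y\<close>, then almost every \<open>z y\<close> avoids B. This replaces putting
  \<open>y = x\<close>, which an almost-everywhere statement on pairs does not allow.\<close>

lemma (in prob_space) AE_inner_zero_imp:
  fixes z :: "'a \<Rightarrow> 'h::{real_inner,second_countable_topology}"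
  assumes z[measurable]: "z \<in> borel_measurable M"
    and ae: "AE x in M. AE y in M. z x \<bullet> z y = 0"
  shows "AE x in M. z x = 0"
proof -
  obtain \<B> :: "'h set set" where \<B>: "countable \<B>" "topological_basis \<B>" using ex_countable_basis by blast
  define \<U> where "\<U> = {B\<in>\<B>. \<forall>u\<in>B. \<forall>v\<in>B. 0 < u \<bullet> v}"
  have "countable \<U>" using \<B> by (auto simp: \<U>_def intro: countable_subset)
  have null: "AE y in M. z y \<notin> B" if B: "B \<in> \<U>" for B
  proof (rule ccontr)
    assume not: "\<not> (AE y in M. z y \<notin> B)"
    have "\<not> (AE x in M. \<not> (z x \<in> B \<and> (AE y in M. z x \<bullet> z y = 0)))"
    proof
      assume "AE x in M. \<not> (z x \<in> B \<and> (AE y in M. z x \<bullet> z y = 0))"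
      then have "AE x in M. z x \<notin> B" using ae by eventually_elim auto
      then show False using not by simp
    qed
    then have "\<exists>x. z x \<in> B \<and> (AE y in M. z x \<bullet> z y = 0)"
      by (metis (mono_tags, lifting) AE_I2)
    then obtain x where x: "z x \<in> B" "AE y in M. z x \<bullet> z y = 0" by blast
    from x(2) have "AE y in M. z y \<notin> B"
    proof eventually_elim
      case (elim y)
      then show ?case using x(1) B by (fastforce simp: \<U>_def)
    qed
    then show False using not by simp
  qed
  have "AE y in M. \<forall>B\<in>\<U>. z y \<notin> B"
    using null by (subst AE_ball_countable[OF \<open>countable \<U>\<close>]) auto
  then show ?thesis
  proof eventually_elim
    fix y assume y: "\<forall>B\<in>\<U>. z y \<notin> B"
    show "z y = 0"
    proof (rule ccontr)
      assume nz: "z y \<noteq> 0"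
      \<comment> \<open>On the ball of this radius the inner product is at least
        \<open>(16 - 4 - 4 - 1) * r * r\<close>, which is positive.\<close>
      define r where "r = norm (z y) / 4"
      have r: "0 < r" using nz by (simp add: r_def)
      obtain B where B: "B \<in> \<B>" "z y \<in> B" "B \<subseteq> ball (z y) r"
        using topological_basisE[OF \<B>(2), of "ball (z y) r" "z y"] r by auto
      have "0 < u \<bullet> v" if "u \<in> B" "v \<in> B" for u v
      proof -
        define p where "p = u - z y"
        define q where "q = v - z y"
        have pq: "norm p \<le> r" "norm q \<le> r"
          using that B(3) by (auto simp: p_def q_def dist_norm norm_minus_commute subset_iff intro: less_imp_le)
        have "u \<bullet> v = (z y) \<bullet> (z y) + p \<bullet> z y + z y \<bullet> q + p \<bullet> q"
          by (simp add: p_def q_def inner_simps)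
        moreover have "\<bar>p \<bullet> z y\<bar> \<le> r * norm (z y)"
          using Cauchy_Schwarz_ineq2[of p "z y"] mult_right_mono[OF pq(1), of "norm (z y)"] by simp
        moreover have "\<bar>z y \<bullet> q\<bar> \<le> r * norm (z y)"
          using Cauchy_Schwarz_ineq2[of "z y" q] mult_left_mono[OF pq(2), of "norm (z y)"] by (simp add: mult.commute)
        moreover have "\<bar>p \<bullet> q\<bar> \<le> r * r"
          using Cauchy_Schwarz_ineq2[of p q] mult_mono[OF pq] r by simp
        moreover have "(z y) \<bullet> (z y) = 16 * (r * r)" "r * norm (z y) = 4 * (r * r)"
          by (simp_all add: r_def power2_norm_eq_inner[symmetric] power2_eq_square)
        moreover have "0 < r * r" using r by simp
        ultimately show ?thesis by linarith
      qed
      then have "B \<in> \<U>" using B by (auto simp: \<U>_def)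
      then show False using y B by blast
    qed
  qed
qed

locale rkhs_setting = disintegrated \<rho> X K for \<rho> X and K :: "'a::euclidean_space \<Rightarrow> real measure" +
  fixes k :: "'a \<Rightarrow> 'a \<Rightarrow> real" and \<kappa> :: real
    and \<Phi> :: "'a \<Rightarrow> 'h::{real_inner,complete_space,second_countable_topology}"
    and lam :: "nat \<Rightarrow> real" and e :: "nat \<Rightarrow> 'a \<Rightarrow> real"
  assumes second_moment: "integrable \<rho> (\<lambda>(x, y). y\<^sup>2)"
    and kernel_cont: "continuous_on (X \<times> X) (\<lambda>(x, y). k x y)"
    and kernel_bdd: "\<forall>x\<in>X. k x x \<le> \<kappa>\<^sup>2"
    and rkhs: "rkhs_model X k \<Phi>"
    and spec: "spectral_decomp \<mu> k lam e"
begin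

abbreviation fs where "fs \<equiv> regfun K"

lemma k_eq: "x \<in> X \<Longrightarrow> y \<in> X \<Longrightarrow> k x y = \<Phi> x \<bullet> \<Phi> y"
  using rkhs by (auto simp: rkhs_model_def)

lemma lam_pos: "0 < lam i" and lam_dec: "lam (Suc i) \<le> lam i"
  and e_L2: "in_L2 \<mu> (e i)" and e_orth: "(\<integral>x. e i x * e j x \<partial>\<mu>) = (if i = j then 1 else 0)"
  using spec by (auto simp: spectral_decomp_def)

lemma lam_antimono: "i \<le> j \<Longrightarrow> lam j \<le> lam i"
  using lift_Suc_antimono_le[of lam, OF lam_dec] by blast

lemma e_meas[measurable]: "e i \<in> borel_measurable \<mu>" and e_sq: "integrable \<mu> (\<lambda>x. (e i x)\<^sup>2)"
  using e_L2[of i] by (auto simp: in_L2_def)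

lemma norm_Phi: "x \<in> X \<Longrightarrow> norm (\<Phi> x) \<le> \<bar>\<kappa>\<bar>"
  using kernel_bdd k_eq[of x x] by (metis abs_le_square_iff abs_norm_cancel power2_norm_eq_inner)

text \<open>The squared distance of two features is \<open>k y y - 2 * k y x + k x x\<close>, which
  tends to 0 by continuity of the kernel.\<close>

lemma Phi_cont: "continuous_on X \<Phi>"
  unfolding continuous_on_def
proof
  fix x assume x: "x \<in> X"
  have c1: "continuous_on X (\<lambda>y. k y y)"
  proof -
    have "continuous_on X ((\<lambda>(x, y). k x y) \<circ> (\<lambda>y. (y, y)))"
      using x by (intro continuous_on_compose continuous_on_subset[OF kernel_cont]) (auto intro!: continuous_intros)
    then show ?thesis by (simp add: o_def)
  qed
  have c2: "continuous_on X (\<lambda>y. k y x)"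
  proof -
    have "continuous_on X ((\<lambda>(x, y). k x y) \<circ> (\<lambda>y. (y, x)))"
      using x by (intro continuous_on_compose continuous_on_subset[OF kernel_cont]) (auto intro!: continuous_intros)
    then show ?thesis by (simp add: o_def)
  qed
  have "((\<lambda>y. k y y - 2 * k y x + k x x) \<longlongrightarrow> k x x - 2 * k x x + k x x) (at x within X)"
    using c1 c2 x by (intro tendsto_intros) (auto simp: continuous_on_def)
  then have "((\<lambda>y. k y y - 2 * k y x + k x x) \<longlongrightarrow> 0) (at x within X)" by simp
  moreover have "\<forall>\<^sub>F y in at x within X. k y y - 2 * k y x + k x x = (norm (\<Phi> y - \<Phi> x))\<^sup>2"
    using x by (auto simp: eventually_at_filter k_eq power2_norm_eq_inner inner_simps inner_commute)
  ultimately have "((\<lambda>y. (norm (\<Phi> y - \<Phi> x))\<^sup>2) \<longlongrightarrow> 0) (at x within X)"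
    by (rule Lim_transform_eventually)
  then have "((\<lambda>y. sqrt ((norm (\<Phi> y - \<Phi> x))\<^sup>2)) \<longlongrightarrow> sqrt 0) (at x within X)"
    by (rule tendsto_real_sqrt)
  then have "((\<lambda>y. norm (\<Phi> y - \<Phi> x)) \<longlongrightarrow> 0) (at x within X)" by simp
  then show "(\<Phi> \<longlongrightarrow> \<Phi> x) (at x within X)"
    by (simp add: tendsto_norm_zero_iff LIM_zero_iff)
qed

lemma Phi_meas[measurable]: "\<Phi> \<in> borel_measurable \<mu>"
  using borel_measurable_continuous_on_restrict[OF Phi_cont] by (simp add: measurable_cong_sets[OF sets_mu])

lemma inner_Phi_bound: "x \<in> X \<Longrightarrow> \<bar>h \<bullet> \<Phi> x\<bar> \<le> norm h * \<bar>\<kappa>\<bar>"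
  using Cauchy_Schwarz_ineq2[of h "\<Phi> x"] mult_left_mono[OF norm_Phi, of x "norm h"] by force

lemma inner_Phi_sq_integrable: "integrable \<mu> (\<lambda>x. (h \<bullet> \<Phi> x)\<^sup>2)"
proof (rule mu.integrable_const_bound[where B="(norm h * \<bar>\<kappa>\<bar>)\<^sup>2"])
  show "AE x in \<mu>. norm ((h \<bullet> \<Phi> x)\<^sup>2) \<le> (norm h * \<bar>\<kappa>\<bar>)\<^sup>2"
    using inner_Phi_bound power_mono[OF inner_Phi_bound abs_ge_zero, of _ h 2] by (auto simp: space_mu)
qed simp

lemma inner_Phi_mult_integrable: "integrable \<mu> (\<lambda>x. (h \<bullet> \<Phi> x) * (h' \<bullet> \<Phi> x))"
  by (intro L2_mult_integrable inner_Phi_sq_integrable) auto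

lemma scaleR_Phi_integrable:
  assumes [measurable]: "f \<in> borel_measurable \<mu>" and f: "integrable \<mu> (\<lambda>x. (f x)\<^sup>2)"
  shows "integrable \<mu> (\<lambda>x. f x *\<^sub>R \<Phi> x)"
proof (rule integrable_complete_space)
  have "integrable \<mu> f" using mu.square_integrable_imp_integrable[OF assms(1)] f by simp
  then have "integrable \<mu> (\<lambda>x. \<bar>f x\<bar> * \<bar>\<kappa>\<bar>)" by simp
  then show "integrable \<mu> (\<lambda>x. norm (f x *\<^sub>R \<Phi> x))"
    by (rule Bochner_Integration.integrable_bound) (auto simp: space_mu intro!: mult_left_mono norm_Phi)
qed simp

text \<open>Testing against every u reduces identities between Hilbert space elements to scalar
  integrals.\<close>

lemma g_H_inner:
  assumes "f \<in> borel_measurable \<mu>" "integrable \<mu> (\<lambda>x. (f x)\<^sup>2)"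
  shows "g_H \<mu> \<Phi> f \<bullet> u = (\<integral>x. f x * (u \<bullet> \<Phi> x) \<partial>\<mu>)"
  unfolding g_H_def
  by (subst integral_inner_left[symmetric]) (auto intro: scaleR_Phi_integrable assms simp: inner_commute)

lemma T_H_eq_g_H: "T_H \<mu> \<Phi> h = g_H \<mu> \<Phi> (\<lambda>x. h \<bullet> \<Phi> x)"
  by (simp add: T_H_def g_H_def)

lemma T_H_inner: "T_H \<mu> \<Phi> h \<bullet> u = (\<integral>x. (h \<bullet> \<Phi> x) * (u \<bullet> \<Phi> x) \<partial>\<mu>)"
  unfolding T_H_eq_g_H by (intro g_H_inner inner_Phi_sq_integrable) simp

lemma inner_ext: "(\<And>u. x \<bullet> u = y \<bullet> u) \<Longrightarrow> x = (y :: 'h)"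
  by (metis inner_diff_left inner_eq_zero_iff right_minus_eq)

lemma T_H_linear: "linear (T_H \<mu> \<Phi>)"
proof
  show "T_H \<mu> \<Phi> (a + b) = T_H \<mu> \<Phi> a + T_H \<mu> \<Phi> b" for a b
    by (rule inner_ext) (simp add: T_H_inner inner_add_left distrib_right inner_Phi_mult_integrable)
  show "T_H \<mu> \<Phi> (r *\<^sub>R a) = r *\<^sub>R T_H \<mu> \<Phi> a" for r a
    by (rule inner_ext) (simp add: T_H_inner mult.assoc)
qed

lemma T_H_bound: "norm (T_H \<mu> \<Phi> h) \<le> \<kappa>\<^sup>2 * norm h"
proof -
  let ?t = "T_H \<mu> \<Phi> h"
  have "(norm ?t)\<^sup>2 = (\<integral>x. (h \<bullet> \<Phi> x) * (?t \<bullet> \<Phi> x) \<partial>\<mu>)"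
    by (simp add: power2_norm_eq_inner T_H_inner)
  also have "\<dots> \<le> (\<integral>x. \<kappa>\<^sup>2 * norm h * norm ?t \<partial>\<mu>)"
  proof (rule integral_mono)
    fix x assume "x \<in> space \<mu>"
    then have x: "x \<in> X" by (simp add: space_mu)
    have "(h \<bullet> \<Phi> x) * (?t \<bullet> \<Phi> x) \<le> \<bar>h \<bullet> \<Phi> x\<bar> * \<bar>?t \<bullet> \<Phi> x\<bar>" by (metis abs_ge_self abs_mult)
    also have "\<dots> \<le> (norm h * \<bar>\<kappa>\<bar>) * (norm ?t * \<bar>\<kappa>\<bar>)"
      using inner_Phi_bound[OF x] by (intro mult_mono) auto
    also have "\<dots> = \<kappa>\<^sup>2 * norm h * norm ?t" by (simp add: power2_eq_square algebra_simps)
    finally show "(h \<bullet> \<Phi> x) * (?t \<bullet> \<Phi> x) \<le> \<kappa>\<^sup>2 * norm h * norm ?t" .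
  qed (auto simp: inner_Phi_mult_integrable)
  also have "\<dots> = \<kappa>\<^sup>2 * norm h * norm ?t" by (simp add: mu.prob_space)
  finally have "norm ?t * norm ?t \<le> (\<kappa>\<^sup>2 * norm h) * norm ?t" by (simp add: power2_eq_square)
  then show ?thesis by (cases "norm ?t = 0") (auto simp: mult_le_cancel_right)
qed

lemma fs_meas[measurable]: "fs \<in> borel_measurable \<mu>"
  unfolding regfun_def
  by (rule measurable_compose[OF K_measurable_subprob integral_measurable_subprob_algebra]) simp

lemma y_integrable: "integrable \<rho> snd"
  using second_moment by (intro square_integrable_imp_integrable[of snd]) (auto simp: case_prod_unfold)

lemma fs_sq_integrable: "integrable \<mu> (\<lambda>x. (fs x)\<^sup>2)"
proof (rule Bochner_Integration.integrable_bound)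
  have sq: "integrable \<rho> (\<lambda>z. (snd z)\<^sup>2)" using second_moment by (simp add: case_prod_unfold)
  show "integrable \<mu> (\<lambda>x. \<integral>y. y\<^sup>2 \<partial>K x)" using integral_disintegration(2)[OF sq] by simp
  show "(\<lambda>x. (fs x)\<^sup>2) \<in> borel_measurable \<mu>" by measurable
  show "AE x in \<mu>. norm ((fs x)\<^sup>2) \<le> norm (\<integral>y. y\<^sup>2 \<partial>K x)"
    using integral_disintegration(1)[OF sq] integral_disintegration(1)[OF y_integrable] AE_space
  proof eventually_elim
    case (elim x)
    interpret Kx: prob_space "K x" using elim K_prob by (simp add: space_mu)
    \<comment> \<open>Nonnegativity of the conditional variance bounds the squared regression
      function by the conditional second moment.\<close>
    have "0 \<le> (\<integral>y. (y - fs x)\<^sup>2 \<partial>K x)" by simp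
    also have "\<dots> = (\<integral>y. y\<^sup>2 - 2 * fs x * y + (fs x)\<^sup>2 \<partial>K x)" by (simp add: power2_diff algebra_simps)
    also have "\<dots> = (\<integral>y. y\<^sup>2 \<partial>K x) - 2 * fs x * fs x + (fs x)\<^sup>2"
      using elim by (simp add: Kx.prob_space regfun_def)
    finally show ?case by (simp add: power2_eq_square)
  qed
qed

text \<open>Boundedness of the weight secures integrability of the product; disintegration then
  reduces the claim to the definition of the conditional mean.\<close>

lemma noise_mean_zero:
  assumes [measurable]: "\<psi> \<in> borel_measurable \<mu>" and bd: "\<And>x. x \<in> X \<Longrightarrow> \<bar>\<psi> x\<bar> \<le> b"
  shows "integrable \<rho> (\<lambda>z. (snd z - fs (fst z)) * \<psi> (fst z))"
    and "(\<integral>z. (snd z - fs (fst z)) * \<psi> (fst z) \<partial>\<rho>) = 0"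
proof -
  have fsi: "integrable \<mu> fs" using mu.square_integrable_imp_integrable[OF fs_meas] fs_sq_integrable by simp
  have i1: "integrable \<rho> (\<lambda>z. snd z - fs (fst z))"
    using y_integrable fsi by (simp add: integrable_marginal)
  show int: "integrable \<rho> (\<lambda>z. (snd z - fs (fst z)) * \<psi> (fst z))"
  proof (rule Bochner_Integration.integrable_bound)
    show "integrable \<rho> (\<lambda>z. (snd z - fs (fst z)) * b)" using i1 by simp
    show "AE z in \<rho>. norm ((snd z - fs (fst z)) * \<psi> (fst z)) \<le> norm ((snd z - fs (fst z)) * b)"
    proof (rule AE_I2)
      fix z assume "z \<in> space \<rho>"
      then have "\<bar>\<psi> (fst z)\<bar> \<le> \<bar>b\<bar>" using bd[of "fst z"] by (auto simp: space_rho)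
      then show "norm ((snd z - fs (fst z)) * \<psi> (fst z)) \<le> norm ((snd z - fs (fst z)) * b)"
        by (simp add: abs_mult mult_left_mono)
    qed
  qed simp
  have "(\<integral>z. (snd z - fs (fst z)) * \<psi> (fst z) \<partial>\<rho>) = (\<integral>x. (\<integral>y. (y - fs x) * \<psi> x \<partial>K x) \<partial>\<mu>)"
    using integral_disintegration(3)[OF int] by simp
  also have "\<dots> = (\<integral>x. 0 \<partial>\<mu>)"
  proof (rule integral_cong_AE)
    show "(\<lambda>x. \<integral>y. (y - fs x) * \<psi> x \<partial>K x) \<in> borel_measurable \<mu>"
      using borel_measurable_integrable[OF integral_disintegration(2)[OF int]] by simp
    show "AE x in \<mu>. (\<integral>y. (y - fs x) * \<psi> x \<partial>K x) = 0"
      using integral_disintegration(1)[OF y_integrable] AE_space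
    proof eventually_elim
      case (elim x)
      interpret Kx: prob_space "K x" using elim K_prob by (simp add: space_mu)
      show ?case using elim by (simp add: Kx.prob_space regfun_def)
    qed
  qed simp
  finally show "(\<integral>z. (snd z - fs (fst z)) * \<psi> (fst z) \<partial>\<rho>) = 0" by simp
qed

text \<open>The element representing \<open>sqrt (lam i)\<close> times \<open>e i\<close>. Since
  \<open>e i\<close> is determined only up to null sets, it is built as an integral against
  features.\<close>

definition hb :: "nat \<Rightarrow> 'h" where "hb i = (1 / sqrt (lam i)) *\<^sub>R g_H \<mu> \<Phi> (e i)"

text \<open>For f equal to \<open>e i\<close>, orthonormality makes the partial sums of the spectral
  series constant beyond index i. The sequence of squared errors, known to tend to 0, is thus
  eventually constant and its value is 0.\<close>

lemma T_L2_e: "AE x in \<mu>. T_L2 \<mu> k (e i) x = lam i * e i x"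
proof -
  let ?G = "g_H \<mu> \<Phi> (e i)"
  have T: "T_L2 \<mu> k (e i) x = ?G \<bullet> \<Phi> x" if "x \<in> X" for x
  proof -
    have "T_L2 \<mu> k (e i) x = (\<integral>y. e i y * (\<Phi> x \<bullet> \<Phi> y) \<partial>\<mu>)"
      unfolding T_L2_def using that
      by (intro Bochner_Integration.integral_cong refl) (auto simp: space_mu k_eq)
    then show ?thesis by (simp add: g_H_inner e_sq)
  qed
  have lim: "(\<lambda>m. \<integral>x. (T_L2 \<mu> k (e i) x - (\<Sum>j<m. lam j * (\<integral>y. e i y * e j y \<partial>\<mu>) * e j x))\<^sup>2 \<partial>\<mu>) \<longlonglongrightarrow> 0"
    using spec e_L2[of i] unfolding spectral_decomp_def by blast
  have sum: "(\<Sum>j<m. lam j * (\<integral>y. e i y * e j y \<partial>\<mu>) * e j x) = lam i * e i x" if "i < m" for m x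
  proof -
    have "(\<Sum>j<m. lam j * (\<integral>y. e i y * e j y \<partial>\<mu>) * e j x) = (\<Sum>j<m. if j = i then lam i * e i x else 0)"
      by (intro sum.cong refl) (auto simp: e_orth)
    then show ?thesis using that by simp
  qed
  have "\<forall>\<^sub>F m in sequentially. (\<integral>x. (T_L2 \<mu> k (e i) x - (\<Sum>j<m. lam j * (\<integral>y. e i y * e j y \<partial>\<mu>) * e j x))\<^sup>2 \<partial>\<mu>)
      = (\<integral>x. (?G \<bullet> \<Phi> x - lam i * e i x)\<^sup>2 \<partial>\<mu>)"
    using eventually_gt_at_top[of i]
  proof eventually_elim
    case (elim m)
    show ?case
      by (intro Bochner_Integration.integral_cong refl) (simp add: sum[OF elim] T space_mu)
  qed
  from Lim_transform_eventually[OF lim this]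
  have "(\<integral>x. (?G \<bullet> \<Phi> x - lam i * e i x)\<^sup>2 \<partial>\<mu>) = 0"
    using LIMSEQ_unique[OF tendsto_const] by blast
  moreover have "integrable \<mu> (\<lambda>x. (?G \<bullet> \<Phi> x + (- lam i * e i x))\<^sup>2)"
    by (rule L2_add_integrable) (auto simp: inner_Phi_sq_integrable e_sq power_mult_distrib)
  ultimately have "AE x in \<mu>. (?G \<bullet> \<Phi> x - lam i * e i x)\<^sup>2 = 0"
    by (subst (asm) integral_nonneg_eq_0_iff_AE) auto
  then show ?thesis using AE_space by eventually_elim (auto simp: T space_mu)
qed

lemma hb_Phi: "AE x in \<mu>. hb i \<bullet> \<Phi> x = sqrt (lam i) * e i x"
  using T_L2_e[of i] AE_space
proof eventually_elim
  case (elim x)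
  have "g_H \<mu> \<Phi> (e i) \<bullet> \<Phi> x = (\<integral>y. e i y * (\<Phi> x \<bullet> \<Phi> y) \<partial>\<mu>)" by (simp add: g_H_inner e_sq)
  also have "\<dots> = T_L2 \<mu> k (e i) x"
    unfolding T_L2_def using elim
    by (intro Bochner_Integration.integral_cong refl) (auto simp: space_mu k_eq)
  finally have "hb i \<bullet> \<Phi> x = lam i / sqrt (lam i) * e i x" using elim by (simp add: hb_def)
  then show ?case using lam_pos[of i] by (simp add: real_div_sqrt)
qed

lemma hb_Phi_all: "AE x in \<mu>. \<forall>i. hb i \<bullet> \<Phi> x = sqrt (lam i) * e i x"
  using hb_Phi by (simp add: AE_all_countable)

lemma T_H_hb: "T_H \<mu> \<Phi> (hb i) = lam i *\<^sub>R hb i"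
proof (rule inner_ext)
  fix u
  have "T_H \<mu> \<Phi> (hb i) \<bullet> u = (\<integral>x. sqrt (lam i) * (e i x * (u \<bullet> \<Phi> x)) \<partial>\<mu>)"
    unfolding T_H_inner
  proof (rule integral_cong_AE)
    show "AE x in \<mu>. hb i \<bullet> \<Phi> x * (u \<bullet> \<Phi> x) = sqrt (lam i) * (e i x * (u \<bullet> \<Phi> x))"
      using hb_Phi[of i] by eventually_elim simp
  qed auto
  also have "\<dots> = sqrt (lam i) * (g_H \<mu> \<Phi> (e i) \<bullet> u)" by (simp add: g_H_inner e_sq)
  also have "\<dots> = (lam i *\<^sub>R hb i) \<bullet> u"
    using lam_pos[of i] real_sqrt_mult_self[of "lam i"] by (simp add: hb_def field_simps)
  finally show "T_H \<mu> \<Phi> (hb i) \<bullet> u = (lam i *\<^sub>R hb i) \<bullet> u" .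
qed

lemma hb_orthonormal: "hb i \<bullet> hb j = (if i = j then 1 else 0)"
proof -
  have "hb i \<bullet> hb j = (1 / sqrt (lam i)) * (\<integral>x. e i x * (hb j \<bullet> \<Phi> x) \<partial>\<mu>)"
    unfolding hb_def[of i] by (simp add: g_H_inner e_sq)
  also have "(\<integral>x. e i x * (hb j \<bullet> \<Phi> x) \<partial>\<mu>) = (\<integral>x. sqrt (lam j) * (e i x * e j x) \<partial>\<mu>)"
  proof (rule integral_cong_AE)
    show "AE x in \<mu>. e i x * (hb j \<bullet> \<Phi> x) = sqrt (lam j) * (e i x * e j x)"
      using hb_Phi[of j] by eventually_elim simp
  qed auto
  also have "\<dots> = sqrt (lam j) * (if i = j then 1 else 0)" by (simp add: e_orth)
  finally show ?thesis using lam_pos[of i] by auto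
qed

section \<open>Projection onto the closed span of the eigenvectors\<close>

sublocale hb: orthonormal_seq hb
  by unfold_locales (rule hb_orthonormal)

text \<open>The \<open>hb i\<close> need not span: an element vanishing almost everywhere as a
  function is orthogonal to all of them without having to be 0.\<close>

definition proj :: "'h \<Rightarrow> 'h" where "proj x = lim (\<lambda>n. \<Sum>i<n. (x \<bullet> hb i) *\<^sub>R hb i)"

lemma proj_lim: "(\<lambda>n. \<Sum>i<n. (x \<bullet> hb i) *\<^sub>R hb i) \<longlonglongrightarrow> proj x"
  unfolding proj_def using convergent_fourier[OF hb.orthonormal_seq_axioms] by (simp add: convergent_LIMSEQ_iff)

lemma proj_inner_sums: "(\<lambda>i. (x \<bullet> hb i) * (u \<bullet> hb i)) sums (proj x \<bullet> u)"
proof -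
  have "(\<lambda>n. (\<Sum>i<n. (x \<bullet> hb i) *\<^sub>R hb i) \<bullet> u) \<longlonglongrightarrow> proj x \<bullet> u"
    by (intro tendsto_inner proj_lim tendsto_const)
  then show ?thesis by (simp add: sums_def inner_sum_left inner_commute[of u])
qed

lemma proj_inner_hb: "proj x \<bullet> hb j = x \<bullet> hb j"
proof -
  have "(\<lambda>i. (x \<bullet> hb i) * (hb j \<bullet> hb i)) = (\<lambda>i. if i = j then x \<bullet> hb j else 0)"
    by (auto simp: hb_orthonormal)
  then have "(\<lambda>i. (x \<bullet> hb i) * (hb j \<bullet> hb i)) sums (x \<bullet> hb j)" using sums_single[of j "\<lambda>_. x \<bullet> hb j"] by simp
  then show ?thesis using proj_inner_sums sums_unique2 by blast
qed

lemma proj_inner_orthogonal: "(\<And>i. v \<bullet> hb i = 0) \<Longrightarrow> proj x \<bullet> v = 0"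
  using proj_inner_sums[of x v] sums_unique2[OF _ sums_zero] by simp

lemma proj_Phi_measurable: "(\<lambda>x. proj (\<Phi> x)) \<in> borel_measurable \<mu>"
  by (rule borel_measurable_LIMSEQ_metric[where f="\<lambda>n x. \<Sum>i<n. (\<Phi> x \<bullet> hb i) *\<^sub>R hb i"]) (auto intro: proj_lim)

text \<open>The kernel expansion is only known off a null set of pairs, so its diagonal cannot be evaluated directly.\<close>
lemma AE_proj_Phi: "AE x in \<mu>. proj (\<Phi> x) = \<Phi> x"
proof -
  define z where "z x = \<Phi> x - proj (\<Phi> x)" for x
  have z_hb: "z x \<bullet> hb i = 0" for x i by (simp add: z_def inner_diff_left proj_inner_hb)
  \<comment> \<open>As \<open>z x\<close> is orthogonal to every \<open>hb i\<close>, only the full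
    feature at y remains. The result is the kernel minus its eigenexpansion, which vanishes for
    almost every pair.\<close>
  have zz: "z x \<bullet> z y = z x \<bullet> \<Phi> y" for x y
    using proj_inner_orthogonal[of "z x" "\<Phi> y"] z_hb by (simp add: z_def[of y] inner_diff_right inner_commute)
  have "AE x in \<mu>. AE y in \<mu>. (\<lambda>i. lam i * e i x * e i y) sums k x y"
    using spec by (simp add: spectral_decomp_def)
  then have "AE x in \<mu>. AE y in \<mu>. z x \<bullet> z y = 0"
    using hb_Phi_all AE_space
  proof eventually_elim
    case (elim x)
    show ?case
      using elim(1) hb_Phi_all AE_space
    proof eventually_elim
      fix y assume y: "(\<lambda>i. lam i * e i x * e i y) sums k x y" "\<forall>i. hb i \<bullet> \<Phi> y = sqrt (lam i) * e i y" "y \<in> space \<mu>"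
      have "(\<Phi> x \<bullet> hb i) * (\<Phi> y \<bullet> hb i) = lam i * e i x * e i y" for i
        using elim(2) y(2) lam_pos[of i] real_sqrt_mult_self[of "lam i"] by (simp add: inner_commute algebra_simps)
      then have "(\<lambda>i. (\<Phi> x \<bullet> hb i) * (\<Phi> y \<bullet> hb i)) sums k x y" using y(1) by simp
      then have "k x y = proj (\<Phi> x) \<bullet> \<Phi> y" using proj_inner_sums sums_unique2 by blast
      then show "z x \<bullet> z y = 0" unfolding zz using elim(3) y(3) by (simp add: z_def inner_diff_left k_eq space_mu)
    qed
  qed
  moreover have "z \<in> borel_measurable \<mu>" unfolding z_def using proj_Phi_measurable by measurable
  ultimately have "AE x in \<mu>. z x = 0" by (intro mu.AE_inner_zero_imp)
  then show ?thesis by eventually_elim (simp add: z_def)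
qed

text \<open>Bessel's inequality for the form of T: the truncation p of u satisfies
  \<open>\<langle>T p, u\<rangle> = \<langle>T p, p\<rangle>\<close>, and the form is nonnegative at
  \<open>u - p\<close>.\<close>

lemma Q_lower: "(\<Sum>j<n. lam j * (u \<bullet> hb j)\<^sup>2) \<le> (\<integral>x. (u \<bullet> \<Phi> x)\<^sup>2 \<partial>\<mu>)"
proof -
  define p where "p = (\<Sum>j<n. (u \<bullet> hb j) *\<^sub>R hb j)"
  have Tp: "T_H \<mu> \<Phi> p = (\<Sum>j<n. (lam j * (u \<bullet> hb j)) *\<^sub>R hb j)"
    unfolding p_def by (simp add: linear_sum[OF T_H_linear] linear_cmul[OF T_H_linear] T_H_hb mult.commute)
  have up: "T_H \<mu> \<Phi> p \<bullet> u = (\<Sum>j<n. lam j * (u \<bullet> hb j)\<^sup>2)"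
    unfolding Tp by (simp add: inner_sum_left power2_eq_square inner_commute[of u] mult.assoc)
  have pp: "T_H \<mu> \<Phi> p \<bullet> p = (\<Sum>j<n. lam j * (u \<bullet> hb j)\<^sup>2)"
    unfolding Tp inner_commute[of _ p] unfolding p_def
    by (simp add: inner_sum_right hb.inner_partial_sum power2_eq_square mult.assoc)
  have "0 \<le> (\<integral>x. ((u - p) \<bullet> \<Phi> x)\<^sup>2 \<partial>\<mu>)" by simp
  also have "\<dots> = (\<integral>x. (u \<bullet> \<Phi> x)\<^sup>2 - 2 * ((p \<bullet> \<Phi> x) * (u \<bullet> \<Phi> x)) + (p \<bullet> \<Phi> x) * (p \<bullet> \<Phi> x) \<partial>\<mu>)"
    by (simp add: inner_diff_left power2_diff power2_eq_square algebra_simps)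
  also have "\<dots> = (\<integral>x. (u \<bullet> \<Phi> x)\<^sup>2 \<partial>\<mu>) - 2 * (T_H \<mu> \<Phi> p \<bullet> u) + T_H \<mu> \<Phi> p \<bullet> p"
    by (simp add: inner_Phi_mult_integrable inner_Phi_sq_integrable T_H_inner)
  finally show ?thesis unfolding up pp by simp
qed

text \<open>The operator \<open>T + l\<close> is coercive with constant l, so the definite
  description in \<open>f_lambda\<close> denotes.\<close>

lemma f_lambda_eq:
  assumes "0 < l"
  shows "T_H \<mu> \<Phi> (f_lambda \<mu> \<Phi> fs l) + l *\<^sub>R f_lambda \<mu> \<Phi> fs l = g_H \<mu> \<Phi> fs"
proof -
  have "\<exists>!h. T_H \<mu> \<Phi> h + l *\<^sub>R h = g_H \<mu> \<Phi> fs"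
  proof (rule lax_milgram[where l=l and L="\<kappa>\<^sup>2 + l"])
    show "linear (\<lambda>h. T_H \<mu> \<Phi> h + l *\<^sub>R h)"
      by (intro linear_compose_add T_H_linear linear_compose_scale_right linear_id[unfolded id_def])
    show "norm (T_H \<mu> \<Phi> x + l *\<^sub>R x) \<le> (\<kappa>\<^sup>2 + l) * norm x" for x
      using norm_triangle_ineq[of "T_H \<mu> \<Phi> x" "l *\<^sub>R x"] T_H_bound[of x] assms by (simp add: algebra_simps)
    show "l * (norm x)\<^sup>2 \<le> (T_H \<mu> \<Phi> x + l *\<^sub>R x) \<bullet> x" for x
      by (simp add: inner_add_left T_H_inner power2_norm_eq_inner)
  qed fact
  from theI'[OF this] show ?thesis by (simp add: f_lambda_def)
qed

text \<open>The part v orthogonal to all \<open>hb i\<close> vanishes almost everywhere as a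
  function, because almost every feature lies in their closed span. Hence \<open>g_H\<close> and T f
  are orthogonal to v, and by the equation so is l f.\<close>

lemma proj_f_lambda:
  assumes l: "0 < l" shows "proj (f_lambda \<mu> \<Phi> fs l) = f_lambda \<mu> \<Phi> fs l"
proof -
  define f where "f = f_lambda \<mu> \<Phi> fs l"
  define v where "v = f - proj f"
  have v_hb: "v \<bullet> hb i = 0" for i by (simp add: v_def inner_diff_left proj_inner_hb)
  have AEv: "AE x in \<mu>. v \<bullet> \<Phi> x = 0"
    using AE_proj_Phi by eventually_elim (metis proj_inner_orthogonal v_hb inner_commute)
  have z: "(\<integral>x. \<psi> x * (v \<bullet> \<Phi> x) \<partial>\<mu>) = 0" if "\<psi> \<in> borel_measurable \<mu>" for \<psi>
  proof -
    have "(\<integral>x. \<psi> x * (v \<bullet> \<Phi> x) \<partial>\<mu>) = (\<integral>x. 0 \<partial>\<mu>)"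
    proof (rule integral_cong_AE)
      show "AE x in \<mu>. \<psi> x * (v \<bullet> \<Phi> x) = 0" using AEv by eventually_elim simp
    qed (use that in auto)
    then show ?thesis by simp
  qed
  have "l * (f \<bullet> v) = g_H \<mu> \<Phi> fs \<bullet> v - T_H \<mu> \<Phi> f \<bullet> v"
    by (simp add: f_lambda_eq[OF l, symmetric] f_def inner_add_left)
  also have "\<dots> = 0" by (simp add: g_H_inner fs_sq_integrable T_H_inner z)
  finally have "f \<bullet> v = 0" using l by simp
  moreover have "proj f \<bullet> v = 0" using v_hb by (rule proj_inner_orthogonal)
  ultimately have "v \<bullet> v = 0" by (simp add: v_def inner_diff_left)
  then show ?thesis by (simp add: v_def f_def)
qed

text \<open>The qualification of ridge regularisation: the gain in l stops at exponent 1. It is used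
  with \<open>t = s / 2\<close>, whence \<open>s \<le> 2\<close>.\<close>

lemma lam_powr_ratio:
  assumes "0 < l" "0 \<le> t" "t \<le> 1"
  shows "lam j powr t * l / (lam j + l) \<le> l powr t"
proof -
  have "lam j powr t * l = l powr t * (lam j powr t * l powr (1 - t))"
    using assms by (simp add: powr_add[symmetric] mult.left_commute)
  also have "\<dots> \<le> l powr t * (lam j + l)"
    using weighted_geometric_le_sum[OF lam_pos assms] by (intro mult_left_mono) auto
  finally show ?thesis using assms lam_pos[of j] by (simp add: divide_le_eq add_pos_pos)
qed

section \<open>The approximation error of the population ridge function\<close>

lemma e_sum_sq_integrable: "integrable \<mu> (\<lambda>x. (\<Sum>i<m. c i * e i x)\<^sup>2)"
  by (intro L2_sum_integrable) (auto simp: e_sq power_mult_distrib)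

lemma e_sum_sq_integral: "(\<integral>x. (\<Sum>i<m. c i * e i x)\<^sup>2 \<partial>\<mu>) = (\<Sum>i<m. (c i)\<^sup>2)"
proof -
  have int: "integrable \<mu> (\<lambda>x. c i * c j * (e i x * e j x))" for i j
    using L2_mult_integrable[OF e_meas e_meas e_sq e_sq] by simp
  have ex: "(\<Sum>i<m. c i * e i x)\<^sup>2 = (\<Sum>i<m. \<Sum>j<m. c i * c j * (e i x * e j x))" for x
    by (simp add: power2_eq_square sum_product algebra_simps)
  have "(\<integral>x. (\<Sum>i<m. c i * e i x)\<^sup>2 \<partial>\<mu>) = (\<Sum>i<m. \<Sum>j<m. (\<integral>x. c i * c j * (e i x * e j x) \<partial>\<mu>))"
    unfolding ex using int
    by (subst Bochner_Integration.integral_sum) (auto intro!: sum.cong Bochner_Integration.integral_sum)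
  also have "\<dots> = (\<Sum>i<m. \<Sum>j<m. if j = i then c i * c i else 0)"
    by (intro sum.cong refl) (auto simp: e_orth)
  finally show ?thesis by (simp add: power2_eq_square)
qed

text \<open>For \<open>1 < s \<le> 2\<close> the variational characterisation of \<open>f_lambda\<close> saturates, so the coefficients of
  \<open>f_lambda\<close> in the eigenbasis are compared with those of the regression function directly.\<close>
lemma approximation_error:
  assumes l: "0 < l" and s: "0 < s" "s \<le> 2" and A3: "interp_norm_le \<mu> lam e s R fs"
  shows "(\<integral>x. (fs x - f_lambda \<mu> \<Phi> fs l \<bullet> \<Phi> x)\<^sup>2 \<partial>\<mu>) \<le> 3 * R\<^sup>2 * l powr s"
proof -
  obtain a where a: "summable (\<lambda>i. (a i)\<^sup>2)" "(\<Sum>i. (a i)\<^sup>2) \<le> R\<^sup>2"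
    and lim: "(\<lambda>m. \<integral>x. (fs x - (\<Sum>i<m. lam i powr (s / 2) * a i * e i x))\<^sup>2 \<partial>\<mu>) \<longlonglongrightarrow> 0"
    using A3 by (auto simp: interp_norm_le_def)
  define f where "f = f_lambda \<mu> \<Phi> fs l"
  define b where "b i = lam i powr (s / 2) * a i" for i
  define S where "S m x = (\<Sum>i<m. b i * e i x)" for m x
  have [measurable]: "S m \<in> borel_measurable \<mu>" for m unfolding S_def by measurable
  have S_sq: "integrable \<mu> (\<lambda>x. (S m x)\<^sup>2)" for m unfolding S_def by (rule e_sum_sq_integrable)
  have fS: "integrable \<mu> (\<lambda>x. (fs x - S m x)\<^sup>2)" for m
    using L2_add_integrable[of fs \<mu> "\<lambda>x. - S m x"] fs_sq_integrable S_sq by simp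
  have lim: "(\<lambda>m. \<integral>x. (fs x - S m x)\<^sup>2 \<partial>\<mu>) \<longlonglongrightarrow> 0" using lim by (simp add: S_def b_def)
  \<comment> \<open>The L2 distance to a partial sum controls each coefficient error by the
    one-dimensional Bessel inequality, and it tends to 0.\<close>
  have coef: "(\<integral>x. fs x * e j x \<partial>\<mu>) = b j" for j
  proof -
    have Se: "(\<integral>x. S m x * e j x \<partial>\<mu>) = b j" if "j < m" for m
    proof -
      have "(\<integral>x. S m x * e j x \<partial>\<mu>) = (\<integral>x. (\<Sum>i<m. b i * (e i x * e j x)) \<partial>\<mu>)"
        by (simp add: S_def sum_distrib_right mult.assoc)
      also have "\<dots> = (\<Sum>i<m. b i * (\<integral>x. e i x * e j x \<partial>\<mu>))"
        using L2_mult_integrable[OF e_meas e_meas e_sq e_sq]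
        by (subst Bochner_Integration.integral_sum) auto
      also have "\<dots> = (\<Sum>i<m. if i = j then b j else 0)" by (intro sum.cong) (auto simp: e_orth)
      finally show ?thesis using that by simp
    qed
    have "((\<integral>x. fs x * e j x \<partial>\<mu>) - b j)\<^sup>2 \<le> (\<integral>x. (fs x - S m x)\<^sup>2 \<partial>\<mu>)" if "j < m" for m
    proof -
      let ?d = "\<lambda>x. fs x - S m x"
      let ?t = "\<integral>x. ?d x * e j x \<partial>\<mu>"
      have de: "integrable \<mu> (\<lambda>x. ?d x * e j x)" by (intro L2_mult_integrable fS e_sq) auto
      have "?t = (\<integral>x. fs x * e j x - S m x * e j x \<partial>\<mu>)" by (simp add: left_diff_distrib)
      also have "\<dots> = (\<integral>x. fs x * e j x \<partial>\<mu>) - b j"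
        using L2_mult_integrable[OF fs_meas e_meas fs_sq_integrable e_sq]
          L2_mult_integrable[of "S m" \<mu> "e j"] S_sq e_sq
        by (simp add: Se[OF that])
      finally have t: "?t = (\<integral>x. fs x * e j x \<partial>\<mu>) - b j" .
      have "0 \<le> (\<integral>x. (?d x - ?t * e j x)\<^sup>2 \<partial>\<mu>)" by simp
      also have "\<dots> = (\<integral>x. (?d x)\<^sup>2 - 2 * ?t * (?d x * e j x) + ?t\<^sup>2 * (e j x)\<^sup>2 \<partial>\<mu>)"
        by (intro Bochner_Integration.integral_cong refl) (simp add: power2_eq_square algebra_simps)
      also have "\<dots> = (\<integral>x. (?d x)\<^sup>2 \<partial>\<mu>) - 2 * ?t * ?t + ?t\<^sup>2 * (\<integral>x. (e j x)\<^sup>2 \<partial>\<mu>)"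
        using fS de e_sq by simp
      also have "(\<integral>x. (e j x)\<^sup>2 \<partial>\<mu>) = 1" using e_orth[of j j] by (simp add: power2_eq_square)
      finally have "?t\<^sup>2 \<le> (\<integral>x. (?d x)\<^sup>2 \<partial>\<mu>)" by (simp add: power2_eq_square)
      then show ?thesis unfolding t .
    qed
    then have "\<forall>\<^sub>F m in sequentially. ((\<integral>x. fs x * e j x \<partial>\<mu>) - b j)\<^sup>2 \<le> (\<integral>x. (fs x - S m x)\<^sup>2 \<partial>\<mu>)"
      by (rule eventually_mono[OF eventually_gt_at_top[of j]])
    from tendsto_lowerbound[OF lim this] show ?thesis by simp
  qed
  have f_hb: "(lam j + l) * (f \<bullet> hb j) = sqrt (lam j) * b j" for j
  proof -
    have "T_H \<mu> \<Phi> f \<bullet> hb j = T_H \<mu> \<Phi> (hb j) \<bullet> f" by (simp add: T_H_inner mult.commute)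
    then have 1: "T_H \<mu> \<Phi> f \<bullet> hb j = lam j * (f \<bullet> hb j)" by (simp add: T_H_hb inner_commute)
    have "g_H \<mu> \<Phi> fs \<bullet> hb j = (\<integral>x. sqrt (lam j) * (fs x * e j x) \<partial>\<mu>)"
      unfolding g_H_inner[OF fs_meas fs_sq_integrable]
    proof (rule integral_cong_AE)
      show "AE x in \<mu>. fs x * (hb j \<bullet> \<Phi> x) = sqrt (lam j) * (fs x * e j x)"
        using hb_Phi[of j] by eventually_elim simp
    qed auto
    then have "g_H \<mu> \<Phi> fs \<bullet> hb j = sqrt (lam j) * b j" by (simp add: coef)
    then show ?thesis
      using arg_cong[OF f_lambda_eq[OF l], of "\<lambda>w. w \<bullet> hb j"] 1
      by (simp add: f_def inner_add_left algebra_simps)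
  qed
  define p where "p m = (\<Sum>j<m. (f \<bullet> hb j) *\<^sub>R hb j)" for m
  \<comment> \<open>In coordinates, ridge regularisation shrinks \<open>b j\<close> by the factor
    \<open>lam j / (lam j + l)\<close>; this is what is lost.\<close>
  define d where "d j = b j * l / (lam j + l)" for j
  have SF: "AE x in \<mu>. S m x - p m \<bullet> \<Phi> x = (\<Sum>j<m. d j * e j x)" for m
    using hb_Phi_all
  proof eventually_elim
    case (elim x)
    have "S m x - p m \<bullet> \<Phi> x = (\<Sum>j<m. (b j - (f \<bullet> hb j) * sqrt (lam j)) * e j x)"
      using elim by (simp add: S_def p_def inner_sum_left sum_subtractf left_diff_distrib mult.assoc)
    also have "\<dots> = (\<Sum>j<m. d j * e j x)"
    proof (intro sum.cong refl)
      fix j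
      have pos: "0 < lam j + l" using lam_pos[of j] l by simp
      have "f \<bullet> hb j = sqrt (lam j) * b j / (lam j + l)" using f_hb[of j] pos by (simp add: field_simps)
      then have "b j - (f \<bullet> hb j) * sqrt (lam j) = b j - (sqrt (lam j) * sqrt (lam j)) * b j / (lam j + l)"
        by simp
      also have "\<dots> = d j" using pos lam_pos[of j] by (simp add: d_def field_simps)
      finally show "(b j - (f \<bullet> hb j) * sqrt (lam j)) * e j x = d j * e j x" by simp
    qed
    finally show ?case .
  qed
  have d_le: "(\<Sum>j<m. (d j)\<^sup>2) \<le> R\<^sup>2 * l powr s" for m
  proof -
    have "(d j)\<^sup>2 \<le> (a j)\<^sup>2 * l powr s" for j
    proof -
      have "(d j)\<^sup>2 = (a j)\<^sup>2 * (lam j powr (s / 2) * l / (lam j + l))\<^sup>2"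
        by (simp add: d_def b_def power_mult_distrib power_divide algebra_simps)
      also have "\<dots> \<le> (a j)\<^sup>2 * (l powr (s / 2))\<^sup>2"
        using lam_powr_ratio[OF l, of "s / 2" j] s lam_pos[of j] l
        by (intro mult_left_mono power_mono) auto
      also have "(l powr (s / 2))\<^sup>2 = l powr s" by (simp add: power2_eq_square powr_add[symmetric])
      finally show ?thesis .
    qed
    then have "(\<Sum>j<m. (d j)\<^sup>2) \<le> (\<Sum>j<m. (a j)\<^sup>2) * l powr s"
      by (simp add: sum_distrib_right sum_mono)
    also have "\<dots> \<le> R\<^sup>2 * l powr s"
      using sum_le_suminf[OF a(1), of "{..<m}"] a(2) by (intro mult_right_mono) auto
    finally show ?thesis .
  qed
  have pf: "(\<lambda>m. (norm (f - p m))\<^sup>2) \<longlonglongrightarrow> 0"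
  proof -
    have "p \<longlonglongrightarrow> f" unfolding p_def using proj_lim[of f] proj_f_lambda[OF l] by (simp add: f_def)
    then have "(\<lambda>m. (norm (f - p m))\<^sup>2) \<longlonglongrightarrow> (norm (f - f))\<^sup>2" by (intro tendsto_intros)
    then show ?thesis by simp
  qed
  \<comment> \<open>Three pieces, hence the factor 3: the series remainder, the shrinkage of the
    first m coefficients, and the projection remainder of f. The outer two vanish as m
    grows.\<close>
  have bound: "(\<integral>x. (fs x - f \<bullet> \<Phi> x)\<^sup>2 \<partial>\<mu>)
      \<le> 3 * (\<integral>x. (fs x - S m x)\<^sup>2 \<partial>\<mu>) + 3 * (R\<^sup>2 * l powr s) + 3 * (\<kappa>\<^sup>2 * (norm (f - p m))\<^sup>2)" for m
  proof -
    let ?u = "\<lambda>x. (fs x - S m x)\<^sup>2" and ?v = "\<lambda>x. (\<Sum>j<m. d j * e j x)\<^sup>2" and ?w = "\<lambda>x. ((f - p m) \<bullet> \<Phi> x)\<^sup>2"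
    have "(\<integral>x. (fs x - f \<bullet> \<Phi> x)\<^sup>2 \<partial>\<mu>) \<le> (\<integral>x. 3 * ?u x + 3 * ?v x + 3 * ?w x \<partial>\<mu>)"
    proof (rule integral_mono_AE)
      show "integrable \<mu> (\<lambda>x. (fs x - f \<bullet> \<Phi> x)\<^sup>2)"
        using L2_add_integrable[of fs \<mu> "\<lambda>x. - (f \<bullet> \<Phi> x)"] fs_sq_integrable inner_Phi_sq_integrable by simp
      show "integrable \<mu> (\<lambda>x. 3 * ?u x + 3 * ?v x + 3 * ?w x)"
        using fS e_sum_sq_integrable inner_Phi_sq_integrable by simp
      show "AE x in \<mu>. (fs x - f \<bullet> \<Phi> x)\<^sup>2 \<le> 3 * ?u x + 3 * ?v x + 3 * ?w x"
        using SF[of m]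
      proof eventually_elim
        case (elim x)
        have three: "(A + B - C)\<^sup>2 \<le> 3 * A\<^sup>2 + 3 * B\<^sup>2 + 3 * C\<^sup>2" for A B C :: real
        proof -
          have "3 * A\<^sup>2 + 3 * B\<^sup>2 + 3 * C\<^sup>2 - (A + B - C)\<^sup>2 = (A - B)\<^sup>2 + (A + C)\<^sup>2 + (B + C)\<^sup>2"
            by (simp add: power2_eq_square algebra_simps)
          then show ?thesis using zero_le_power2[of "A - B"] zero_le_power2[of "A + C"] zero_le_power2[of "B + C"] by linarith
        qed
        have eq: "fs x - f \<bullet> \<Phi> x = (fs x - S m x) + (\<Sum>j<m. d j * e j x) - ((f - p m) \<bullet> \<Phi> x)"
          using elim by (simp add: inner_diff_left)
        show ?case unfolding eq by (rule three)
      qed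
    qed
    also have "\<dots> = 3 * (\<integral>x. ?u x \<partial>\<mu>) + 3 * (\<integral>x. ?v x \<partial>\<mu>) + 3 * (\<integral>x. ?w x \<partial>\<mu>)"
      using fS e_sum_sq_integrable inner_Phi_sq_integrable by simp
    also have "\<dots> \<le> 3 * (\<integral>x. ?u x \<partial>\<mu>) + 3 * (R\<^sup>2 * l powr s) + 3 * (\<kappa>\<^sup>2 * (norm (f - p m))\<^sup>2)"
    proof -
      have "(\<integral>x. ?w x \<partial>\<mu>) = T_H \<mu> \<Phi> (f - p m) \<bullet> (f - p m)" by (simp add: T_H_inner power2_eq_square)
      also have "\<dots> \<le> norm (T_H \<mu> \<Phi> (f - p m)) * norm (f - p m)" by (rule norm_cauchy_schwarz)
      also have "\<dots> \<le> \<kappa>\<^sup>2 * (norm (f - p m))\<^sup>2"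
        using mult_right_mono[OF T_H_bound, of "norm (f - p m)"] by (simp add: power2_eq_square mult.assoc)
      finally show ?thesis using d_le[of m] unfolding e_sum_sq_integral by (intro add_mono mult_left_mono) auto
    qed
    finally show ?thesis .
  qed
  have "(\<lambda>m. 3 * (\<integral>x. (fs x - S m x)\<^sup>2 \<partial>\<mu>) + 3 * (R\<^sup>2 * l powr s) + 3 * (\<kappa>\<^sup>2 * (norm (f - p m))\<^sup>2))
     \<longlonglongrightarrow> 3 * 0 + 3 * (R\<^sup>2 * l powr s) + 3 * (\<kappa>\<^sup>2 * 0)"
    by (intro tendsto_intros lim pf)
  then have "(\<integral>x. (fs x - f \<bullet> \<Phi> x)\<^sup>2 \<partial>\<mu>) \<le> 3 * 0 + 3 * (R\<^sup>2 * l powr s) + 3 * (\<kappa>\<^sup>2 * 0)"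
    using bound by (intro tendsto_lowerbound[where F=sequentially]) auto
  then show ?thesis by (simp add: f_def)
qed

end

section \<open>The ridge estimator on a good event\<close>

lemma sq_le_half: "(p::real)\<^sup>2 / 2 - r\<^sup>2 \<le> (p + r)\<^sup>2"
proof -
  have "(p + r)\<^sup>2 - p\<^sup>2 / 2 + r\<^sup>2 = (p + 2 * r)\<^sup>2 / 2" by (simp add: power2_eq_square field_simps)
  then show ?thesis using zero_le_power2[of "p + 2 * r"] by linarith
qed

text \<open>Around a solution of the normal equation the objective grows by the quadratic form of
  the coercive operator A, so this solution is the unique minimiser and the definite description
  denotes.\<close>

lemma krr_unique_minimiser:
  fixes \<Phi> :: "'a \<Rightarrow> 'h::{real_inner,complete_space}"
  assumes l: "0 < l"
  shows "(1 / real n) *\<^sub>R (\<Sum>i<n. (krr \<Phi> l n z \<bullet> \<Phi> (fst (z i))) *\<^sub>R \<Phi> (fst (z i))) + l *\<^sub>R krr \<Phi> l n z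
    = (1 / real n) *\<^sub>R (\<Sum>i<n. snd (z i) *\<^sub>R \<Phi> (fst (z i)))"
proof -
  let ?p = "\<lambda>i. \<Phi> (fst (z i))"
  define A where "A h = (1 / real n) *\<^sub>R (\<Sum>i<n. (h \<bullet> ?p i) *\<^sub>R ?p i) + l *\<^sub>R h" for h
  define g where "g = (1 / real n) *\<^sub>R (\<Sum>i<n. snd (z i) *\<^sub>R ?p i)"
  define S where "S = (\<Sum>i<n. (norm (?p i))\<^sup>2) / real n"
  have quad: "A v \<bullet> v = (\<Sum>i<n. (v \<bullet> ?p i)\<^sup>2) / real n + l * (norm v)\<^sup>2" for v
    unfolding power2_norm_eq_inner
    by (simp add: A_def inner_add_left inner_sum_left power2_eq_square inner_commute[of "\<Phi> x" v for x])
  have "\<exists>!h. A h = g"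
  proof (rule lax_milgram[where l=l and L="S + l"])
    show "linear A"
      by (rule linearI) (simp_all add: A_def inner_add_left scaleR_add_left scaleR_add_right sum.distrib scaleR_sum_right algebra_simps)
    show "norm (A h) \<le> (S + l) * norm h" for h
    proof -
      have "norm (\<Sum>i<n. (h \<bullet> ?p i) *\<^sub>R ?p i) \<le> (\<Sum>i<n. (norm (?p i))\<^sup>2 * norm h)"
      proof (rule sum_norm_le)
        fix i
        have "norm ((h \<bullet> ?p i) *\<^sub>R ?p i) \<le> (norm h * norm (?p i)) * norm (?p i)"
          using Cauchy_Schwarz_ineq2[of h "?p i"] by (simp add: mult_right_mono)
        then show "norm ((h \<bullet> ?p i) *\<^sub>R ?p i) \<le> (norm (?p i))\<^sup>2 * norm h" by (simp add: power2_eq_square algebra_simps)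
      qed
      then have "norm ((1 / real n) *\<^sub>R (\<Sum>i<n. (h \<bullet> ?p i) *\<^sub>R ?p i)) \<le> S * norm h"
        by (simp add: S_def sum_distrib_right[symmetric] divide_right_mono)
      then show ?thesis
        unfolding A_def using l norm_triangle_ineq[of "(1 / real n) *\<^sub>R (\<Sum>i<n. (h \<bullet> ?p i) *\<^sub>R ?p i)" "l *\<^sub>R h"]
        by (simp add: distrib_right)
    qed
    show "l * (norm h)\<^sup>2 \<le> A h \<bullet> h" for h unfolding quad by (simp add: sum_nonneg)
  qed (rule l)
  then obtain h0 where h0: "A h0 = g" by blast
  have obj: "emp_obj \<Phi> l n z (h0 + v) = emp_obj \<Phi> l n z h0 + A v \<bullet> v" for v
  proof -
    have each: "(snd (z i) - (h0 + v) \<bullet> ?p i)\<^sup>2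
        = (snd (z i) - h0 \<bullet> ?p i)\<^sup>2 - 2 * ((snd (z i) - h0 \<bullet> ?p i) * (v \<bullet> ?p i)) + (v \<bullet> ?p i)\<^sup>2" for i
      by (simp add: inner_add_left power2_eq_square algebra_simps)
    have sq: "(\<Sum>i<n. (snd (z i) - (h0 + v) \<bullet> ?p i)\<^sup>2) = (\<Sum>i<n. (snd (z i) - h0 \<bullet> ?p i)\<^sup>2)
        - 2 * (\<Sum>i<n. (snd (z i) - h0 \<bullet> ?p i) * (v \<bullet> ?p i)) + (\<Sum>i<n. (v \<bullet> ?p i)\<^sup>2)"
      unfolding each by (simp only: sum.distrib sum_subtractf sum_distrib_left[symmetric])
    have nm: "(norm (h0 + v))\<^sup>2 = (norm h0)\<^sup>2 + 2 * (h0 \<bullet> v) + (norm v)\<^sup>2"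
      unfolding power2_norm_eq_inner by (simp add: inner_add_left inner_add_right inner_commute[of v h0])
    have "emp_obj \<Phi> l n z (h0 + v) = emp_obj \<Phi> l n z h0
       - 2 * ((\<Sum>i<n. (snd (z i) - h0 \<bullet> ?p i) * (v \<bullet> ?p i)) / real n - l * (h0 \<bullet> v))
       + ((\<Sum>i<n. (v \<bullet> ?p i)\<^sup>2) / real n + l * (norm v)\<^sup>2)"
      unfolding emp_obj_def sq nm by (simp add: add_divide_distrib diff_divide_distrib distrib_left)
    also have "(\<Sum>i<n. (snd (z i) - h0 \<bullet> ?p i) * (v \<bullet> ?p i)) / real n - l * (h0 \<bullet> v) = (g - A h0) \<bullet> v"
      by (simp add: g_def A_def inner_diff_left inner_add_left inner_sum_left left_diff_distrib sum_subtractf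
          diff_divide_distrib inner_commute[of "\<Phi> x" v for x])
    finally show ?thesis by (simp add: h0 quad)
  qed
  have min: "emp_obj \<Phi> l n z h0 \<le> emp_obj \<Phi> l n z h'" for h'
    using obj[of "h' - h0"] quad[of "h' - h0"] l by (simp add: sum_nonneg)
  have "krr \<Phi> l n z = h0"
    unfolding krr_def
  proof (rule the_equality)
    show "\<forall>h'. emp_obj \<Phi> l n z h0 \<le> emp_obj \<Phi> l n z h'" using min by blast
    fix h assume "\<forall>h'. emp_obj \<Phi> l n z h \<le> emp_obj \<Phi> l n z h'"
    then have "emp_obj \<Phi> l n z h \<le> emp_obj \<Phi> l n z h0" by blast
    then have le0: "A (h - h0) \<bullet> (h - h0) \<le> 0" using obj[of "h - h0"] by simp
    have "0 \<le> (\<Sum>i<n. ((h - h0) \<bullet> ?p i)\<^sup>2) / real n" by (simp add: sum_nonneg)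
    then have "l * (norm (h - h0))\<^sup>2 \<le> 0" using le0 unfolding quad by linarith
    then show "h = h0" using l by (simp add: mult_le_0_iff)
  qed
  then show ?thesis using h0 by (simp add: A_def g_def)
qed

text \<open>G is a measurable set of full measure on which the almost-everywhere facts hold
  pointwise. The bound is stated with \<open>hb i\<close>, which has a value at every point; it
  corresponds to the weighted sum of squares defining \<open>M_\<alpha>\<close>.\<close>

locale krr_analysis = rkhs_setting \<rho> X K k \<kappa> \<Phi> lam e
  for \<rho> :: "('a::euclidean_space \<times> real) measure" and X K k \<kappa>
    and \<Phi> :: "'a \<Rightarrow> 'h::{real_inner,complete_space,second_countable_topology}" and lam e +
  fixes \<alpha> A :: real and G :: "'a set"
  assumes alpha: "0 < \<alpha>" "\<alpha> < 1"
    and G_sets: "G \<in> sets \<mu>" and AE_G: "AE x in \<mu>. x \<in> G"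
    and G_proj: "\<And>x. x \<in> G \<Longrightarrow> proj (\<Phi> x) = \<Phi> x"
    and G_bound: "\<And>x m. x \<in> G \<Longrightarrow> (\<Sum>i<m. lam i powr (\<alpha> - 1) * (hb i \<bullet> \<Phi> x)\<^sup>2) \<le> A\<^sup>2"
begin

text \<open>Setting the feature to 0 off G makes the bounds hold everywhere without changing
  integrals.\<close>

definition Phi_G :: "'a \<Rightarrow> 'h" where "Phi_G x = indicator G x *\<^sub>R \<Phi> x"

lemma Phi_G_meas[measurable]: "Phi_G \<in> borel_measurable \<mu>"
  unfolding Phi_G_def using G_sets by measurable

lemma Phi_G_eq: "x \<in> G \<Longrightarrow> Phi_G x = \<Phi> x" and Phi_G_0: "x \<notin> G \<Longrightarrow> Phi_G x = 0"
  by (auto simp: Phi_G_def)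

text \<open>The operator \<open>(T + l) powr (-1/2)\<close> restricted to the first M eigenvectors.
  All bounds are uniform in M, and no square root of an operator has to be constructed.\<close>

definition J :: "real \<Rightarrow> nat \<Rightarrow> 'h \<Rightarrow> 'h" where
  "J l M x = (\<Sum>j<M. ((x \<bullet> hb j) / sqrt (lam j + l)) *\<^sub>R hb j)"

lemma norm_J: assumes "0 < l" shows "(norm (J l M x))\<^sup>2 = (\<Sum>j<M. (x \<bullet> hb j)\<^sup>2 / (lam j + l))"
  using hb.norm_sum_square[of "\<lambda>j. (x \<bullet> hb j) / sqrt (lam j + l)" 0 M] lam_pos assms
  by (simp add: J_def lessThan_atLeast0 power_divide add_nonneg_nonneg less_imp_le)

lemma J_mono: assumes "0 < l" "M \<le> M'" shows "norm (J l M x) \<le> norm (J l M' x)"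
proof -
  have "(norm (J l M x))\<^sup>2 \<le> (norm (J l M' x))\<^sup>2"
    unfolding norm_J[OF assms(1)] using assms lam_pos
    by (intro sum_mono2) (auto intro!: divide_nonneg_nonneg add_nonneg_nonneg simp: less_imp_le)
  then show ?thesis by (simp add: power2_le_iff_abs_le)
qed

lemma J_add: "J l M (x + y) = J l M x + J l M y"
  by (simp add: J_def inner_add_left add_divide_distrib scaleR_add_left sum.distrib)

lemma J_scaleR: "J l M (r *\<^sub>R x) = r *\<^sub>R J l M x"
  by (simp add: J_def scaleR_sum_right)

lemma J_diff: "J l M (x - y) = J l M x - J l M y"
  by (simp add: J_def inner_diff_left diff_divide_distrib scaleR_diff_left sum_subtractf)

lemma J_sum: "J l M (\<Sum>i\<in>I. f i) = (\<Sum>i\<in>I. J l M (f i))"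
  by (induction I rule: infinite_finite_induct) (auto simp: J_add, auto simp: J_def)

lemma J_inner: "c \<bullet> J l M x = J l M c \<bullet> x"
  by (simp add: J_def inner_sum_left inner_sum_right inner_commute mult.commute)

lemma J_meas[measurable]: "J l M \<in> borel_measurable borel"
  unfolding J_def by measurable

text \<open>Interpolation gives \<open>1 / (lam j + l) \<le> lam j powr (\<alpha> - 1) * l powr (-
  \<alpha>)\<close>, which matches the weights bounded on G.\<close>

lemma J_Phi_G_bound:
  assumes "0 < l" shows "(norm (J l M (Phi_G x)))\<^sup>2 \<le> A\<^sup>2 * l powr (- \<alpha>)"
proof (cases "x \<in> G")
  case True
  have "(norm (J l M (Phi_G x)))\<^sup>2 = (\<Sum>j<M. (hb j \<bullet> \<Phi> x)\<^sup>2 / (lam j + l))"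
    by (simp add: norm_J assms Phi_G_eq True inner_commute)
  also have "\<dots> \<le> (\<Sum>j<M. lam j powr (\<alpha> - 1) * (hb j \<bullet> \<Phi> x)\<^sup>2 * l powr (- \<alpha>))"
  proof (intro sum_mono)
    fix j
    have p: "0 < lam j" "0 < lam j + l" using lam_pos[of j] assms by auto
    have "lam j powr (1 - \<alpha>) * l powr \<alpha> \<le> lam j + l"
      using weighted_geometric_le_sum[OF lam_pos assms, of "1 - \<alpha>" j] alpha by simp
    then have "lam j powr (\<alpha> - 1) * l powr (- \<alpha>) * (lam j powr (1 - \<alpha>) * l powr \<alpha>)
        \<le> lam j powr (\<alpha> - 1) * l powr (- \<alpha>) * (lam j + l)"
      by (intro mult_left_mono) auto
    moreover have "lam j powr (\<alpha> - 1) * l powr (- \<alpha>) * (lam j powr (1 - \<alpha>) * l powr \<alpha>)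
      = (lam j powr (\<alpha> - 1) * lam j powr (1 - \<alpha>)) * (l powr (- \<alpha>) * l powr \<alpha>)" by (simp only: ac_simps)
    moreover have "\<dots> = 1" using p assms by (simp add: powr_add[symmetric])
    ultimately have "1 / (lam j + l) \<le> lam j powr (\<alpha> - 1) * l powr (- \<alpha>)"
      using p by (simp add: divide_le_eq)
    then have "(hb j \<bullet> \<Phi> x)\<^sup>2 * (1 / (lam j + l)) \<le> (hb j \<bullet> \<Phi> x)\<^sup>2 * (lam j powr (\<alpha> - 1) * l powr (- \<alpha>))"
      by (rule mult_left_mono) simp
    then show "(hb j \<bullet> \<Phi> x)\<^sup>2 / (lam j + l) \<le> lam j powr (\<alpha> - 1) * (hb j \<bullet> \<Phi> x)\<^sup>2 * l powr (- \<alpha>)"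
      by (simp add: ac_simps)
  qed
  also have "\<dots> = (\<Sum>j<M. lam j powr (\<alpha> - 1) * (hb j \<bullet> \<Phi> x)\<^sup>2) * l powr (- \<alpha>)"
    by (simp add: sum_distrib_right)
  also have "\<dots> \<le> A\<^sup>2 * l powr (- \<alpha>)" using G_bound[OF True] by (intro mult_right_mono) auto
  finally show ?thesis .
qed (simp add: Phi_G_0 J_def)

text \<open>The second moment of the whitened feature is the truncated effective dimension.\<close>

lemma integral_J_Phi_G:
  assumes "0 < l"
  shows "integrable \<mu> (\<lambda>x. (norm (J l M (Phi_G x)))\<^sup>2)"
    and "(\<integral>x. (norm (J l M (Phi_G x)))\<^sup>2 \<partial>\<mu>) = (\<Sum>j<M. lam j / (lam j + l))"
proof -
  show "integrable \<mu> (\<lambda>x. (norm (J l M (Phi_G x)))\<^sup>2)"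
    using J_Phi_G_bound[OF assms] by (intro mu.integrable_const_bound[where B="A\<^sup>2 * l powr (- \<alpha>)"]) auto
  have sq: "(\<integral>x. (hb j \<bullet> \<Phi> x)\<^sup>2 \<partial>\<mu>) = lam j" for j
    using T_H_inner[of "hb j" "hb j"] by (simp add: T_H_hb hb_orthonormal power2_eq_square)
  have "(\<integral>x. (norm (J l M (Phi_G x)))\<^sup>2 \<partial>\<mu>) = (\<integral>x. (\<Sum>j<M. (hb j \<bullet> \<Phi> x)\<^sup>2 / (lam j + l)) \<partial>\<mu>)"
  proof (rule integral_cong_AE)
    show "AE x in \<mu>. (norm (J l M (Phi_G x)))\<^sup>2 = (\<Sum>j<M. (hb j \<bullet> \<Phi> x)\<^sup>2 / (lam j + l))"
      using AE_G by eventually_elim (simp add: norm_J assms Phi_G_eq inner_commute)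
  qed auto
  also have "\<dots> = (\<Sum>j<M. lam j / (lam j + l))"
    by (simp add: inner_Phi_sq_integrable sq)
  finally show "(\<integral>x. (norm (J l M (Phi_G x)))\<^sup>2 \<partial>\<mu>) = (\<Sum>j<M. lam j / (lam j + l))" .
qed

definition Q :: "real \<Rightarrow> 'h \<Rightarrow> real" where
  "Q l u = (\<integral>x. (u \<bullet> \<Phi> x)\<^sup>2 \<partial>\<mu>) + l * (norm u)\<^sup>2"

lemma Q_coord: assumes "0 < l" shows "(\<Sum>j<M. (lam j + l) * (u \<bullet> hb j)\<^sup>2) \<le> Q l u"
proof -
  have "(\<Sum>j<M. (lam j + l) * (u \<bullet> hb j)\<^sup>2) = (\<Sum>j<M. lam j * (u \<bullet> hb j)\<^sup>2) + l * (\<Sum>j<M. (u \<bullet> hb j)\<^sup>2)"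
    by (simp add: distrib_right sum.distrib sum_distrib_left)
  also have "\<dots> \<le> Q l u"
    unfolding Q_def using assms by (intro add_mono Q_lower mult_left_mono hb.bessel) auto
  finally show ?thesis .
qed

lemma Q_nonneg: "0 < l \<Longrightarrow> 0 \<le> Q l u"
  by (simp add: Q_def)

text \<open>Cauchy-Schwarz in the dual pair \<open>(T + l) powr (-1/2)\<close> and
  \<open>(T + l) powr (1/2)\<close>, for each truncation and then in the limit. The
  \<open>sums\<close> assumption is essential because the eigenvectors need not span.\<close>

lemma dual_bound:
  assumes l: "0 < l" and sums: "(\<lambda>j. (x \<bullet> hb j) * (u \<bullet> hb j)) sums (x \<bullet> u)"
    and r: "\<And>M. norm (J l M x) \<le> r"
  shows "x \<bullet> u \<le> r * sqrt (Q l u)"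
proof -
  have r0: "0 \<le> r" using r[of 0] norm_ge_zero order_trans by blast
  have "(\<Sum>j<M. (x \<bullet> hb j) * (u \<bullet> hb j)) \<le> r * sqrt (Q l u)" for M
  proof -
    let ?a = "\<lambda>j. (x \<bullet> hb j) / sqrt (lam j + l)" and ?b = "\<lambda>j. sqrt (lam j + l) * (u \<bullet> hb j)"
    have p: "0 < lam j + l" for j using lam_pos[of j] l by simp
    have "(\<Sum>j<M. (x \<bullet> hb j) * (u \<bullet> hb j)) = (\<Sum>j<M. ?a j * ?b j)"
      using p by (intro sum.cong refl) (simp add: less_imp_neq[symmetric])
    also have "\<dots> \<le> sqrt ((\<Sum>j<M. ?a j * ?b j)\<^sup>2)" by simp
    also have "\<dots> \<le> sqrt ((\<Sum>j<M. (?a j)\<^sup>2) * (\<Sum>j<M. (?b j)\<^sup>2))"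
      by (intro real_sqrt_le_mono Cauchy_Schwarz_ineq_sum)
    also have "(\<Sum>j<M. (?a j)\<^sup>2) = (norm (J l M x))\<^sup>2"
      using p by (simp add: norm_J l power_divide less_imp_le)
    also have "(\<Sum>j<M. (?b j)\<^sup>2) = (\<Sum>j<M. (lam j + l) * (u \<bullet> hb j)\<^sup>2)"
      using p by (simp add: power_mult_distrib less_imp_le)
    also have "sqrt ((norm (J l M x))\<^sup>2 * (\<Sum>j<M. (lam j + l) * (u \<bullet> hb j)\<^sup>2)) \<le> sqrt (r\<^sup>2 * Q l u)"
      using r[of M] r0 Q_coord[OF l] p
      by (intro real_sqrt_le_mono mult_mono power_mono) (auto intro!: sum_nonneg mult_nonneg_nonneg simp: less_imp_le)
    also have "\<dots> = r * sqrt (Q l u)" using r0 by (simp add: real_sqrt_mult)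
    finally show ?thesis .
  qed
  then show ?thesis using sums by (intro LIMSEQ_le_const2[of "\<lambda>M. \<Sum>j<M. (x \<bullet> hb j) * (u \<bullet> hb j)"]) (auto simp: sums_def)
qed

text \<open>Beyond index m the factor \<open>lam j powr (1 - \<alpha>)\<close> is at most its value
  at m, so \<open>\<alpha> < 1\<close> makes the tail uniformly small over G.\<close>

lemma tail_bound:
  assumes x: "x \<in> G"
  shows "(u \<bullet> \<Phi> x - (\<Sum>j<m. (u \<bullet> hb j) * (hb j \<bullet> \<Phi> x)))\<^sup>2 \<le> (norm u)\<^sup>2 * (lam m powr (1 - \<alpha>) * A\<^sup>2)"
proof -
  let ?c = "\<lambda>j. (u \<bullet> hb j) * (hb j \<bullet> \<Phi> x)"
  have lim: "(\<lambda>M. ((\<Sum>j<M. ?c j) - (\<Sum>j<m. ?c j))\<^sup>2) \<longlonglongrightarrow> (u \<bullet> \<Phi> x - (\<Sum>j<m. ?c j))\<^sup>2"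
    using proj_inner_sums[of "\<Phi> x" u] G_proj[OF x]
    by (intro tendsto_intros) (simp add: sums_def inner_commute mult.commute)
  have "((\<Sum>j<M. ?c j) - (\<Sum>j<m. ?c j))\<^sup>2 \<le> (norm u)\<^sup>2 * (lam m powr (1 - \<alpha>) * A\<^sup>2)" if M: "m \<le> M" for M
  proof -
    have split: "sum f {..<M} = sum f {..<m} + sum f {m..<M}" for f :: "nat \<Rightarrow> real"
      using M sum.atLeastLessThan_concat[of 0 m M f] by (simp add: lessThan_atLeast0)
    have "((\<Sum>j<M. ?c j) - (\<Sum>j<m. ?c j))\<^sup>2 = (\<Sum>j\<in>{m..<M}. ?c j)\<^sup>2" by (simp add: split)
    also have "\<dots> \<le> (\<Sum>j\<in>{m..<M}. (u \<bullet> hb j)\<^sup>2) * (\<Sum>j\<in>{m..<M}. (hb j \<bullet> \<Phi> x)\<^sup>2)"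
      by (rule Cauchy_Schwarz_ineq_sum)
    also have "\<dots> \<le> (norm u)\<^sup>2 * (lam m powr (1 - \<alpha>) * A\<^sup>2)"
    proof (intro mult_mono)
      show "(\<Sum>j\<in>{m..<M}. (u \<bullet> hb j)\<^sup>2) \<le> (norm u)\<^sup>2"
        using hb.bessel[of u M] split[of "\<lambda>j. (u \<bullet> hb j)\<^sup>2"] by (smt (verit) sum_nonneg zero_le_power2)
      have "(\<Sum>j\<in>{m..<M}. (hb j \<bullet> \<Phi> x)\<^sup>2) \<le> (\<Sum>j\<in>{m..<M}. lam m powr (1 - \<alpha>) * (lam j powr (\<alpha> - 1) * (hb j \<bullet> \<Phi> x)\<^sup>2))"
      proof (intro sum_mono)
        fix j assume "j \<in> {m..<M}"
        then have "lam j powr (1 - \<alpha>) \<le> lam m powr (1 - \<alpha>)"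
          using alpha lam_antimono[of m j] lam_pos[of j] by (intro powr_mono2) auto
        then have "(lam j powr (1 - \<alpha>) * lam j powr (\<alpha> - 1)) * (hb j \<bullet> \<Phi> x)\<^sup>2
           \<le> (lam m powr (1 - \<alpha>) * lam j powr (\<alpha> - 1)) * (hb j \<bullet> \<Phi> x)\<^sup>2"
          by (intro mult_right_mono) auto
        moreover have "lam j powr (1 - \<alpha>) * lam j powr (\<alpha> - 1) = 1"
          using lam_pos[of j] by (simp add: powr_add[symmetric])
        ultimately show "(hb j \<bullet> \<Phi> x)\<^sup>2 \<le> lam m powr (1 - \<alpha>) * (lam j powr (\<alpha> - 1) * (hb j \<bullet> \<Phi> x)\<^sup>2)"
          by (simp add: mult.assoc)
      qed
      also have "\<dots> = lam m powr (1 - \<alpha>) * (\<Sum>j\<in>{m..<M}. lam j powr (\<alpha> - 1) * (hb j \<bullet> \<Phi> x)\<^sup>2)"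
        by (simp add: sum_distrib_left)
      also have "\<dots> \<le> lam m powr (1 - \<alpha>) * A\<^sup>2"
      proof (intro mult_left_mono)
        have "(\<Sum>j\<in>{m..<M}. lam j powr (\<alpha> - 1) * (hb j \<bullet> \<Phi> x)\<^sup>2) \<le> (\<Sum>j<M. lam j powr (\<alpha> - 1) * (hb j \<bullet> \<Phi> x)\<^sup>2)"
          by (intro sum_mono2) auto
        then show "(\<Sum>j\<in>{m..<M}. lam j powr (\<alpha> - 1) * (hb j \<bullet> \<Phi> x)\<^sup>2) \<le> A\<^sup>2" using G_bound[OF x, of M] by linarith
      qed simp
      finally show "(\<Sum>j\<in>{m..<M}. (hb j \<bullet> \<Phi> x)\<^sup>2) \<le> lam m powr (1 - \<alpha>) * A\<^sup>2" .
    qed (auto simp: sum_nonneg)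
    finally show ?thesis .
  qed
  then show ?thesis
    using LIMSEQ_le_const2[OF lim] by blast
qed

section \<open>Comparison of the empirical form with the population form\<close>

definition vcoord :: "real \<Rightarrow> 'a \<times> real \<Rightarrow> nat \<Rightarrow> real" where
  "vcoord l z j = (hb j \<bullet> Phi_G (fst z)) / sqrt (lam j + l)"

lemma rank_one_vcoord:
  assumes l: "0 < l" and B: "1 \<le> B" "A\<^sup>2 * l powr (- \<alpha>) \<le> B"
  shows "rank_one_sum \<rho> m (vcoord l) B (\<lambda>j. lam j / (lam j + l))"
proof
  have p: "0 < lam j + l" for j using lam_pos[of j] l by simp
  show "(\<lambda>x. vcoord l x j) \<in> borel_measurable \<rho>" for j unfolding vcoord_def by measurable
  show "(\<Sum>j<m. (vcoord l z j)\<^sup>2) \<le> B" for z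
  proof -
    have "(\<Sum>j<m. (vcoord l z j)\<^sup>2) = (norm (J l m (Phi_G (fst z))))\<^sup>2"
      using p by (simp add: norm_J l vcoord_def power_divide less_imp_le inner_commute)
    then show ?thesis using J_Phi_G_bound[OF l, of m "fst z"] B by simp
  qed
  show "(\<integral>z. vcoord l z i * vcoord l z j \<partial>\<rho>) = (if i = j then lam i / (lam i + l) else 0)" for i j
  proof -
    have "(\<integral>z. vcoord l z i * vcoord l z j \<partial>\<rho>)
        = (\<integral>z. (hb i \<bullet> Phi_G (fst z)) * (hb j \<bullet> Phi_G (fst z)) / (sqrt (lam i + l) * sqrt (lam j + l)) \<partial>\<rho>)"
      by (simp add: vcoord_def)
    also have "\<dots> = (\<integral>x. (hb i \<bullet> Phi_G x) * (hb j \<bullet> Phi_G x) \<partial>\<mu>) / (sqrt (lam i + l) * sqrt (lam j + l))"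
      by (subst integral_marginal) auto
    also have "(\<integral>x. (hb i \<bullet> Phi_G x) * (hb j \<bullet> Phi_G x) \<partial>\<mu>) = (\<integral>x. (hb i \<bullet> \<Phi> x) * (hb j \<bullet> \<Phi> x) \<partial>\<mu>)"
    proof (rule integral_cong_AE)
      show "AE x in \<mu>. (hb i \<bullet> Phi_G x) * (hb j \<bullet> Phi_G x) = (hb i \<bullet> \<Phi> x) * (hb j \<bullet> \<Phi> x)"
        using AE_G by eventually_elim (simp add: Phi_G_eq)
    qed auto
    also have "\<dots> = lam i * (if i = j then 1 else 0)"
      using T_H_inner[of "hb i" "hb j"] by (simp add: T_H_hb hb_orthonormal)
    finally show ?thesis using p[of i] p[of j] by auto
  qed
  show "0 \<le> lam j / (lam j + l)" "lam j / (lam j + l) \<le> 1" for j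
    using lam_pos[of j] l by (auto simp: divide_le_eq)
qed (use B in auto)

text \<open>Replacing u by its projection on the first m eigenvectors costs at most
  \<open>U / 24\<close> pointwise and a factor 2, both on the sample and in the population. Between
  these replacements the deviation bound compares the two forms of the projection.\<close>

lemma empirical_form_lower_bound:
  assumes l: "0 < l" and n: "0 < n" and B: "1 \<le> B" "A\<^sup>2 * l powr (- \<alpha>) \<le> B"
    and zG: "\<And>i. i < n \<Longrightarrow> fst (z i) \<in> G"
    and dev: "\<And>b. \<bar>\<Sum>i<m. \<Sum>j<m. b i * rank_one_sum.cmat_sum (vcoord l) (\<lambda>j. lam j / (lam j + l)) {..<n} z i j * b j\<bar>
       \<le> real n / 8 * (\<Sum>i<m. (b i)\<^sup>2)"
    and tail: "lam m powr (1 - \<alpha>) * A\<^sup>2 \<le> l / 24"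
  shows "Q l u / 8 \<le> (\<Sum>i<n. (u \<bullet> \<Phi> (fst (z i)))\<^sup>2) / real n + l * (norm u)\<^sup>2"
proof -
  interpret R: rank_one_sum \<rho> m "vcoord l" B "\<lambda>j. lam j / (lam j + l)"
    by (rule rank_one_vcoord[OF l B])
  have pos: "0 < lam j + l" for j using lam_pos[of j] l by simp
  define U where "U = l * (norm u)\<^sup>2"
  define p where "p x = (\<Sum>j<m. (u \<bullet> hb j) * (hb j \<bullet> \<Phi> x))" for x
  define b where "b j = sqrt (lam j + l) * (u \<bullet> hb j)" for j
  define P where "P = (\<Sum>j<m. lam j * (u \<bullet> hb j)\<^sup>2)"
  have U0: "0 \<le> U" using l by (simp add: U_def)
  have r: "(u \<bullet> \<Phi> x - p x)\<^sup>2 \<le> U / 24" if "x \<in> G" for x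
    using tail_bound[OF that, of u m] mult_left_mono[OF tail, of "(norm u)\<^sup>2"]
    by (simp add: p_def U_def algebra_simps)
  have sumb: "(\<Sum>j<m. (b j)\<^sup>2) \<le> Q l u"
    using Q_coord[OF l, where u=u and M=m] pos by (simp add: b_def power_mult_distrib less_imp_le)
  have pz: "p (fst (z i)) = (\<Sum>j<m. b j * vcoord l (z i) j)" if "i < n" for i
    unfolding p_def b_def vcoord_def using zG[OF that] pos by (intro sum.cong) (auto simp: Phi_G_eq less_imp_neq[symmetric])
  have "(\<Sum>i<m. \<Sum>j<m. b i * R.cmat_sum {..<n} z i j * b j) = (\<Sum>l<n. (p (fst (z l)))\<^sup>2) - real n * P"
  proof -
    have one: "(\<Sum>i<m. \<Sum>j<m. b i * R.cmat (z t) i j * b j) = (p (fst (z t)))\<^sup>2 - P" if t: "t < n" for t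
    proof -
      have "(\<Sum>i<m. \<Sum>j<m. b i * R.cmat (z t) i j * b j) = (\<Sum>i<m. b i * (\<Sum>j<m. R.cmat (z t) i j * b j))"
        by (simp add: sum_distrib_left mult.assoc)
      also have "\<dots> = (\<Sum>i<m. b i * (vcoord l (z t) i * (\<Sum>j<m. vcoord l (z t) j * b j) - lam i / (lam i + l) * b i))"
        by (intro sum.cong refl) (simp add: R.cmat_mult_vec)
      also have "\<dots> = (\<Sum>i<m. b i * vcoord l (z t) i) * (\<Sum>j<m. vcoord l (z t) j * b j) - (\<Sum>i<m. lam i / (lam i + l) * (b i)\<^sup>2)"
        by (simp add: right_diff_distrib sum_subtractf sum_distrib_right power2_eq_square ac_simps)
      also have "(\<Sum>i<m. lam i / (lam i + l) * (b i)\<^sup>2) = P"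
        unfolding P_def
      proof (intro sum.cong refl)
        fix i show "lam i / (lam i + l) * (b i)\<^sup>2 = lam i * (u \<bullet> hb i)\<^sup>2"
          using pos[of i] by (simp add: b_def power_mult_distrib less_imp_le)
      qed
      finally show ?thesis by (simp add: pz[OF t] power2_eq_square mult.commute)
    qed
    have "(\<Sum>i<m. \<Sum>j<m. b i * R.cmat_sum {..<n} z i j * b j) = (\<Sum>i<m. \<Sum>j<m. \<Sum>t<n. b i * R.cmat (z t) i j * b j)"
      by (simp add: R.cmat_sum_def sum_distrib_left sum_distrib_right)
    also have "\<dots> = (\<Sum>i<m. \<Sum>t<n. \<Sum>j<m. b i * R.cmat (z t) i j * b j)" by (intro sum.cong refl sum.swap)
    also have "\<dots> = (\<Sum>t<n. \<Sum>i<m. \<Sum>j<m. b i * R.cmat (z t) i j * b j)" by (rule sum.swap)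
    also have "\<dots> = (\<Sum>t<n. (p (fst (z t)))\<^sup>2 - P)" by (intro sum.cong refl) (simp add: one)
    finally show ?thesis by (simp add: sum_subtractf)
  qed
  then have "real n * P - (\<Sum>i<n. (p (fst (z i)))\<^sup>2) \<le> real n / 8 * (\<Sum>j<m. (b j)\<^sup>2)"
    using dev[of b] by linarith
  also have "\<dots> \<le> real n / 8 * Q l u" using sumb by (intro mult_left_mono) auto
  finally have emp_p: "real n * (P - Q l u / 8) \<le> (\<Sum>i<n. (p (fst (z i)))\<^sup>2)" by (simp add: algebra_simps)
  have "(\<Sum>i<n. (p (fst (z i)))\<^sup>2 / 2 - U / 24) \<le> (\<Sum>i<n. (u \<bullet> \<Phi> (fst (z i)))\<^sup>2)"
  proof (intro sum_mono)
    fix i assume "i \<in> {..<n}"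
    then show "(p (fst (z i)))\<^sup>2 / 2 - U / 24 \<le> (u \<bullet> \<Phi> (fst (z i)))\<^sup>2"
      using r[OF zG, of i] sq_le_half[of "p (fst (z i))" "u \<bullet> \<Phi> (fst (z i)) - p (fst (z i))"] by simp
  qed
  then have "real n * ((P - Q l u / 8) / 2 - U / 24) \<le> (\<Sum>i<n. (u \<bullet> \<Phi> (fst (z i)))\<^sup>2)"
    using emp_p by (simp add: sum_subtractf sum_divide_distrib[symmetric] algebra_simps)
  then have emp: "(P - Q l u / 8) / 2 - U / 24 \<le> (\<Sum>i<n. (u \<bullet> \<Phi> (fst (z i)))\<^sup>2) / real n"
    using n by (simp add: le_divide_eq mult.commute)
  have popl: "(\<integral>x. (u \<bullet> \<Phi> x)\<^sup>2 \<partial>\<mu>) \<le> 2 * P + U / 12"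
  proof -
    define up where "up = (\<Sum>j<m. (u \<bullet> hb j) *\<^sub>R hb j)"
    have pup: "p x = up \<bullet> \<Phi> x" for x by (simp add: p_def up_def inner_sum_left)
    have "(\<integral>x. (up \<bullet> \<Phi> x)\<^sup>2 \<partial>\<mu>) = T_H \<mu> \<Phi> up \<bullet> up" by (simp add: T_H_inner power2_eq_square)
    also have "T_H \<mu> \<Phi> up = (\<Sum>j<m. (lam j * (u \<bullet> hb j)) *\<^sub>R hb j)"
      unfolding up_def by (simp add: linear_sum[OF T_H_linear] linear_cmul[OF T_H_linear] T_H_hb mult.commute)
    also have "\<dots> \<bullet> up = (\<Sum>j<m. (lam j * (u \<bullet> hb j)) * (up \<bullet> hb j))"
      by (simp add: inner_sum_left inner_commute[of up])
    also have "\<dots> = P"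
      unfolding P_def up_def by (simp add: hb.inner_partial_sum power2_eq_square mult.assoc)
    finally have Pint: "(\<integral>x. (up \<bullet> \<Phi> x)\<^sup>2 \<partial>\<mu>) = P" .
    have "(\<integral>x. (u \<bullet> \<Phi> x)\<^sup>2 \<partial>\<mu>) \<le> (\<integral>x. 2 * (up \<bullet> \<Phi> x)\<^sup>2 + U / 12 \<partial>\<mu>)"
    proof (rule integral_mono_AE)
      show "AE x in \<mu>. (u \<bullet> \<Phi> x)\<^sup>2 \<le> 2 * (up \<bullet> \<Phi> x)\<^sup>2 + U / 12"
        using AE_G
      proof eventually_elim
        case (elim x)
        have "(u \<bullet> \<Phi> x)\<^sup>2 / 2 - (up \<bullet> \<Phi> x - u \<bullet> \<Phi> x)\<^sup>2 \<le> (up \<bullet> \<Phi> x)\<^sup>2"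
          using sq_le_half[of "u \<bullet> \<Phi> x" "up \<bullet> \<Phi> x - u \<bullet> \<Phi> x"] by simp
        then show ?case using r[OF elim] by (simp add: pup power2_commute)
      qed
    qed (auto simp: inner_Phi_sq_integrable)
    also have "\<dots> = 2 * P + U / 12" by (simp add: inner_Phi_sq_integrable Pint mu.prob_space)
    finally show ?thesis .
  qed
  have Qd: "Q l u = (\<integral>x. (u \<bullet> \<Phi> x)\<^sup>2 \<partial>\<mu>) + U" by (simp add: Q_def U_def)
  have i0: "0 \<le> (\<integral>x. (u \<bullet> \<Phi> x)\<^sup>2 \<partial>\<mu>)" by simp
  \<comment> \<open>The three estimates even give \<open>3 / 16\<close> of q, using that U is
    nonnegative.\<close>
  have arith: "q / 8 \<le> w + U" if "(P - q / 8) / 2 - U / 24 \<le> w" "i \<le> 2 * P + U / 12" "q = i + U" "0 \<le> i"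
    for q w i :: real
    using that U0 by argo
  show ?thesis unfolding U_def[symmetric] by (rule arith[OF emp popl Qd i0])
qed

text \<open>Subtracting from the normal equation leaves the sums \<open>S1\<close> and
  \<open>S2\<close> on the right. Pairing them with u costs \<open>sqrt (Q l u)\<close>, while the
  form bound supplies \<open>Q l u / 8\<close>; one square root cancels.\<close>

lemma krr_error_bound:
  fixes r1 r2 :: real
  assumes l: "0 < l" and n: "0 < n" and B: "1 \<le> B" "A\<^sup>2 * l powr (- \<alpha>) \<le> B"
    and zG: "\<And>i. i < n \<Longrightarrow> fst (z i) \<in> G"
    and dev: "\<And>b. \<bar>\<Sum>i<m. \<Sum>j<m. b i * rank_one_sum.cmat_sum (vcoord l) (\<lambda>j. lam j / (lam j + l)) {..<n} z i j * b j\<bar>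
       \<le> real n / 8 * (\<Sum>i<m. (b i)\<^sup>2)"
    and tail: "lam m powr (1 - \<alpha>) * A\<^sup>2 \<le> l / 24"
    and noise: "\<And>M. norm (\<Sum>i<n. (snd (z i) - fs (fst (z i))) *\<^sub>R J l M (Phi_G (fst (z i)))) \<le> real n * r1"
    and bias: "\<And>M. norm (\<Sum>i<n. (fs (fst (z i)) - f_lambda \<mu> \<Phi> fs l \<bullet> \<Phi> (fst (z i))) *\<^sub>R J l M (Phi_G (fst (z i)))
       - J l M (l *\<^sub>R f_lambda \<mu> \<Phi> fs l)) \<le> real n * r2"
  shows "L2norm \<mu> (\<lambda>x. krr \<Phi> l n z \<bullet> \<Phi> x - f_lambda \<mu> \<Phi> fs l \<bullet> \<Phi> x) \<le> 8 * (r1 + r2)"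
proof -
  define f where "f = f_lambda \<mu> \<Phi> fs l"
  define u where "u = krr \<Phi> l n z - f"
  let ?p = "\<lambda>i. \<Phi> (fst (z i))"
  define S1 where "S1 = (\<Sum>i<n. (snd (z i) - fs (fst (z i))) *\<^sub>R ?p i)"
  define S2 where "S2 = (\<Sum>i<n. (fs (fst (z i)) - f \<bullet> ?p i) *\<^sub>R ?p i) - real n *\<^sub>R (l *\<^sub>R f)"
  \<comment> \<open>The property required by \<open>dual_bound\<close>. It is linear in x and holds
    for features at points of G and for the population solution, but perhaps not for u.\<close>
  define FS where "FS x \<longleftrightarrow> (\<lambda>j. (x \<bullet> hb j) * (u \<bullet> hb j)) sums (x \<bullet> u)" for x
  have FS_add: "FS (x + y)" if "FS x" "FS y" for x y
    using sums_add[OF that[unfolded FS_def]] unfolding FS_def by (simp add: inner_add_left distrib_right)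
  have FS_scale: "FS (c *\<^sub>R x)" if "FS x" for c x
    using sums_mult[OF that[unfolded FS_def], of c] unfolding FS_def by (simp add: mult.assoc)
  have FS_0: "FS 0" by (simp add: FS_def)
  have FS_sum: "FS (\<Sum>i\<in>I. y i)" if "\<And>i. i \<in> I \<Longrightarrow> FS (y i)" for I :: "nat set" and y
    using that by (induction I rule: infinite_finite_induct) (auto intro: FS_add FS_0)
  have FS_proj: "FS x" if "proj x = x" for x
    using proj_inner_sums[of x u] that by (simp add: FS_def)
  have FSp: "FS (?p i)" if "i < n" for i using G_proj[OF zG[OF that]] by (rule FS_proj)
  have FSf: "FS f" unfolding f_def by (intro FS_proj proj_f_lambda l)
  have FS1: "FS S1" unfolding S1_def by (intro FS_sum FS_scale FSp) auto
  have FS2: "FS S2"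
  proof -
    have "FS ((\<Sum>i<n. (fs (fst (z i)) - f \<bullet> ?p i) *\<^sub>R ?p i) + (- (real n * l)) *\<^sub>R f)"
      by (intro FS_add FS_sum FS_scale FSp FSf) auto
    then show ?thesis by (simp add: S2_def)
  qed
  have J1: "norm (J l M S1) \<le> real n * r1" for M
    using noise[of M] zG by (simp add: S1_def J_sum J_scaleR Phi_G_eq cong: sum.cong_simp)
  have J2: "norm (J l M S2) \<le> real n * r2" for M
    using bias[of M] zG
    by (simp add: S2_def J_diff J_sum J_scaleR Phi_G_eq sum_subtractf f_def[symmetric] scaleR_scaleR
        sum_constant_scaleR cong: sum.cong_simp)
  have s1: "S1 \<bullet> u \<le> real n * r1 * sqrt (Q l u)" by (rule dual_bound[OF l FS1[unfolded FS_def] J1])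
  have s2: "S2 \<bullet> u \<le> real n * r2 * sqrt (Q l u)" by (rule dual_bound[OF l FS2[unfolded FS_def] J2])
  have eq: "(1 / real n) *\<^sub>R (\<Sum>i<n. (u \<bullet> ?p i) *\<^sub>R ?p i) + l *\<^sub>R u = (1 / real n) *\<^sub>R (S1 + S2)"
  proof -
    have "(1 / real n) *\<^sub>R (\<Sum>i<n. (u \<bullet> ?p i) *\<^sub>R ?p i) + l *\<^sub>R u
      = ((1 / real n) *\<^sub>R (\<Sum>i<n. (krr \<Phi> l n z \<bullet> ?p i) *\<^sub>R ?p i) + l *\<^sub>R krr \<Phi> l n z)
        - ((1 / real n) *\<^sub>R (\<Sum>i<n. (f \<bullet> ?p i) *\<^sub>R ?p i) + l *\<^sub>R f)"
      by (simp add: u_def inner_diff_left scaleR_diff_left scaleR_diff_right sum_subtractf)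
    also have "\<dots> = (1 / real n) *\<^sub>R (\<Sum>i<n. snd (z i) *\<^sub>R ?p i) - ((1 / real n) *\<^sub>R (\<Sum>i<n. (f \<bullet> ?p i) *\<^sub>R ?p i) + l *\<^sub>R f)"
      by (simp only: krr_unique_minimiser[OF l])
    also have "\<dots> = (1 / real n) *\<^sub>R (S1 + S2)"
      using n by (simp add: S1_def S2_def scaleR_diff_left sum_subtractf scaleR_diff_right scaleR_add_right)
    finally show ?thesis .
  qed
  have "Q l u / 8 \<le> (\<Sum>i<n. (u \<bullet> ?p i)\<^sup>2) / real n + l * (norm u)\<^sup>2"
    by (rule empirical_form_lower_bound[OF l n B zG dev tail])
  also have "\<dots> = ((1 / real n) *\<^sub>R (\<Sum>i<n. (u \<bullet> ?p i) *\<^sub>R ?p i) + l *\<^sub>R u) \<bullet> u"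
    unfolding power2_norm_eq_inner
    by (simp add: inner_add_left inner_sum_left power2_eq_square inner_commute[of "\<Phi> x" u for x])
  also have "\<dots> = (S1 \<bullet> u + S2 \<bullet> u) / real n" unfolding eq by (simp add: inner_add_left)
  also have "\<dots> \<le> (real n * r1 * sqrt (Q l u) + real n * r2 * sqrt (Q l u)) / real n"
    using s1 s2 by (intro divide_right_mono add_mono) auto
  also have "\<dots> = (r1 + r2) * sqrt (Q l u)" using n by (simp add: field_simps)
  finally have main: "Q l u \<le> 8 * (r1 + r2) * sqrt (Q l u)" by (simp add: algebra_simps)
  have Q0: "0 \<le> Q l u" by (rule Q_nonneg[OF l])
  have r0: "0 \<le> r1 + r2" 
  proof -
    have "0 \<le> real n * r1" "0 \<le> real n * r2" using J1[of 0] J2[of 0] norm_ge_zero order_trans by blast+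
    then show ?thesis using n by (simp add: zero_le_mult_iff)
  qed
  have "sqrt (Q l u) \<le> 8 * (r1 + r2)"
  proof (cases "Q l u = 0")
    case False
    then have "0 < sqrt (Q l u)" using Q0 by simp
    moreover have "sqrt (Q l u) * sqrt (Q l u) \<le> 8 * (r1 + r2) * sqrt (Q l u)" using main Q0 by simp
    ultimately show ?thesis by (simp only: mult_le_cancel_right)
  qed (use r0 in simp)
  moreover have "L2norm \<mu> (\<lambda>x. krr \<Phi> l n z \<bullet> \<Phi> x - f \<bullet> \<Phi> x) \<le> sqrt (Q l u)"
    unfolding L2norm_def u_def inner_diff_left[symmetric] using l by (intro real_sqrt_le_mono) (simp add: Q_def)
  ultimately show ?thesis by (simp add: f_def)
qed

end

section \<open>High-probability events\<close>

text \<open>Group the indices into blocks of length \<open>J\<close>, about \<open>(C / l) powr (1 / \<beta>)\<close>: on the \<open>k\<close>-th block the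
  summand is at most \<open>k powr (- \<beta>)\<close>.\<close>
lemma effective_dimension:
  fixes lam :: "nat \<Rightarrow> real"
  assumes pos: "\<And>i. 0 < lam i" and dec: "\<And>i. lam i \<le> C * (real i + 1) powr (- \<beta>)"
    and b: "1 < \<beta>" and C: "0 < C" and l: "0 < l" "l \<le> l0"
  shows "(\<Sum>j<M. lam j / (lam j + l))
    \<le> (C powr (1 / \<beta>) + l0 powr (1 / \<beta>)) * (1 + (\<Sum>k. real k powr (- \<beta>))) * l powr (- 1 / \<beta>)"
proof -
  define q where "q = (C / l) powr (1 / \<beta>)"
  have q: "0 < q" using C l by (simp add: q_def)
  define J where "J = nat \<lceil>q\<rceil>"
  have J: "0 < J" "q \<le> real J" "real J \<le> q + 1" using q by (auto simp: J_def)
  \<comment> \<open>The separate 1 serves block 0, since \<open>0 powr _\<close> is 0.\<close>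
  define g where "g k = (if k = 0 then 1 else 0) + real k powr (- \<beta>)" for k :: nat
  have sg: "summable (\<lambda>k. real k powr (- \<beta>))" using b by (simp add: summable_real_powr_iff)
  have gsums: "g sums (1 + (\<Sum>k. real k powr (- \<beta>)))"
    unfolding g_def using sums_add[OF sums_single[of 0 "\<lambda>_. 1::real"] summable_sums[OF sg]] by simp
  have term_le: "lam j / (lam j + l) \<le> g k" if j: "k * J \<le> j" for k j
  proof (cases "k = 0")
    case True
    then show ?thesis using pos[of j] l by (simp add: g_def divide_le_eq)
  next
    case False
    have "real k * q \<le> real k * real J" using J by (intro mult_left_mono) auto
    also have "\<dots> \<le> real j + 1" using j of_nat_mono[of "k * J" j, where 'a=real] by simp
    finally have kq: "real k * q \<le> real j + 1" .
    have "lam j \<le> C * (real j + 1) powr (- \<beta>)" by (rule dec)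
    also have "\<dots> \<le> C * (real k * q) powr (- \<beta>)"
      using kq False q b C by (intro mult_left_mono powr_mono2') auto
    also have "\<dots> = C * (real k powr (- \<beta>) * q powr (- \<beta>))" using q by (simp add: powr_mult)
    also have "q powr (- \<beta>) = l / C"
      using b C l by (simp add: q_def powr_powr powr_minus_divide)
    finally have "lam j \<le> l * real k powr (- \<beta>)" using C by (simp add: mult.commute)
    then have "lam j / l \<le> real k powr (- \<beta>)" using l by (simp add: divide_le_eq mult.commute)
    moreover have "lam j / (lam j + l) \<le> lam j / l" using pos[of j] l by (intro divide_left_mono) auto
    ultimately show ?thesis using False by (simp add: g_def)
  qed
  \<comment> \<open>Extending the sum to \<open>M * J\<close> terms fills whole blocks; the added
    terms are nonnegative.\<close>
  have "(\<Sum>j<M. lam j / (lam j + l)) \<le> (\<Sum>j<M * J. lam j / (lam j + l))"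
    using pos l J by (intro sum_mono2) (auto intro!: divide_nonneg_nonneg simp: less_imp_le add_nonneg_nonneg intro: less_le_trans)
  also have "\<dots> = (\<Sum>k<M. \<Sum>j\<in>{k * J..<k * J + J}. lam j / (lam j + l))"
    by (rule sum.nat_group[symmetric])
  also have "\<dots> \<le> (\<Sum>k<M. \<Sum>j\<in>{k * J..<k * J + J}. g k)"
    by (intro sum_mono term_le) auto
  also have "\<dots> = real J * (\<Sum>k<M. g k)" by (simp add: sum_distrib_left)
  also have "\<dots> \<le> (q + 1) * (1 + (\<Sum>k. real k powr (- \<beta>)))"
  proof (rule mult_mono)
    show "(\<Sum>k<M. g k) \<le> 1 + (\<Sum>k. real k powr (- \<beta>))"
      using gsums sums_unique[OF gsums] sum_le_suminf[of g "{..<M}"] by (auto simp: sums_iff g_def)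
  qed (use J q in \<open>auto intro!: sum_nonneg simp: g_def\<close>)
  \<comment> \<open>The 1 from rounding q up is absorbed by \<open>l \<le> l0\<close>.\<close>
  also have "q + 1 \<le> (C powr (1 / \<beta>) + l0 powr (1 / \<beta>)) * l powr (- 1 / \<beta>)"
  proof -
    have "1 = l powr (1 / \<beta>) * l powr (- 1 / \<beta>)" using l by (simp add: powr_add[symmetric])
    also have "\<dots> \<le> l0 powr (1 / \<beta>) * l powr (- 1 / \<beta>)"
      using l b by (intro mult_right_mono powr_mono2) auto
    finally have "1 \<le> l0 powr (1 / \<beta>) * l powr (- 1 / \<beta>)" .
    moreover have "q = C powr (1 / \<beta>) * l powr (- 1 / \<beta>)"
      using C l by (simp add: q_def powr_divide powr_minus_divide)
    ultimately show ?thesis by (simp add: distrib_right)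
  qed
  then have "(q + 1) * (1 + (\<Sum>k. real k powr (- \<beta>)))
      \<le> (C powr (1 / \<beta>) + l0 powr (1 / \<beta>)) * l powr (- 1 / \<beta>) * (1 + (\<Sum>k. real k powr (- \<beta>)))"
    using sg by (intro mult_right_mono) (auto intro!: add_nonneg_nonneg suminf_nonneg)
  finally show ?thesis by (simp add: ac_simps)
qed

text \<open>The good events decrease with k, so continuity from above gives all k at once with the
  same p, where a union bound would diverge.\<close>

lemma (in prob_space) uniform_monotone_event:
  fixes N :: "nat \<Rightarrow> 'a \<Rightarrow> real"
  assumes "\<And>k. N k \<in> borel_measurable M"
    and mono: "\<And>k k' z. k \<le> k' \<Longrightarrow> z \<in> space M \<Longrightarrow> N k z \<le> N k' z"
    and p: "\<And>k. prob {z\<in>space M. c \<le> N k z} \<le> p"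
  shows "\<exists>E\<in>sets M. 1 - p \<le> prob E \<and> (\<forall>z\<in>E. \<forall>k. N k z \<le> c)"
proof -
  define E where "E k = {z\<in>space M. \<not> c \<le> N k z}" for k
  have E_sets: "E k \<in> sets M" for k using assms(1)[of k] unfolding E_def by measurable
  have dec: "decseq E"
  proof (rule decseq_SucI)
    show "E (Suc k) \<subseteq> E k" for k
      using mono[of k "Suc k"] by (auto simp: E_def) (meson order.trans not_le)
  qed
  have lim: "(\<lambda>k. prob (E k)) \<longlonglongrightarrow> prob (\<Inter>k. E k)"
    using E_sets dec by (intro finite_Lim_measure_decseq) auto
  have "1 - p \<le> prob (E k)" for k
  proof -
    have "{z\<in>space M. c \<le> N k z} \<in> sets M" using assms(1)[of k] by measurable
    then have "prob (E k) = 1 - prob {z\<in>space M. c \<le> N k z}"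
      unfolding E_def by (intro prob_neg) simp
    then show ?thesis using p[of k] by simp
  qed
  then have "1 - p \<le> prob (\<Inter>k. E k)" by (intro LIMSEQ_le_const[OF lim]) auto
  moreover have "(\<Inter>k. E k) \<in> sets M" using E_sets by (intro sets.countable_INT) auto
  moreover have "\<forall>z\<in>(\<Inter>k. E k). \<forall>k. N k z \<le> c" by (auto simp: E_def) (meson linear)
  ultimately show ?thesis by blast
qed

text \<open>Termwise integration of the exponential series without its linear term. The factorials
  cancel and \<open>r * \<bar>L\<bar> \<le> 1 / 2\<close> leaves a geometric series. L may be
  negative, hence the absolute value.\<close>

lemma nn_integral_exp_moment:
  assumes P: "prob_space P" and f[measurable]: "f \<in> borel_measurable P" and f0: "\<And>y. 0 \<le> f y"
    and mom: "\<And>m::nat. m \<ge> 2 \<Longrightarrow> (\<integral>\<^sup>+y. ennreal (f y ^ m) \<partial>P) \<le> ennreal (1/2 * fact m * \<sigma>\<^sup>2 * L ^ (m - 2))"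
    and r: "0 \<le> r" "r * \<bar>L\<bar> \<le> 1 / 2"
  shows "(\<integral>\<^sup>+y. ennreal (exp (r * f y) - r * f y) \<partial>P) \<le> ennreal (1 + \<sigma>\<^sup>2 * r\<^sup>2)"
proof -
  interpret prob_space P by fact
  let ?a = "\<lambda>m y. if m = 1 then 0 else (r * f y) ^ m / fact m"
  \<comment> \<open>Index 1 is empty because the linear term was subtracted; the tail from index 2
    adds up to \<open>\<sigma>\<^sup>2 * r\<^sup>2\<close>.\<close>
  define b where "b m = (if m = 0 then 1 else if m = 1 then 0 else 1/2 * \<sigma>\<^sup>2 * r\<^sup>2 * (1/2) ^ (m - 2))" for m :: nat
  have a_sums: "(\<lambda>m. ?a m y) sums (exp (r * f y) - r * f y)" for y
  proof -
    have "(\<lambda>m. (r * f y) ^ m / fact m) sums exp (r * f y)"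
      using exp_converges[of "r * f y"] by (simp add: divide_inverse mult.commute)
    from sums_diff[OF this sums_single[of 1 "\<lambda>_. r * f y"]]
    show ?thesis by (rule back_subst[of "\<lambda>h. h sums _"]) auto
  qed
  have a0: "0 \<le> ?a m y" for m y using r f0 by simp
  have b0: "0 \<le> b m" for m by (simp add: b_def)
  have b_sums: "b sums (1 + \<sigma>\<^sup>2 * r\<^sup>2)"
  proof -
    have "(\<lambda>k. 1/2 * \<sigma>\<^sup>2 * r\<^sup>2 * (1/2) ^ k) sums (1/2 * \<sigma>\<^sup>2 * r\<^sup>2 * 2)"
      using geometric_sums[of "1/2 :: real"] by (intro sums_mult) simp
    then have "(\<lambda>k. b (k + 2)) sums (1 + \<sigma>\<^sup>2 * r\<^sup>2 - (\<Sum>i<2. b i))"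
      by (simp add: b_def numeral_2_eq_2)
    then show ?thesis by (simp only: sums_iff_shift')
  qed
  have "(\<integral>\<^sup>+y. ennreal (exp (r * f y) - r * f y) \<partial>P) = (\<integral>\<^sup>+y. (\<Sum>m. ennreal (?a m y)) \<partial>P)"
  proof (rule nn_integral_cong)
    fix y
    show "ennreal (exp (r * f y) - r * f y) = (\<Sum>m. ennreal (?a m y))"
      using a_sums[of y] a0 by (subst suminf_ennreal2) (auto simp: sums_iff)
  qed
  also have "\<dots> = (\<Sum>m. \<integral>\<^sup>+y. ennreal (?a m y) \<partial>P)" by (intro nn_integral_suminf) auto
  also have "\<dots> \<le> (\<Sum>m. ennreal (b m))"
  proof (intro suminf_le)
    fix m :: nat
    consider "m = 0" | "m = 1" | "m \<ge> 2" by linarith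
    then show "(\<integral>\<^sup>+y. ennreal (?a m y) \<partial>P) \<le> ennreal (b m)"
    proof cases
      case 3
      have "(\<integral>\<^sup>+y. ennreal (?a m y) \<partial>P) = (\<integral>\<^sup>+y. ennreal (r ^ m / fact m) * ennreal (f y ^ m) \<partial>P)"
        using 3 r f0 by (intro nn_integral_cong) (auto simp: power_mult_distrib ennreal_mult[symmetric])
      also have "\<dots> = ennreal (r ^ m / fact m) * (\<integral>\<^sup>+y. ennreal (f y ^ m) \<partial>P)"
        by (intro nn_integral_cmult) auto
      also have "\<dots> \<le> ennreal (r ^ m / fact m) * ennreal (1/2 * fact m * \<sigma>\<^sup>2 * \<bar>L\<bar> ^ (m - 2))"
      proof (intro mult_left_mono)
        have "1/2 * fact m * \<sigma>\<^sup>2 * L ^ (m - 2) \<le> 1/2 * fact m * \<sigma>\<^sup>2 * \<bar>L\<bar> ^ (m - 2)"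
          by (intro mult_left_mono) (auto simp: power_abs[symmetric])
        then show "(\<integral>\<^sup>+y. ennreal (f y ^ m) \<partial>P) \<le> ennreal (1/2 * fact m * \<sigma>\<^sup>2 * \<bar>L\<bar> ^ (m - 2))"
          using mom[OF 3] ennreal_leI order_trans by blast
      qed simp
      also have "\<dots> = ennreal (r ^ m / fact m * (1/2 * fact m * \<sigma>\<^sup>2 * \<bar>L\<bar> ^ (m - 2)))"
        using r by (intro ennreal_mult[symmetric]) auto
      also have "r ^ m / fact m * (1/2 * fact m * \<sigma>\<^sup>2 * \<bar>L\<bar> ^ (m - 2)) = 1/2 * \<sigma>\<^sup>2 * r\<^sup>2 * (r * \<bar>L\<bar>) ^ (m - 2)"
      proof -
        have "2 + (m - 2) = m" using 3 by simp
        then have "r ^ m = r ^ (2 + (m - 2))" by (simp only:)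
        then have "r ^ m = r\<^sup>2 * r ^ (m - 2)" by (simp only: power_add)
        then show ?thesis by (simp add: power_mult_distrib)
      qed
      also have "ennreal \<dots> \<le> ennreal (b m)"
      proof (rule ennreal_leI)
        have "(r * \<bar>L\<bar>) ^ (m - 2) \<le> (1/2) ^ (m - 2)" using r by (intro power_mono) auto
        then show "1/2 * \<sigma>\<^sup>2 * r\<^sup>2 * (r * \<bar>L\<bar>) ^ (m - 2) \<le> b m"
          using 3 mult_left_mono[of _ _ "1/2 * \<sigma>\<^sup>2 * r\<^sup>2"] by (simp add: b_def)
      qed
      finally show ?thesis .
    qed (auto simp: b_def emeasure_space_1)
  qed auto
  also have "\<dots> = ennreal (1 + \<sigma>\<^sup>2 * r\<^sup>2)"
    using b_sums b0 by (subst suminf_ennreal2) (auto simp: sums_iff)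
  finally show ?thesis .
qed

section \<open>Events for noise, approximation and covariance\<close>

context krr_analysis
begin

lemma noise_mgf:
  assumes A4: "\<forall>m::nat. m \<ge> 2 \<longrightarrow> (AE x in \<mu>. (\<integral>\<^sup>+y. ennreal (\<bar>y - fs x\<bar> ^ m) \<partial>K x)
                 \<le> ennreal (1/2 * fact m * \<sigma>\<^sup>2 * L ^ (m - 2)))"
    and w[measurable]: "w \<in> borel_measurable \<mu>" and w0: "\<And>x. 0 \<le> w x" and wL: "\<And>x. w x * \<bar>L\<bar> \<le> 1 / 2"
    and wi: "integrable \<mu> (\<lambda>x. (w x)\<^sup>2)"
  shows "(\<integral>\<^sup>+z. ennreal (exp (w (fst z) * \<bar>snd z - fs (fst z)\<bar>) - w (fst z) * \<bar>snd z - fs (fst z)\<bar>) \<partial>\<rho>)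
    \<le> ennreal (1 + \<sigma>\<^sup>2 * (\<integral>x. (w x)\<^sup>2 \<partial>\<mu>))"
proof -
  \<comment> \<open>There are countably many exponents, so one null set serves all of them.\<close>
  have "AE x in \<mu>. \<forall>m::nat. m \<ge> 2 \<longrightarrow> (\<integral>\<^sup>+y. ennreal (\<bar>y - fs x\<bar> ^ m) \<partial>K x)
                 \<le> ennreal (1/2 * fact m * \<sigma>\<^sup>2 * L ^ (m - 2))"
    unfolding AE_all_countable
  proof
    fix m :: nat
    show "AE x in \<mu>. m \<ge> 2 \<longrightarrow> (\<integral>\<^sup>+y. ennreal (\<bar>y - fs x\<bar> ^ m) \<partial>K x)
                 \<le> ennreal (1/2 * fact m * \<sigma>\<^sup>2 * L ^ (m - 2))"
      using A4 by (cases "m \<ge> 2") auto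
  qed
  then have ae: "AE x in \<mu>. (\<integral>\<^sup>+y. ennreal (exp (w x * \<bar>y - fs x\<bar>) - w x * \<bar>y - fs x\<bar>) \<partial>K x) \<le> ennreal (1 + \<sigma>\<^sup>2 * (w x)\<^sup>2)"
    using AE_space
  proof eventually_elim
    case (elim x)
    then have x: "x \<in> X" by (simp add: space_mu)
    show ?case
      by (rule nn_integral_exp_moment[OF K_prob[OF x], where L=L])
        (use elim(1) w0 wL K_sets[OF x] in \<open>auto simp: measurable_cong_sets[OF K_sets[OF x] refl]\<close>)
  qed
  have "(\<integral>\<^sup>+z. ennreal (exp (w (fst z) * \<bar>snd z - fs (fst z)\<bar>) - w (fst z) * \<bar>snd z - fs (fst z)\<bar>) \<partial>\<rho>)
     = (\<integral>\<^sup>+x. (\<integral>\<^sup>+y. ennreal (exp (w x * \<bar>y - fs x\<bar>) - w x * \<bar>y - fs x\<bar>) \<partial>K x) \<partial>\<mu>)"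
    by (subst nn_integral_disintegration) auto
  also have "\<dots> \<le> (\<integral>\<^sup>+x. ennreal (1 + \<sigma>\<^sup>2 * (w x)\<^sup>2) \<partial>\<mu>)" by (rule nn_integral_mono_AE[OF ae])
  also have "\<dots> = ennreal (\<integral>x. 1 + \<sigma>\<^sup>2 * (w x)\<^sup>2 \<partial>\<mu>)" using wi by (intro nn_integral_eq_integral) auto
  also have "(\<integral>x. 1 + \<sigma>\<^sup>2 * (w x)\<^sup>2 \<partial>\<mu>) = 1 + \<sigma>\<^sup>2 * (\<integral>x. (w x)\<^sup>2 \<partial>\<mu>)" using wi by (simp add: mu.prob_space)
  finally show ?thesis .
qed

text \<open>V bounds the variance of one whitened noise term uniformly in M, and
  \<open>small\<close> keeps the scaled term within the range of the moment condition. The threshold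
  depends on \<delta> only through the logarithm.\<close>

lemma noise_event:
  fixes n :: nat and V \<delta> :: real
  assumes l: "0 < l" and n: "0 < n" and d: "0 < \<delta>" "\<delta> < 1" and V: "0 < V"
    and A4: "\<forall>m::nat. m \<ge> 2 \<longrightarrow> (AE x in \<mu>. (\<integral>\<^sup>+y. ennreal (\<bar>y - fs x\<bar> ^ m) \<partial>K x)
                 \<le> ennreal (1/2 * fact m * \<sigma>\<^sup>2 * L ^ (m - 2)))"
    and dim: "\<And>M. \<sigma>\<^sup>2 * (\<Sum>j<M. lam j / (lam j + l)) \<le> V"
    and small: "\<bar>A\<bar> * l powr (- \<alpha> / 2) * \<bar>L\<bar> / sqrt (n * V) \<le> 1 / 2"
  shows "\<exists>E\<in>sets (Pi\<^sub>M {..<n} (\<lambda>_. \<rho>)). 1 - \<delta> / 2 \<le> measure (Pi\<^sub>M {..<n} (\<lambda>_. \<rho>)) E \<and>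
    (\<forall>z\<in>E. \<forall>M. norm (\<Sum>i<n. (snd (z i) - fs (fst (z i))) *\<^sub>R J l M (Phi_G (fst (z i)))) \<le> n * (2 * ln (4 / \<delta>) * sqrt (V / n)))"
proof -
  interpret P: prob_space "Pi\<^sub>M {..<n} (\<lambda>_. \<rho>)" by (intro prob_space_PiM prob_space_axioms)
  let ?P = "Pi\<^sub>M {..<n} (\<lambda>_. \<rho>)"
  let ?N = "\<lambda>M z. norm (\<Sum>i<n. (snd (z i) - fs (fst (z i))) *\<^sub>R J l M (Phi_G (fst (z i))))"
  \<comment> \<open>With this scale each coordinate contributes at most \<open>1 + 1 / n\<close>,
    and the product over the sample stays below \<open>exp 1\<close>.\<close>
  define t where "t = 1 / sqrt (n * V)"
  have t0: "0 < t" using n V by (simp add: t_def)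
  \<comment> \<open>The factor 2 gives \<open>exp u = (4 / \<delta>)\<^sup>2\<close>, so the failure
    probability is at most \<open>\<delta> * \<delta> / 2\<close>, leaving room for the constants
    from \<open>exp 1\<close> and \<open>cosh\<close>.\<close>
  define u where "u = 2 * ln (4 / \<delta>)"
  define c where "c = n * (2 * ln (4 / \<delta>) * sqrt (V / n))"
  have "exp 1 \<le> 4 / \<delta>"
  proof -
    have "exp 1 \<le> (3::real)" by (rule exp_le)
    also have "3 \<le> 4 / \<delta>" using d by (simp add: le_divide_eq)
    finally show ?thesis .
  qed
  then have ln1: "1 \<le> ln (4 / \<delta>)" using d by (subst ln_ge_iff) auto
  have tc: "t * c = u"
  proof -
    have "sqrt (V / n) = sqrt (n * V) / n"
    proof -
      have "V / n = (n * V) / (real n)\<^sup>2" using n by (simp add: power2_eq_square)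
      then show ?thesis by (simp add: real_sqrt_divide)
    qed
    moreover have "0 < sqrt (n * V)" using n V by simp
    ultimately show ?thesis using n V by (simp add: t_def c_def u_def)
  qed
  have meas: "?N M \<in> borel_measurable ?P" for M by measurable
  show ?thesis unfolding c_def[symmetric]
  proof (rule P.uniform_monotone_event[OF meas])
    fix k k' :: nat and z assume "k \<le> k'"
    have "(\<Sum>i<n. (snd (z i) - fs (fst (z i))) *\<^sub>R J l M (Phi_G (fst (z i))))
       = J l M (\<Sum>i<n. (snd (z i) - fs (fst (z i))) *\<^sub>R Phi_G (fst (z i)))" for M
      by (simp add: J_sum J_scaleR)
    then show "?N k z \<le> ?N k' z" using J_mono[OF l \<open>k \<le> k'\<close>] by simp
  next
    fix M
    define \<xi> where "\<xi> z = (t * (snd z - fs (fst z))) *\<^sub>R J l M (Phi_G (fst z))" for z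
    have \<xi>_meas: "\<xi> \<in> borel_measurable \<rho>" unfolding \<xi>_def by measurable
    define w where "w x = t * norm (J l M (Phi_G x))" for x
    have w_meas: "w \<in> borel_measurable \<mu>" unfolding w_def by measurable
    have nJ: "norm (J l M (Phi_G x)) \<le> \<bar>A\<bar> * l powr (- \<alpha> / 2)" for x
    proof -
      have "(norm (J l M (Phi_G x)))\<^sup>2 \<le> (\<bar>A\<bar> * l powr (- \<alpha> / 2))\<^sup>2"
        using J_Phi_G_bound[OF l, of M x] by (simp add: power_mult_distrib power2_eq_square[of "l powr _"] powr_add[symmetric])
      then show ?thesis by (rule power2_le_imp_le) simp
    qed
    have norm_xi: "norm (\<xi> z) = w (fst z) * \<bar>snd z - fs (fst z)\<bar>" for z
      using t0 by (simp add: \<xi>_def w_def abs_mult)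
    have c_xi: "b \<bullet> \<xi> z = (snd z - fs (fst z)) * (t * (b \<bullet> J l M (Phi_G (fst z))))" for b z
      by (simp add: \<xi>_def)
    have psi: "\<bar>t * (b \<bullet> J l M (Phi_G x))\<bar> \<le> t * (norm b * (\<bar>A\<bar> * l powr (- \<alpha> / 2)))" for b x
      using Cauchy_Schwarz_ineq2[of b "J l M (Phi_G x)"] mult_left_mono[OF nJ[of x], of "norm b"] t0
      by (simp add: abs_mult)
    have mean: "integrable \<rho> (\<lambda>z. b \<bullet> \<xi> z)" "(\<integral>z. b \<bullet> \<xi> z \<partial>\<rho>) = 0" for b
      unfolding c_xi using noise_mean_zero[where \<psi>="\<lambda>x. t * (b \<bullet> J l M (Phi_G x))", OF _ psi[of b]] by auto
    have wsq: "integrable \<mu> (\<lambda>x. (w x)\<^sup>2)" "(\<integral>x. (w x)\<^sup>2 \<partial>\<mu>) = t\<^sup>2 * (\<Sum>j<M. lam j / (lam j + l))"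
      unfolding w_def power_mult_distrib using integral_J_Phi_G[OF l, of M] by auto
    have "(\<integral>\<^sup>+z. ennreal (exp (norm (\<xi> z)) - norm (\<xi> z)) \<partial>\<rho>) \<le> ennreal (1 + \<sigma>\<^sup>2 * (\<integral>x. (w x)\<^sup>2 \<partial>\<mu>))"
      unfolding norm_xi
    proof (rule noise_mgf[OF A4 w_meas _ _ wsq(1)])
      show "0 \<le> w x" for x using t0 by (simp add: w_def)
      show "w x * \<bar>L\<bar> \<le> 1 / 2" for x
      proof -
        have "w x * \<bar>L\<bar> \<le> t * (\<bar>A\<bar> * l powr (- \<alpha> / 2)) * \<bar>L\<bar>"
          unfolding w_def using t0 nJ by (intro mult_right_mono mult_left_mono) auto
        also have "\<dots> \<le> 1 / 2" using small by (simp add: t_def)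
        finally show ?thesis .
      qed
    qed
    also have "\<dots> \<le> ennreal (1 + 1 / n)"
    proof (intro ennreal_leI add_left_mono)
      have "\<sigma>\<^sup>2 * (\<integral>x. (w x)\<^sup>2 \<partial>\<mu>) = t\<^sup>2 * (\<sigma>\<^sup>2 * (\<Sum>j<M. lam j / (lam j + l)))" by (simp add: wsq)
      also have "\<dots> \<le> t\<^sup>2 * V" by (intro mult_left_mono dim) simp
      also have "\<dots> = 1 / n" using n V by (simp add: t_def power_divide)
      finally show "\<sigma>\<^sup>2 * (\<integral>x. (w x)\<^sup>2 \<partial>\<mu>) \<le> 1 / n" .
    qed
    finally have "(\<integral>\<^sup>+z. ennreal (cosh (norm (\<Sum>i<n. \<xi> (z i)))) \<partial>?P) \<le> ennreal ((1 + 1 / n) ^ card {..<n})"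
      by (intro cosh_norm_sum_integral_le prob_space_axioms \<xi>_meas mean) auto
    also have "\<dots> \<le> ennreal (exp 1)"
    proof (rule ennreal_leI)
      have "(1 + 1 / real n) ^ n \<le> exp (1 / n) ^ n" by (intro power_mono exp_ge_add_one_self) auto
      also have "\<dots> = exp 1" using n by (simp add: exp_of_nat_mult[symmetric])
      finally show "(1 + 1 / real n) ^ card {..<n} \<le> exp 1" by simp
    qed
    finally have E: "(\<integral>\<^sup>+z. ennreal (cosh (norm (\<Sum>i<n. \<xi> (z i)))) \<partial>?P) \<le> ennreal (exp 1)" .
    have [measurable]: "(\<lambda>z. cosh (norm (\<Sum>i<n. \<xi> (z i)))) \<in> borel_measurable ?P"
    proof -
      have [measurable]: "(cosh :: real \<Rightarrow> real) \<in> borel_measurable borel"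
        by (intro borel_measurable_continuous_onI continuous_intros)
      show ?thesis using \<xi>_meas by measurable
    qed
    have "{z\<in>space ?P. c \<le> ?N M z} \<subseteq> {z\<in>space ?P. cosh u \<le> cosh (norm (\<Sum>i<n. \<xi> (z i)))}"
    proof safe
      fix z assume "c \<le> ?N M z"
      have "(\<Sum>i<n. \<xi> (z i)) = t *\<^sub>R (\<Sum>i<n. (snd (z i) - fs (fst (z i))) *\<^sub>R J l M (Phi_G (fst (z i))))"
        by (simp add: \<xi>_def scaleR_sum_right)
      then have "norm (\<Sum>i<n. \<xi> (z i)) = t * ?N M z" using t0 by simp
      then have "u \<le> norm (\<Sum>i<n. \<xi> (z i))" using \<open>c \<le> ?N M z\<close> t0 by (simp add: tc[symmetric])
      then show "cosh u \<le> cosh (norm (\<Sum>i<n. \<xi> (z i)))"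
        using ln1 by (simp add: u_def cosh_real_nonneg_le_iff)
    qed
    then have "P.prob {z\<in>space ?P. c \<le> ?N M z} \<le> P.prob {z\<in>space ?P. cosh u \<le> cosh (norm (\<Sum>i<n. \<xi> (z i)))}"
      by (intro P.finite_measure_mono) auto
    also have "\<dots> \<le> exp 1 / cosh u"
      by (intro P.prob_ge_le E) (auto simp: less_imp_le)
    also have "\<dots> \<le> 4 / (exp u / 2)"
    proof (rule frac_le)
      show "exp 1 \<le> (4::real)" using exp_le by linarith
      show "exp u / 2 \<le> cosh u" by (simp add: cosh_field_def divide_right_mono)
    qed auto
    also have "exp u = (4 / \<delta>)\<^sup>2"
    proof -
      have "exp u = exp (ln (4 / \<delta>) + ln (4 / \<delta>))" by (simp add: u_def)
      also have "\<dots> = exp (ln (4 / \<delta>)) * exp (ln (4 / \<delta>))" by (rule exp_add)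
      finally show ?thesis using d by (simp add: power2_eq_square)
    qed
    also have "4 / ((4 / \<delta>)\<^sup>2 / 2) = \<delta> * \<delta> / 2" by (simp add: power2_eq_square)
    also have "\<dots> \<le> \<delta> / 2" using d by (simp add: mult_left_le)
    finally show "P.prob {z\<in>space ?P. c \<le> ?N M z} \<le> \<delta> / 2" .
  qed
qed

text \<open>The whitened feature is bounded by \<open>A\<^sup>2 * l powr (- \<alpha>)\<close> in
  squared norm and the approximation error is of order \<open>l powr s\<close> in squared L2 norm.
  Their product bounds the variance in Chebyshev's inequality.\<close>

lemma bias_event:
  fixes n :: nat and r :: real
  assumes l: "0 < l" and n: "0 < n" and r: "0 < r" and s: "0 < s" "s \<le> 2" and A3: "interp_norm_le \<mu> lam e s R fs"
  defines "f \<equiv> f_lambda \<mu> \<Phi> fs l"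
  shows "\<exists>E\<in>sets (Pi\<^sub>M {..<n} (\<lambda>_. \<rho>)).
    1 - 3 * A\<^sup>2 * R\<^sup>2 * l powr (s - \<alpha>) / (n * r\<^sup>2) \<le> measure (Pi\<^sub>M {..<n} (\<lambda>_. \<rho>)) E \<and>
    (\<forall>z\<in>E. \<forall>M. norm (\<Sum>i<n. (fs (fst (z i)) - f \<bullet> \<Phi> (fst (z i))) *\<^sub>R J l M (Phi_G (fst (z i))) - J l M (l *\<^sub>R f)) \<le> n * r)"
proof -
  interpret P: prob_space "Pi\<^sub>M {..<n} (\<lambda>_. \<rho>)" by (intro prob_space_PiM prob_space_axioms)
  let ?P = "Pi\<^sub>M {..<n} (\<lambda>_. \<rho>)"
  define g where "g x = fs x - f \<bullet> \<Phi> x" for x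
  have g_meas[measurable]: "g \<in> borel_measurable \<mu>" unfolding g_def by measurable
  have g_sq: "integrable \<mu> (\<lambda>x. (g x)\<^sup>2)"
    using L2_add_integrable[of fs \<mu> "\<lambda>x. - (f \<bullet> \<Phi> x)"] fs_sq_integrable inner_Phi_sq_integrable by (simp add: g_def)
  have g_int: "(\<integral>x. (g x)\<^sup>2 \<partial>\<mu>) \<le> 3 * R\<^sup>2 * l powr s"
    unfolding g_def f_def by (rule approximation_error[OF l s A3])
  define \<zeta> where "\<zeta> M x = g x *\<^sub>R J l M (Phi_G x) - J l M (l *\<^sub>R f)" for M x
  have [measurable]: "\<zeta> M \<in> borel_measurable \<mu>" for M unfolding \<zeta>_def by measurable
  let ?N = "\<lambda>M z. norm (\<Sum>i<n. \<zeta> M (fst (z i)))"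
  have meas: "?N M \<in> borel_measurable ?P" for M by measurable
  have "\<exists>E\<in>sets ?P. 1 - 3 * A\<^sup>2 * R\<^sup>2 * l powr (s - \<alpha>) / (n * r\<^sup>2) \<le> P.prob E \<and> (\<forall>z\<in>E. \<forall>M. ?N M z \<le> n * r)"
  proof (rule P.uniform_monotone_event[OF meas])
    fix k k' :: nat and z assume "k \<le> k'"
    have "(\<Sum>i<n. \<zeta> M (fst (z i))) = J l M (\<Sum>i<n. g (fst (z i)) *\<^sub>R Phi_G (fst (z i)) - l *\<^sub>R f)" for M
      by (simp add: J_sum J_scaleR J_diff \<zeta>_def)
    then show "?N k z \<le> ?N k' z" using J_mono[OF l \<open>k \<le> k'\<close>] by simp
  next
    fix M
    let ?J = "J l M"
    have inner: "b \<bullet> \<zeta> M x = g x * (?J b \<bullet> Phi_G x) - ?J b \<bullet> (l *\<^sub>R f)" for b x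
      by (simp only: \<zeta>_def inner_diff_right inner_scaleR_right J_inner)
    \<comment> \<open>The population equation identifies the mean of the residual times the feature
      as l f, which is why this term is subtracted in \<open>\<zeta>\<close>.\<close>
    have JG: "integrable \<mu> (\<lambda>x. g x * (b \<bullet> Phi_G x))" "(\<integral>x. g x * (b \<bullet> Phi_G x) \<partial>\<mu>) = b \<bullet> (l *\<^sub>R f)" for b
    proof -
      have ae: "AE x in \<mu>. g x * (b \<bullet> Phi_G x) = g x * (b \<bullet> \<Phi> x)" using AE_G by eventually_elim (simp add: Phi_G_eq)
      have i: "integrable \<mu> (\<lambda>x. g x * (b \<bullet> \<Phi> x))" by (intro L2_mult_integrable g_sq inner_Phi_sq_integrable) auto
      then show "integrable \<mu> (\<lambda>x. g x * (b \<bullet> Phi_G x))" using ae by (subst integrable_cong_AE) auto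
      have "(\<integral>x. g x * (b \<bullet> Phi_G x) \<partial>\<mu>) = (\<integral>x. fs x * (b \<bullet> \<Phi> x) - (f \<bullet> \<Phi> x) * (b \<bullet> \<Phi> x) \<partial>\<mu>)"
        using ae by (subst integral_cong_AE[OF _ _ ae]) (auto simp: g_def left_diff_distrib)
      also have "\<dots> = g_H \<mu> \<Phi> fs \<bullet> b - T_H \<mu> \<Phi> f \<bullet> b"
        using L2_mult_integrable[OF fs_meas _ fs_sq_integrable inner_Phi_sq_integrable, of b]
        by (simp add: g_H_inner fs_sq_integrable T_H_inner inner_Phi_mult_integrable)
      also have "\<dots> = b \<bullet> (l *\<^sub>R f)"
        by (simp add: f_lambda_eq[OF l, symmetric] f_def inner_add_left inner_add_right inner_commute)
      finally show "(\<integral>x. g x * (b \<bullet> Phi_G x) \<partial>\<mu>) = b \<bullet> (l *\<^sub>R f)" .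
    qed
    have mean: "integrable \<mu> (\<lambda>x. b \<bullet> \<zeta> M x)" "(\<integral>x. b \<bullet> \<zeta> M x \<partial>\<mu>) = 0" for b
      unfolding inner using JG[of "?J b"] by (simp_all add: mu.prob_space)
    have gJ: "integrable \<mu> (\<lambda>x. (norm (g x *\<^sub>R ?J (Phi_G x)))\<^sup>2)"
      "(\<integral>x. (norm (g x *\<^sub>R ?J (Phi_G x)))\<^sup>2 \<partial>\<mu>) \<le> 3 * A\<^sup>2 * R\<^sup>2 * l powr (s - \<alpha>)"
    proof -
      have bd: "(norm (g x *\<^sub>R ?J (Phi_G x)))\<^sup>2 \<le> A\<^sup>2 * l powr (- \<alpha>) * (g x)\<^sup>2" for x
        using mult_left_mono[OF J_Phi_G_bound[OF l, of M x], of "(g x)\<^sup>2"] by (simp add: power_mult_distrib ac_simps)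
      show i: "integrable \<mu> (\<lambda>x. (norm (g x *\<^sub>R ?J (Phi_G x)))\<^sup>2)"
      proof (rule Bochner_Integration.integrable_bound)
        show "integrable \<mu> (\<lambda>x. A\<^sup>2 * l powr (- \<alpha>) * (g x)\<^sup>2)" using g_sq by simp
        show "AE x in \<mu>. norm ((norm (g x *\<^sub>R ?J (Phi_G x)))\<^sup>2) \<le> norm (A\<^sup>2 * l powr (- \<alpha>) * (g x)\<^sup>2)"
          using bd by (intro AE_I2) (simp add: abs_mult)
      qed measurable
      have "(\<integral>x. (norm (g x *\<^sub>R ?J (Phi_G x)))\<^sup>2 \<partial>\<mu>) \<le> (\<integral>x. A\<^sup>2 * l powr (- \<alpha>) * (g x)\<^sup>2 \<partial>\<mu>)"
        using g_sq by (intro integral_mono i bd) auto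
      also have "\<dots> = A\<^sup>2 * l powr (- \<alpha>) * (\<integral>x. (g x)\<^sup>2 \<partial>\<mu>)" by simp
      also have "\<dots> \<le> A\<^sup>2 * l powr (- \<alpha>) * (3 * R\<^sup>2 * l powr s)" using g_int by (intro mult_left_mono) auto
      also have "\<dots> = 3 * A\<^sup>2 * R\<^sup>2 * l powr (s - \<alpha>)"
      proof -
        have "l powr (s - \<alpha>) = l powr (- \<alpha>) * l powr s" by (simp add: powr_add[symmetric])
        then show ?thesis by simp
      qed
      finally show "(\<integral>x. (norm (g x *\<^sub>R ?J (Phi_G x)))\<^sup>2 \<partial>\<mu>) \<le> 3 * A\<^sup>2 * R\<^sup>2 * l powr (s - \<alpha>)" .
    qed
    have zsq: "integrable \<mu> (\<lambda>x. (norm (\<zeta> M x))\<^sup>2)" "(\<integral>x. (norm (\<zeta> M x))\<^sup>2 \<partial>\<mu>) \<le> 3 * A\<^sup>2 * R\<^sup>2 * l powr (s - \<alpha>)"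
    proof -
      define d where "d = ?J (l *\<^sub>R f)"
      \<comment> \<open>Centring can only lower the second moment: the linear term integrates to
        0.\<close>
      have ex: "(norm (\<zeta> M x))\<^sup>2 = (norm (g x *\<^sub>R ?J (Phi_G x)))\<^sup>2 - 2 * (d \<bullet> \<zeta> M x) - (norm d)\<^sup>2" for x
        unfolding \<zeta>_def d_def[symmetric] power2_norm_eq_inner by (simp add: inner_diff_left inner_diff_right inner_commute)
      show "integrable \<mu> (\<lambda>x. (norm (\<zeta> M x))\<^sup>2)" unfolding ex using gJ(1) mean(1) by simp
      have "(\<integral>x. (norm (\<zeta> M x))\<^sup>2 \<partial>\<mu>) = (\<integral>x. (norm (g x *\<^sub>R ?J (Phi_G x)))\<^sup>2 \<partial>\<mu>) - (norm d)\<^sup>2"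
        unfolding ex using gJ(1) mean by (simp add: mu.prob_space)
      then show "(\<integral>x. (norm (\<zeta> M x))\<^sup>2 \<partial>\<mu>) \<le> 3 * A\<^sup>2 * R\<^sup>2 * l powr (s - \<alpha>)" using gJ(2) zero_le_power2[of "norm d"] by linarith
    qed
    have "(\<integral>\<^sup>+z. ennreal ((?N M z)\<^sup>2) \<partial>?P) \<le> ennreal (card {..<n} * (3 * A\<^sup>2 * R\<^sup>2 * l powr (s - \<alpha>)))"
    proof (rule norm_sum_square_integral_le[where P=\<rho> and I="{..<n}" and \<xi>="\<lambda>z. \<zeta> M (fst z)"])
      show "prob_space \<rho>" by (rule prob_space_axioms)
      show "integrable \<rho> (\<lambda>y. b \<bullet> \<zeta> M (fst y))" for b using mean(1)[of b] by (subst (asm) integrable_marginal) auto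
      show "(\<integral>y. b \<bullet> \<zeta> M (fst y) \<partial>\<rho>) = 0" for b using mean(2)[of b] by (subst (asm) integral_marginal) auto
      show "integrable \<rho> (\<lambda>y. (norm (\<zeta> M (fst y)))\<^sup>2)" using zsq(1) by (subst (asm) integrable_marginal) auto
      show "(\<integral>y. (norm (\<zeta> M (fst y)))\<^sup>2 \<partial>\<rho>) \<le> 3 * A\<^sup>2 * R\<^sup>2 * l powr (s - \<alpha>)"
        using zsq(2) by (subst (asm) integral_marginal) auto
    qed auto
    then have "P.prob {z\<in>space ?P. (n * r)\<^sup>2 \<le> (?N M z)\<^sup>2} \<le> (n * (3 * A\<^sup>2 * R\<^sup>2 * l powr (s - \<alpha>))) / (n * r)\<^sup>2"
      using n r by (intro P.prob_ge_le) auto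
    moreover have "(n * (3 * A\<^sup>2 * R\<^sup>2 * l powr (s - \<alpha>))) / (n * r)\<^sup>2 = 3 * A\<^sup>2 * R\<^sup>2 * l powr (s - \<alpha>) / (n * r\<^sup>2)"
      using n by (simp add: power_mult_distrib power2_eq_square[of "real n"])
    moreover have "{z\<in>space ?P. n * r \<le> ?N M z} = {z\<in>space ?P. (n * r)\<^sup>2 \<le> (?N M z)\<^sup>2}"
    proof -
      have "n * r \<le> y \<longleftrightarrow> (n * r)\<^sup>2 \<le> y\<^sup>2" if "0 \<le> y" for y
        using r that by (intro power_mono_iff[symmetric]) auto
      then show ?thesis by (meson norm_ge_zero)
    qed
    ultimately show "P.prob {z\<in>space ?P. n * r \<le> ?N M z} \<le> 3 * A\<^sup>2 * R\<^sup>2 * l powr (s - \<alpha>) / (n * r\<^sup>2)"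
      by (simp only:)
  qed
  then show ?thesis by (simp add: \<zeta>_def g_def)
qed

text \<open>The failure budget is \<open>\<delta> / 2\<close> for the noise,
  \<open>\<delta> / 4\<close> each for approximation and operator deviation, and 0 for leaving
  G.\<close>

lemma error_event:
  fixes n :: nat and r V \<delta> B :: real
  assumes l: "0 < l" and n: "0 < n" and d: "0 < \<delta>" "\<delta> < 1" and V: "0 < V" and r: "0 < r"
    and s: "0 < s" "s \<le> 2" and A3: "interp_norm_le \<mu> lam e s R fs"
    and A4: "\<forall>m::nat. m \<ge> 2 \<longrightarrow> (AE x in \<mu>. (\<integral>\<^sup>+y. ennreal (\<bar>y - fs x\<bar> ^ m) \<partial>K x)
                 \<le> ennreal (1/2 * fact m * \<sigma>\<^sup>2 * L ^ (m - 2)))"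
    and dim: "\<And>M. \<sigma>\<^sup>2 * (\<Sum>j<M. lam j / (lam j + l)) \<le> V"
    and small: "\<bar>A\<bar> * l powr (- \<alpha> / 2) * \<bar>L\<bar> / sqrt (n * V) \<le> 1 / 2"
    and bias: "3 * A\<^sup>2 * R\<^sup>2 * l powr (s - \<alpha>) / (n * r\<^sup>2) \<le> \<delta> / 4"
    and B: "1 \<le> B" "A\<^sup>2 * l powr (- \<alpha>) \<le> B" "B \<le> n"
    and op: "moment_const (2 ^ p) * (n * B) ^ (2 ^ p) * m / (n / 8) ^ (2 * 2 ^ p) \<le> \<delta> / 4"
    and tail: "lam m powr (1 - \<alpha>) * A\<^sup>2 \<le> l / 24"
  shows "\<exists>E\<in>sets (Pi\<^sub>M {..<n} (\<lambda>_. \<rho>)).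
    E \<subseteq> {z \<in> space (Pi\<^sub>M {..<n} (\<lambda>_. \<rho>)).
      L2norm \<mu> (\<lambda>x. krr \<Phi> l n z \<bullet> \<Phi> x - f_lambda \<mu> \<Phi> fs l \<bullet> \<Phi> x) \<le> 8 * (2 * ln (4 / \<delta>) * sqrt (V / n) + r)} \<and>
    1 - \<delta> \<le> measure (Pi\<^sub>M {..<n} (\<lambda>_. \<rho>)) E"
proof -
  interpret P: prob_space "Pi\<^sub>M {..<n} (\<lambda>_. \<rho>)" by (intro prob_space_PiM prob_space_axioms)
  interpret R: rank_one_sum \<rho> m "vcoord l" B "\<lambda>j. lam j / (lam j + l)"
    by (rule rank_one_vcoord[OF l B(1,2)])
  let ?P = "Pi\<^sub>M {..<n} (\<lambda>_. \<rho>)"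
  obtain E1 where E1: "E1 \<in> sets ?P" "1 - \<delta> / 2 \<le> P.prob E1"
    "\<forall>z\<in>E1. \<forall>M. norm (\<Sum>i<n. (snd (z i) - fs (fst (z i))) *\<^sub>R J l M (Phi_G (fst (z i)))) \<le> n * (2 * ln (4 / \<delta>) * sqrt (V / n))"
    using noise_event[OF l n d V A4 dim small] by blast
  obtain E2 where E2: "E2 \<in> sets ?P" "1 - 3 * A\<^sup>2 * R\<^sup>2 * l powr (s - \<alpha>) / (n * r\<^sup>2) \<le> P.prob E2"
    "\<forall>z\<in>E2. \<forall>M. norm (\<Sum>i<n. (fs (fst (z i)) - f_lambda \<mu> \<Phi> fs l \<bullet> \<Phi> (fst (z i))) *\<^sub>R J l M (Phi_G (fst (z i)))
       - J l M (l *\<^sub>R f_lambda \<mu> \<Phi> fs l)) \<le> n * r"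
    using bias_event[OF l n r s A3] by blast
  have E2': "1 - \<delta> / 4 \<le> P.prob E2" using E2(2) bias by linarith
  have "0 < real n / 8" using n by simp
  from R.prob_quad_form_deviation[OF finite_lessThan _ B(3) this, of n p]
  obtain E3 where E3: "E3 \<in> sets ?P"
    "1 - moment_const (2 ^ p) * (n * B) ^ (2 ^ p) * m / (n / 8) ^ (2 * 2 ^ p) \<le> P.prob E3"
    "\<forall>z\<in>E3. \<forall>b. \<bar>\<Sum>i<m. \<Sum>j<m. b i * R.cmat_sum {..<n} z i j * b j\<bar> \<le> real n / 8 * (\<Sum>i<m. (b i)\<^sup>2)"
    by auto
  have E3': "1 - \<delta> / 4 \<le> P.prob E3" using E3(2) op by linarith
  \<comment> \<open>The pointwise bounds hold on G only, so all sample points have to lie there;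
    this costs no probability.\<close>
  have "AE z in ?P. \<forall>i\<in>{..<n}. fst (z i) \<in> G"
  proof (subst AE_ball_countable)
    show "\<forall>i\<in>{..<n}. AE z in ?P. fst (z i) \<in> G"
      using AE_marginal[OF AE_G] by (intro ballI AE_PiM_component) (auto intro: prob_space_axioms)
  qed auto
  then obtain E4 where E4: "E4 \<in> sets ?P" "P.prob E4 = 1" "\<forall>z\<in>E4. \<forall>i\<in>{..<n}. fst (z i) \<in> G"
  proof -
    assume *: "\<And>E4. E4 \<in> sets ?P \<Longrightarrow> P.prob E4 = 1 \<Longrightarrow> \<forall>z\<in>E4. \<forall>i\<in>{..<n}. fst (z i) \<in> G \<Longrightarrow> thesis"
    assume ae: "AE z in ?P. \<forall>i\<in>{..<n}. fst (z i) \<in> G"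
    let ?E = "{z\<in>space ?P. \<forall>i\<in>{..<n}. fst (z i) \<in> G}"
    have "?E \<in> sets ?P" using G_sets by measurable
    then show thesis using ae by (intro *[of ?E]) (auto simp: P.prob_eq_1 elim!: eventually_mono)
  qed
  define E where "E = E1 \<inter> E2 \<inter> E3 \<inter> E4"
  have inter: "1 - (a + b) \<le> P.prob (F \<inter> F')" if "F \<in> sets ?P" "F' \<in> sets ?P" "1 - a \<le> P.prob F" "1 - b \<le> P.prob F'" for F F' a b
  proof -
    have "P.prob (F \<union> F') = P.prob F + P.prob F' - P.prob (F \<inter> F')"
      using that by (simp add: P.finite_measure_Union' P.finite_measure_Diff' Int_commute)
    then show ?thesis using that P.prob_le_1[of "F \<union> F'"] by linarith
  qed
  have "1 - (\<delta> / 2 + \<delta> / 4) \<le> P.prob (E1 \<inter> E2)" by (rule inter[OF E1(1) E2(1) E1(2) E2'])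
  from inter[OF sets.Int[OF E1(1) E2(1)] E3(1) this E3']
  have "1 - (\<delta> / 2 + \<delta> / 4 + \<delta> / 4) \<le> P.prob (E1 \<inter> E2 \<inter> E3)" .
  from inter[OF sets.Int[OF sets.Int[OF E1(1) E2(1)] E3(1)] E4(1) this, of 0]
  have "1 - \<delta> \<le> P.prob E" by (simp add: E4(2) E_def)
  moreover have "E \<in> sets ?P" unfolding E_def using E1(1) E2(1) E3(1) E4(1) by blast
  moreover have "L2norm \<mu> (\<lambda>x. krr \<Phi> l n z \<bullet> \<Phi> x - f_lambda \<mu> \<Phi> fs l \<bullet> \<Phi> x) \<le> 8 * (2 * ln (4 / \<delta>) * sqrt (V / n) + r)"
    if "z \<in> E" for z
    using that E1(3) E2(3) E3(3) E4(3)
    by (intro krr_error_bound[OF l n B(1,2) _ _ tail]) (auto simp: E_def)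
  ultimately show ?thesis using sets.sets_into_space by (intro bexI[of _ E]) auto
qed

end

section \<open>The convergence rate\<close>

lemma eventually_powr_le:
  fixes c e \<epsilon> :: real
  assumes "e < 0" "0 < \<epsilon>"
  shows "\<forall>\<^sub>F n in sequentially. c * real n powr e \<le> \<epsilon>"
proof -
  have "(\<lambda>n. c * real n powr e) \<longlonglongrightarrow> c * 0"
    by (intro tendsto_mult tendsto_const tendsto_neg_powr[OF assms(1)] filterlim_real_sequentially)
  then have "\<forall>\<^sub>F n in sequentially. c * real n powr e < \<epsilon>"
    using assms(2) by (intro order_tendstoD(2)) auto
  then show ?thesis by (rule eventually_mono) simp
qed

context krr_analysis
begin

lemma convergence_rate:
  fixes lamn :: "nat \<Rightarrow> real"
  assumes b: "1 < \<beta>" and C': "0 < C'" and lam_le: "\<And>i. lam i \<le> C' * (real i + 1) powr (- \<beta>)"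
    and s: "0 < s" "s \<le> 2" and A3: "interp_norm_le \<mu> lam e s R fs"
    and A4: "\<forall>m::nat. m \<ge> 2 \<longrightarrow> (AE x in \<mu>. (\<integral>\<^sup>+y. ennreal (\<bar>y - fs x\<bar> ^ m) \<partial>K x)
                 \<le> ennreal (1/2 * fact m * \<sigma>\<^sup>2 * L ^ (m - 2)))"
    and als: "\<alpha> < s + 1 / \<beta>"
    and c12: "0 < c1" "0 < c2"
    and lamn: "\<forall>n\<ge>1. c1 * real n powr (- \<beta> / (s * \<beta> + 1)) \<le> lamn n \<and>
               lamn n \<le> c2 * real n powr (- \<beta> / (s * \<beta> + 1))"
  shows "\<exists>C. \<forall>\<delta>. 0 < \<delta> \<and> \<delta> < 1 \<longrightarrow>
           (\<forall>\<^sub>F n in sequentially.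
              \<exists>E \<in> sets (Pi\<^sub>M {..<n} (\<lambda>_. \<rho>)).
                E \<subseteq> {z \<in> space (Pi\<^sub>M {..<n} (\<lambda>_. \<rho>)).
                       L2norm \<mu> (\<lambda>x. krr \<Phi> (lamn n) n z \<bullet> \<Phi> x - f_lambda \<mu> \<Phi> fs (lamn n) \<bullet> \<Phi> x)
                       \<le> ln (4 / \<delta>) * C * real n powr (- (1/2) * (s * \<beta> / (s * \<beta> + 1)))} \<and>
                measure (Pi\<^sub>M {..<n} (\<lambda>_. \<rho>)) E \<ge> 1 - \<delta>)"
proof -
  \<comment> \<open>The decay exponent of \<open>lamn\<close>. The relation
    \<open>\<gamma> * (s + 1 / \<beta>) = 1\<close> balances the squared bias
    \<open>l powr s\<close> against the variance \<open>l powr (- 1 / \<beta>) / n\<close>.\<close>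
  define \<gamma> where "\<gamma> = \<beta> / (s * \<beta> + 1)"
  have sb: "0 < s * \<beta> + 1" using s b by (simp add: add_pos_pos)
  have g0: "0 < \<gamma>" using b sb by (simp add: \<gamma>_def)
  have g_inv: "\<gamma> * (s + 1 / \<beta>) = 1"
  proof -
    have "s + 1 / \<beta> = (s * \<beta> + 1) / \<beta>" using b by (simp add: field_simps)
    then show ?thesis using b sb by (simp add: \<gamma>_def)
  qed
  have ga: "\<gamma> * \<alpha> < 1" using mult_strict_left_mono[OF als g0] g_inv by simp
  have gb: "\<gamma> / \<beta> - 1 = - (s * \<beta> / (s * \<beta> + 1))" 
  proof -
    have "\<gamma> / \<beta> = 1 / (s * \<beta> + 1)" using b by (simp add: \<gamma>_def)
    moreover have "1 = (s * \<beta> + 1) / (s * \<beta> + 1)" using sb by simp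
    ultimately have "\<gamma> / \<beta> - 1 = (1 - (s * \<beta> + 1)) / (s * \<beta> + 1)" by (simp only: diff_divide_distrib)
    then show ?thesis by simp
  qed
  define D where "D = (C' powr (1 / \<beta>) + c2 powr (1 / \<beta>)) * (1 + (\<Sum>k. real k powr (- \<beta>)))"
  have D0: "0 < D"
  proof -
    have "summable (\<lambda>k. real k powr (- \<beta>))" using b by (simp add: summable_real_powr_iff)
    then have "0 \<le> (\<Sum>k. real k powr (- \<beta>))" by (intro suminf_nonneg) auto
    then show ?thesis using C' c12 unfolding D_def by (intro mult_pos_pos add_pos_nonneg) auto
  qed
  \<comment> \<open>The added 1 keeps W, and with it the noise scale, positive when \<sigma> is
    0.\<close>
  define W where "W = (\<sigma>\<^sup>2 + 1) * D"
  have W0: "0 < W" using D0 by (simp add: W_def add_nonneg_pos)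
  define V where "V n = W * lamn n powr (- 1 / \<beta>)" for n
  define B0 where "B0 = 1 + A\<^sup>2 * c1 powr (- \<alpha>)"
  define B where "B n = B0 * real n powr (\<gamma> * \<alpha>)" for n :: nat
  \<comment> \<open>With dimension \<open>n ^ g\<close> the tail decays like
    \<open>n powr (- (g * \<beta> * (1 - \<alpha>)))\<close>, faster than the regularisation
    parameter.\<close>
  obtain g :: nat where g: "\<gamma> / (\<beta> * (1 - \<alpha>)) < real g" using reals_Archimedean2 by blast
  \<comment> \<open>The moment of order \<open>2 ^ p\<close> gains
    \<open>n powr ((\<gamma> * \<alpha> - 1) * 2 ^ p)\<close>, which has to beat the dimension
    \<open>n ^ g\<close>.\<close>
  obtain p :: nat where p: "real g / (1 - \<gamma> * \<alpha>) < 2 ^ p" using real_arch_pow[of 2] by auto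
  \<comment> \<open>The approximation part is allowed the size r of the noise scale;
    \<open>8 * (2 * ln (4 / \<delta>) + 1) \<le> 24 * ln (4 / \<delta>)\<close> because the
    logarithm is at least 1.\<close>
  define C where "C = 24 * sqrt (W * c1 powr (- 1 / \<beta>))"
  have lb: "c1 * real n powr (- \<gamma>) \<le> lamn n" and ub: "lamn n \<le> c2 * real n powr (- \<gamma>)" if "1 \<le> n" for n
    using lamn that by (auto simp: \<gamma>_def)
  have lpos: "0 < lamn n" if "1 \<le> n" for n
    using lb[OF that] c12 that by (intro less_le_trans[OF _ lb[OF that]]) auto
  have lneg: "lamn n powr (- a) \<le> c1 powr (- a) * real n powr (\<gamma> * a)" if "1 \<le> n" "0 \<le> a" for n a
  proof -
    have "lamn n powr (- a) \<le> (c1 * real n powr (- \<gamma>)) powr (- a)"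
      using lb[OF that(1)] c12 that by (intro powr_mono2') auto
    then show ?thesis using c12 by (simp add: powr_mult powr_powr)
  qed
  have lneg': "c2 powr (- a) * real n powr (\<gamma> * a) \<le> lamn n powr (- a)" if "1 \<le> n" "0 \<le> a" for n a
  proof -
    have "(c2 * real n powr (- \<gamma>)) powr (- a) \<le> lamn n powr (- a)"
      using ub[OF that(1)] lpos[OF that(1)] that by (intro powr_mono2') auto
    then show ?thesis using c12 by (simp add: powr_mult powr_powr)
  qed
  have lub: "lamn n \<le> c2" if "1 \<le> n" for n
  proof -
    have "real n powr (- \<gamma>) \<le> 1 powr (- \<gamma>)" using that g0 by (intro powr_mono2') auto
    then have "c2 * real n powr (- \<gamma>) \<le> c2 * 1" using c12 by (intro mult_left_mono) auto
    then show ?thesis using ub[OF that] by simp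
  qed
  have Vpos: "0 < V n" if "1 \<le> n" for n using W0 lpos[OF that] by (simp add: V_def)
  have dim: "\<sigma>\<^sup>2 * (\<Sum>j<M. lam j / (lam j + lamn n)) \<le> V n" if "1 \<le> n" for n M
  proof -
    have "(\<Sum>j<M. lam j / (lam j + lamn n)) \<le> D * lamn n powr (- 1 / \<beta>)"
      unfolding D_def by (rule effective_dimension[OF lam_pos lam_le b C' lpos[OF that] lub[OF that]])
    then have "\<sigma>\<^sup>2 * (\<Sum>j<M. lam j / (lam j + lamn n)) \<le> \<sigma>\<^sup>2 * (D * lamn n powr (- 1 / \<beta>))"
      by (intro mult_left_mono) auto
    also have "\<dots> \<le> V n" using D0 by (simp add: V_def W_def algebra_simps)
    finally show ?thesis .
  qed
  have ev_small: "\<forall>\<^sub>F n in sequentially. \<bar>A\<bar> * lamn n powr (- \<alpha> / 2) * \<bar>L\<bar> / sqrt (n * V n) \<le> 1 / 2"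
  proof -
    define c where "c = \<bar>A\<bar> * c1 powr (- \<alpha> / 2) * \<bar>L\<bar> / sqrt (W * c2 powr (- 1 / \<beta>))"
    have "\<gamma> * \<alpha> / 2 - (1 + \<gamma> / \<beta>) / 2 < 0"
    proof -
      have "\<gamma> * \<alpha> < 1 + \<gamma> / \<beta>" using ga g0 b by (intro less_trans[OF ga]) auto
      then show ?thesis by simp
    qed
    then have "\<forall>\<^sub>F n in sequentially. c * real n powr (\<gamma> * \<alpha> / 2 - (1 + \<gamma> / \<beta>) / 2) \<le> 1 / 2"
      by (rule eventually_powr_le) simp
    then show ?thesis using eventually_ge_at_top[of 1]
    proof eventually_elim
      case (elim n)
      then have n: "1 \<le> n" "0 < real n" by auto
      have "(W * c2 powr (- 1 / \<beta>)) * real n powr (1 + \<gamma> / \<beta>) = n * (W * (c2 powr (- (1 / \<beta>)) * real n powr (\<gamma> * (1 / \<beta>))))"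
        using n by (simp add: powr_add)
      also have "\<dots> \<le> n * V n"
        unfolding V_def using lneg'[OF n(1), of "1 / \<beta>"] b W0 by (intro mult_left_mono) auto
      finally have "sqrt ((W * c2 powr (- 1 / \<beta>)) * real n powr (1 + \<gamma> / \<beta>)) \<le> sqrt (n * V n)"
        by (rule real_sqrt_le_mono)
      then have den: "sqrt (W * c2 powr (- 1 / \<beta>)) * real n powr ((1 + \<gamma> / \<beta>) / 2) \<le> sqrt (n * V n)"
        by (simp add: real_sqrt_mult powr_half_sqrt[symmetric] powr_powr)
      have ln2: "lamn n powr (- \<alpha> / 2) \<le> c1 powr (- \<alpha> / 2) * real n powr (\<gamma> * \<alpha> / 2)"
        using lneg[OF n(1), of "\<alpha> / 2"] alpha by simp
      have num: "\<bar>A\<bar> * lamn n powr (- \<alpha> / 2) * \<bar>L\<bar> \<le> \<bar>A\<bar> * (c1 powr (- \<alpha> / 2) * real n powr (\<gamma> * \<alpha> / 2)) * \<bar>L\<bar>"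
        by (intro mult_right_mono mult_left_mono ln2) simp_all
      have pos: "0 < sqrt (W * c2 powr (- 1 / \<beta>)) * real n powr ((1 + \<gamma> / \<beta>) / 2)"
        using W0 c12(2) n(2) by simp
      have "\<bar>A\<bar> * lamn n powr (- \<alpha> / 2) * \<bar>L\<bar> / sqrt (n * V n)
         \<le> \<bar>A\<bar> * (c1 powr (- \<alpha> / 2) * real n powr (\<gamma> * \<alpha> / 2)) * \<bar>L\<bar> / (sqrt (W * c2 powr (- 1 / \<beta>)) * real n powr ((1 + \<gamma> / \<beta>) / 2))"
        by (rule frac_le[OF _ num pos den]) simp
      also have "\<dots> = c * real n powr (\<gamma> * \<alpha> / 2 - (1 + \<gamma> / \<beta>) / 2)"
        by (simp add: c_def powr_diff)
      finally show ?case using elim(1) by (rule order_trans)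
    qed
  qed
  have ev_bias: "\<forall>\<^sub>F n in sequentially. 3 * A\<^sup>2 * R\<^sup>2 * lamn n powr (s - \<alpha>) / (n * (sqrt (V n / n))\<^sup>2) \<le> \<delta> / 4"
    if "0 < \<delta>" for \<delta>
  proof -
    \<comment> \<open>The exponent gained by approximation over noise. Since it is positive, the
      Chebyshev bound drops below any fixed \<delta>, while \<delta> affects only how large n must
      be.\<close>
    define \<eta> where "\<eta> = s + 1 / \<beta> - \<alpha>"
    have eta: "0 < \<eta>" using als by (simp add: \<eta>_def)
    have "\<forall>\<^sub>F n in sequentially. (3 * A\<^sup>2 * R\<^sup>2 / W * c2 powr \<eta>) * real n powr (- (\<gamma> * \<eta>)) \<le> \<delta> / 4"
      using eta g0 that by (intro eventually_powr_le) auto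
    then show ?thesis using eventually_ge_at_top[of 1]
    proof eventually_elim
      case (elim n)
      then have n: "1 \<le> n" "0 < real n" by auto
      have l: "0 < lamn n" by (rule lpos[OF n(1)])
      have "0 \<le> V n / n" using Vpos[OF n(1)] n by simp
      then have "n * (sqrt (V n / n))\<^sup>2 = V n" using n by (simp only: real_sqrt_pow2) simp
      then have "3 * A\<^sup>2 * R\<^sup>2 * lamn n powr (s - \<alpha>) / (n * (sqrt (V n / n))\<^sup>2)
          = 3 * A\<^sup>2 * R\<^sup>2 / W * (lamn n powr (s - \<alpha>) / lamn n powr (- 1 / \<beta>))"
        by (simp add: V_def)
      also have "lamn n powr (s - \<alpha>) / lamn n powr (- 1 / \<beta>) = lamn n powr (s - \<alpha> - (- 1 / \<beta>))"
        by (rule powr_diff[symmetric])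
      also have "s - \<alpha> - (- 1 / \<beta>) = \<eta>" by (simp add: \<eta>_def)
      also have "3 * A\<^sup>2 * R\<^sup>2 / W * lamn n powr \<eta> \<le> 3 * A\<^sup>2 * R\<^sup>2 / W * (c2 * real n powr (- \<gamma>)) powr \<eta>"
        using ub[OF n(1)] l eta W0 by (intro mult_left_mono powr_mono2) auto
      also have "\<dots> = (3 * A\<^sup>2 * R\<^sup>2 / W * c2 powr \<eta>) * real n powr (- (\<gamma> * \<eta>))"
        using c12 by (simp add: powr_mult powr_powr)
      finally show ?case using elim(1) by linarith
    qed
  qed
  have B0_ge: "1 \<le> B0" by (simp add: B0_def)
  have B_ge1: "1 \<le> B n" if "1 \<le> n" for n
  proof -
    have "1 \<le> real n powr (\<gamma> * \<alpha>)" using that g0 alpha by (intro ge_one_powr_ge_zero) auto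
    then have "1 * 1 \<le> B0 * real n powr (\<gamma> * \<alpha>)" using B0_ge by (intro mult_mono) auto
    then show ?thesis by (simp add: B_def)
  qed
  have B_ge: "A\<^sup>2 * lamn n powr (- \<alpha>) \<le> B n" if "1 \<le> n" for n
  proof -
    have "A\<^sup>2 * lamn n powr (- \<alpha>) \<le> A\<^sup>2 * (c1 powr (- \<alpha>) * real n powr (\<gamma> * \<alpha>))"
      using lneg[OF that, of \<alpha>] alpha by (intro mult_left_mono) auto
    also have "\<dots> = (A\<^sup>2 * c1 powr (- \<alpha>)) * real n powr (\<gamma> * \<alpha>)" by simp
    also have "\<dots> \<le> B n" unfolding B_def B0_def by (intro mult_right_mono) auto
    finally show ?thesis .
  qed
  have ev_B: "\<forall>\<^sub>F n in sequentially. B n \<le> n"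
  proof -
    have "\<forall>\<^sub>F n in sequentially. B0 * real n powr (\<gamma> * \<alpha> - 1) \<le> 1"
      using ga by (intro eventually_powr_le) auto
    then show ?thesis using eventually_ge_at_top[of 1]
    proof eventually_elim
      case (elim n)
      then show ?case by (simp add: B_def powr_diff divide_le_eq)
    qed
  qed
  have ev_op: "\<forall>\<^sub>F n in sequentially. moment_const (2 ^ p) * (n * B n) ^ (2 ^ p) * real (n ^ g) / (n / 8) ^ (2 * 2 ^ p) \<le> \<delta> / 4"
    if "0 < \<delta>" for \<delta>
  proof -
    define P where "P = (2 ^ p :: nat)"
    have "(\<gamma> * \<alpha> - 1) * real P + real g < 0"
      using p ga by (simp add: P_def divide_less_eq algebra_simps)
    then have "\<forall>\<^sub>F n in sequentially. (moment_const P * (64 * B0) ^ P) * real n powr ((\<gamma> * \<alpha> - 1) * real P + real g) \<le> \<delta> / 4"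
      using that by (intro eventually_powr_le) auto
    then show ?thesis using eventually_ge_at_top[of 1]
    proof eventually_elim
      case (elim n)
      then have n: "0 < real n" by auto
      have "(n * B n) ^ P / (n / 8) ^ (2 * P) = (n * B n / (n / 8)\<^sup>2) ^ P"
        by (simp add: power_mult power_divide)
      also have "n * B n / (n / 8)\<^sup>2 = 64 * B0 * real n powr (\<gamma> * \<alpha> - 1)"
        using n by (simp add: B_def powr_diff power2_eq_square field_simps)
      also have "(64 * B0 * real n powr (\<gamma> * \<alpha> - 1)) ^ P = (64 * B0) ^ P * real n powr ((\<gamma> * \<alpha> - 1) * real P)"
        using n by (simp add: power_mult_distrib powr_realpow[symmetric] powr_powr)
      finally have quot: "(n * B n) ^ P / (n / 8) ^ (2 * P) = (64 * B0) ^ P * real n powr ((\<gamma> * \<alpha> - 1) * real P)" .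
      have "moment_const P * (n * B n) ^ P * real (n ^ g) / (n / 8) ^ (2 * P)
         = moment_const P * ((n * B n) ^ P / (n / 8) ^ (2 * P)) * real n ^ g" by simp
      also have "\<dots> = moment_const P * ((64 * B0) ^ P * real n powr ((\<gamma> * \<alpha> - 1) * real P)) * real n ^ g"
        by (simp only: quot)
      also have "\<dots> = (moment_const P * (64 * B0) ^ P) * real n powr ((\<gamma> * \<alpha> - 1) * real P + real g)"
        using n by (simp add: powr_add powr_realpow)
      finally show ?case using elim(1) by (simp add: P_def)
    qed
  qed
  have ev_tail: "\<forall>\<^sub>F n in sequentially. lam (n ^ g) powr (1 - \<alpha>) * A\<^sup>2 \<le> lamn n / 24"
  proof -
    have "\<gamma> < real g * (\<beta> * (1 - \<alpha>))" using g b alpha by (simp add: divide_less_eq)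
    then have "\<forall>\<^sub>F n in sequentially. (C' powr (1 - \<alpha>) * A\<^sup>2) * real n powr (\<gamma> - real g * (\<beta> * (1 - \<alpha>))) \<le> c1 / 24"
      using c12 by (intro eventually_powr_le) auto
    then show ?thesis using eventually_ge_at_top[of 1]
    proof eventually_elim
      case (elim n)
      then have n: "1 \<le> n" "0 < real n" by auto
      have "lam (n ^ g) \<le> C' * (real (n ^ g) + 1) powr (- \<beta>)" by (rule lam_le)
      also have "\<dots> \<le> C' * (real n powr real g) powr (- \<beta>)"
        using n b C' by (intro mult_left_mono powr_mono2') (auto simp: powr_realpow)
      finally have "lam (n ^ g) powr (1 - \<alpha>) * A\<^sup>2 \<le> (C' * (real n powr real g) powr (- \<beta>)) powr (1 - \<alpha>) * A\<^sup>2"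
        using alpha lam_pos[of "n ^ g"] by (intro mult_right_mono powr_mono2) auto
      also have "\<dots> = (C' powr (1 - \<alpha>) * A\<^sup>2) * real n powr (\<gamma> - real g * (\<beta> * (1 - \<alpha>))) * real n powr (- \<gamma>)"
      proof -
        have "real n powr (- (real g * \<beta> * (1 - \<alpha>))) = real n powr (\<gamma> - real g * (\<beta> * (1 - \<alpha>))) * real n powr (- \<gamma>)"
          by (simp add: powr_add[symmetric] mult.assoc)
        then show ?thesis using C' by (simp add: powr_mult powr_powr)
      qed
      also have "\<dots> \<le> c1 / 24 * real n powr (- \<gamma>)" using elim(1) by (intro mult_right_mono) auto
      also have "\<dots> \<le> lamn n / 24" using lb[OF n(1)] by simp
      finally show ?case .
    qed
  qed
  have rate: "sqrt (V n / n) \<le> sqrt (W * c1 powr (- 1 / \<beta>)) * real n powr (- (1/2) * (s * \<beta> / (s * \<beta> + 1)))" if n: "1 \<le> n" for n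
  proof -
    have "V n / n \<le> (W * (c1 powr (- (1 / \<beta>)) * real n powr (\<gamma> * (1 / \<beta>)))) / n"
      unfolding V_def using lneg[OF n, of "1 / \<beta>"] b W0 by (intro divide_right_mono mult_left_mono) auto
    also have "\<dots> = W * c1 powr (- 1 / \<beta>) * real n powr (\<gamma> / \<beta> - 1)" using n by (simp add: powr_diff)
    finally have "sqrt (V n / n) \<le> sqrt (W * c1 powr (- 1 / \<beta>) * real n powr (\<gamma> / \<beta> - 1))" by (rule real_sqrt_le_mono)
    also have "\<dots> = sqrt (W * c1 powr (- 1 / \<beta>)) * real n powr ((\<gamma> / \<beta> - 1) / 2)"
      by (simp add: real_sqrt_mult powr_half_sqrt[symmetric] powr_powr)
    also have "(\<gamma> / \<beta> - 1) / 2 = - (1/2) * (s * \<beta> / (s * \<beta> + 1))" by (simp add: gb)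
    finally show ?thesis .
  qed
  show ?thesis
  proof (intro exI[of _ C] allI impI)
    fix \<delta> :: real assume d: "0 < \<delta> \<and> \<delta> < 1"
    have ln1: "1 \<le> ln (4 / \<delta>)"
    proof -
      have "exp 1 \<le> (3::real)" by (rule exp_le)
      also have "3 \<le> 4 / \<delta>" using d by (simp add: le_divide_eq)
      finally show ?thesis using d by (subst ln_ge_iff) auto
    qed
    show "\<forall>\<^sub>F n in sequentially.
              \<exists>E \<in> sets (Pi\<^sub>M {..<n} (\<lambda>_. \<rho>)).
                E \<subseteq> {z \<in> space (Pi\<^sub>M {..<n} (\<lambda>_. \<rho>)).
                       L2norm \<mu> (\<lambda>x. krr \<Phi> (lamn n) n z \<bullet> \<Phi> x - f_lambda \<mu> \<Phi> fs (lamn n) \<bullet> \<Phi> x)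
                       \<le> ln (4 / \<delta>) * C * real n powr (- (1/2) * (s * \<beta> / (s * \<beta> + 1)))} \<and>
                measure (Pi\<^sub>M {..<n} (\<lambda>_. \<rho>)) E \<ge> 1 - \<delta>"
      using ev_small ev_bias[of \<delta>, OF conjunct1[OF d]] ev_B ev_op[of \<delta>, OF conjunct1[OF d]] ev_tail eventually_ge_at_top[of 1]
    proof eventually_elim
      case (elim n)
      then have n: "1 \<le> n" "0 < n" by auto
      have r: "0 < sqrt (V n / n)" using Vpos[OF n(1)] n by simp
      from error_event[OF lpos[OF n(1)] n(2) _ _ Vpos[OF n(1)] r s A3 A4 dim[OF n(1)] elim(1) elim(2)
          B_ge1[OF n(1)] B_ge[OF n(1)] elim(3) elim(4) elim(5)] d
      obtain E where E: "E \<in> sets (Pi\<^sub>M {..<n} (\<lambda>_. \<rho>))"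
        "E \<subseteq> {z \<in> space (Pi\<^sub>M {..<n} (\<lambda>_. \<rho>)).
          L2norm \<mu> (\<lambda>x. krr \<Phi> (lamn n) n z \<bullet> \<Phi> x - f_lambda \<mu> \<Phi> fs (lamn n) \<bullet> \<Phi> x)
            \<le> 8 * (2 * ln (4 / \<delta>) * sqrt (V n / n) + sqrt (V n / n))}"
        "1 - \<delta> \<le> measure (Pi\<^sub>M {..<n} (\<lambda>_. \<rho>)) E"
        by blast
      have "8 * (2 * ln (4 / \<delta>) * sqrt (V n / n) + sqrt (V n / n)) \<le> ln (4 / \<delta>) * 24 * sqrt (V n / n)"
        using mult_right_mono[OF ln1, of "sqrt (V n / n)"] r by (simp add: algebra_simps)
      also have "\<dots> \<le> ln (4 / \<delta>) * 24 * (sqrt (W * c1 powr (- 1 / \<beta>)) * real n powr (- (1/2) * (s * \<beta> / (s * \<beta> + 1))))"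
        using rate[OF n(1)] ln1 by (intro mult_left_mono) auto
      also have "\<dots> = ln (4 / \<delta>) * C * real n powr (- (1/2) * (s * \<beta> / (s * \<beta> + 1)))" by (simp add: C_def)
      finally show ?case using E by (intro bexI[of _ E]) auto
    qed
  qed
qed

end

theorem mainTheorem5:
  fixes X :: "'a::euclidean_space set"
    and k :: "'a \<Rightarrow> 'a \<Rightarrow> real" and \<kappa> :: real
    and \<Phi> :: "'a \<Rightarrow> 'h::{real_inner,complete_space,second_countable_topology}"
    and \<rho> :: "('a \<times> real) measure" and K :: "'a \<Rightarrow> real measure"
    and lam :: "nat \<Rightarrow> real" and e :: "nat \<Rightarrow> 'a \<Rightarrow> real"
    and \<beta> c C' s R \<sigma> L q :: real
    and lamn :: "nat \<Rightarrow> real" and c1 c2 :: real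
  assumes rho: "prob_space \<rho>" "sets \<rho> = sets (restrict_space borel (X \<times> UNIV))"
    and second_moment: "integrable \<rho> (\<lambda>(x, y). y\<^sup>2)"
    and disint: "disintegration \<rho> X K"
    and kernel_cont: "continuous_on (X \<times> X) (\<lambda>(x, y). k x y)"
    and kernel_bdd: "\<forall>x\<in>X. k x x \<le> \<kappa>\<^sup>2"
    and rkhs: "rkhs_model X k \<Phi>"
    and spec: "spectral_decomp (marginal \<rho> X) k lam e"
    and A1: "\<beta> > 1" "c > 0" "C' > 0"
            "\<forall>i. c * (real i + 1) powr (-\<beta>) \<le> lam i \<and> lam i \<le> C' * (real i + 1) powr (-\<beta>)"
    and A3: "interp_norm_le (marginal \<rho> X) lam e s R (regfun K)"
    and A4: "\<forall>m::nat. m \<ge> 2 \<longrightarrow> (AE x in marginal \<rho> X.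
               (\<integral>\<^sup>+y. ennreal (\<bar>y - regfun K x\<bar> ^ m) \<partial>K x)
                 \<le> ennreal (1/2 * fact m * \<sigma>\<^sup>2 * L ^ (m - 2)))"
    and s: "0 < s" "s \<le> 2"
    and a0: "1 / \<beta> \<le> alpha0 (marginal \<rho> X) lam e \<beta>" "alpha0 (marginal \<rho> X) lam e \<beta> < 1"
            "s + 1 / \<beta> > alpha0 (marginal \<rho> X) lam e \<beta>"
    and Lq: "(\<integral>\<^sup>+x. ennreal (\<bar>regfun K x\<bar> powr q) \<partial>marginal \<rho> X) < \<infinity>"
    and q: "q > 2 * (s * \<beta> + 1) / (2 + (s - alpha0 (marginal \<rho> X) lam e \<beta>) * \<beta>)"
    and lamn: "c1 > 0" "c2 > 0"
       "\<forall>n\<ge>1. c1 * real n powr (- \<beta> / (s * \<beta> + 1)) \<le> lamn n \<and>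
               lamn n \<le> c2 * real n powr (- \<beta> / (s * \<beta> + 1))"
  shows "\<exists>C. \<forall>\<delta>. 0 < \<delta> \<and> \<delta> < 1 \<longrightarrow>
           (\<forall>\<^sub>F n in sequentially.
              \<exists>E \<in> sets (Pi\<^sub>M {..<n} (\<lambda>_. \<rho>)).
                E \<subseteq> {z \<in> space (Pi\<^sub>M {..<n} (\<lambda>_. \<rho>)).
                       L2norm (marginal \<rho> X)
                         (\<lambda>x. krr \<Phi> (lamn n) n z \<bullet> \<Phi> x
                              - f_lambda (marginal \<rho> X) \<Phi> (regfun K) (lamn n) \<bullet> \<Phi> x)
                       \<le> ln (4 / \<delta>) * C * real n powr (- (1/2) * (s * \<beta> / (s * \<beta> + 1)))} \<and>
                measure (Pi\<^sub>M {..<n} (\<lambda>_. \<rho>)) E \<ge> 1 - \<delta>)"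
proof -
  interpret prob_space \<rho> by (rule rho(1))
  interpret rkhs_setting \<rho> X K k \<kappa> \<Phi> lam e
    by unfold_locales fact+
  let ?S = "{\<alpha>. 1 / \<beta> \<le> \<alpha> \<and> \<alpha> \<le> 1 \<and> M_finite \<mu> lam e \<alpha>}"
  \<comment> \<open>Bessel's inequality and boundedness of the kernel make exponent 1 admissible.
    Without a member of the set its infimum would carry no information.\<close>
  have "M_finite \<mu> lam e 1"
    unfolding M_finite_def
  proof (intro exI[of _ "\<bar>\<kappa>\<bar>"])
    show "AE x in \<mu>. \<forall>m. (\<Sum>i<m. lam i powr 1 * (e i x)\<^sup>2) \<le> \<bar>\<kappa>\<bar>\<^sup>2"
      using hb_Phi_all AE_space
    proof eventually_elim
      case (elim x)
      show ?case
      proof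
        fix m
        have "(\<Sum>i<m. lam i powr 1 * (e i x)\<^sup>2) = (\<Sum>i<m. (\<Phi> x \<bullet> hb i)\<^sup>2)"
          using elim(1) lam_pos by (intro sum.cong) (auto simp: inner_commute power_mult_distrib less_imp_le)
        also have "\<dots> \<le> (norm (\<Phi> x))\<^sup>2" by (rule hb.bessel)
        also have "\<dots> \<le> \<bar>\<kappa>\<bar>\<^sup>2" using norm_Phi[of x] elim(2) by (intro power_mono) (auto simp: space_mu)
        finally show "(\<Sum>i<m. lam i powr 1 * (e i x)\<^sup>2) \<le> \<bar>\<kappa>\<bar>\<^sup>2" .
      qed
    qed
  qed
  then have ne: "?S \<noteq> {}" using A1(1) by (intro ex_in_conv[THEN iffD1] exI[of _ 1]) simp
  \<comment> \<open>Both strict bounds pass from the infimum to an admissible exponent near it, for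
    which a finite constant is available.\<close>
  have "Inf ?S < min 1 (s + 1 / \<beta>)" using a0 by (simp add: alpha0_def)
  from cInf_lessD[OF ne this] obtain \<alpha> where al: "\<alpha> \<in> ?S" "\<alpha> < min 1 (s + 1 / \<beta>)" ..
  then obtain A where A: "AE x in \<mu>. \<forall>m. (\<Sum>i<m. lam i powr \<alpha> * (e i x)\<^sup>2) \<le> A\<^sup>2"
    by (auto simp: M_finite_def)
  have "0 < 1 / \<beta>" using A1(1) by simp
  moreover have "1 / \<beta> \<le> \<alpha>" using al(1) by simp
  ultimately have \<alpha>: "0 < \<alpha>" "\<alpha> < 1" "\<alpha> < s + 1 / \<beta>"
    using al(2) by linarith+
  have "AE x in \<mu>. proj (\<Phi> x) = \<Phi> x \<and> (\<forall>m. (\<Sum>i<m. lam i powr (\<alpha> - 1) * (hb i \<bullet> \<Phi> x)\<^sup>2) \<le> A\<^sup>2)"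
    using A AE_proj_Phi hb_Phi_all
  proof eventually_elim
    case (elim x)
    have "lam i powr (\<alpha> - 1) * (hb i \<bullet> \<Phi> x)\<^sup>2 = lam i powr \<alpha> * (e i x)\<^sup>2" for i
    proof -
      have "(hb i \<bullet> \<Phi> x)\<^sup>2 = lam i * (e i x)\<^sup>2"
        using elim(3) lam_pos[of i] by (simp add: power_mult_distrib)
      moreover have "lam i powr (\<alpha> - 1) * lam i = lam i powr \<alpha>"
        using lam_pos[of i] by (simp add: powr_diff)
      ultimately show ?thesis by (simp add: mult.assoc[symmetric])
    qed
    then show ?case using elim by simp
  qed
  \<comment> \<open>The exceptional set need not be measurable; it is enclosed in a measurable null
    set, whose complement serves as G.\<close>
  then obtain N where N: "{x\<in>space \<mu>. \<not> (proj (\<Phi> x) = \<Phi> x \<and> (\<forall>m. (\<Sum>i<m. lam i powr (\<alpha> - 1) * (hb i \<bullet> \<Phi> x)\<^sup>2) \<le> A\<^sup>2))} \<subseteq> N"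
    "emeasure \<mu> N = 0" "N \<in> sets \<mu>"
    by (rule AE_E)
  interpret krr_analysis \<rho> X K k \<kappa> \<Phi> lam e \<alpha> A "space \<mu> - N"
  proof
    show "AE x in \<mu>. x \<in> space \<mu> - N"
      using N by (intro AE_I[of _ _ N]) auto
  qed (use \<alpha> N in auto)
  show ?thesis
    using A1(4) by (intro convergence_rate[OF A1(1) A1(3) _ s A3 A4 \<alpha>(3) lamn]) blast
qed

end
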